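(* Let $\epsilon>0$. There are constants $C_1>0$ and $C_0$ such that for all sufficiently large $n$, every positive integer $\delta<(2-\epsilon)\log n$, and all sufficiently large $K$ (depending on $n$ and $\delta$): if $X_1,\ldots,X_n$ is an arrangement of $n$ pebbles on the $K\times K$ grid in the unit square satisfying \[ C(X_1,\ldots,X_n \mid n,K) \ \ge\ \log \binom{K^2}{n} - \delta, \] then some triangle whose vertices are three of the pebbles has area at most \[ A(\delta)=\frac{14\delta + C_0}{4C_1 n^3 \log e}. \]
   Context: The $K\times K$ grid in the unit square $[0,1]^2$ is the set of points $(i/(K-1), j/(K-1))$ with $i,j\in\{0,\ldots,K-1\}$. An arrangement of $n$ pebbles is a set of $n$ distinct grid points (unlabeled, at most one per grid point), encoded as a binary string in a fixed natural way. $C(x\mid y)$ denotes the conditional (plain) Kolmogorov complexity of $x$ given $y$ with respect to a fixed reference universal Turing machine. $\log$ is the binary logarithm. *)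

theory Defs
  imports "HOL-Analysis.Analysis"
begin

section \<open>Turing machines\<close>

text \<open>
  Deterministic Turing machines with finitely many two-way infinite tapes. States and tape symbols
  are initial segments of the natural numbers; \<open>0\<close> is the start state and the blank symbol,
  and the symbols \<open>1\<close> and \<open>2\<close> stand for the bits 0 and 1. The machine halts when its
  transition function yields \<open>None\<close>.
  Tape \<open>0\<close> holds the program, tape \<open>1\<close> the conditional information, and the result is
  read off tape \<open>2\<close>; any further tapes are work tapes.
\<close>

datatype move = Move_Left | Stay | Move_Right

record tm =
  tm_states :: nat
  tm_symbols :: nat
  tm_tapes :: nat
  tm_trans :: "nat \<Rightarrow> nat list \<Rightarrow> (nat \<times> (nat \<times> move) list) option"

definition wf_tm :: "tm \<Rightarrow> bool" where
  "wf_tm M \<longleftrightarrow> 0 < tm_states M \<and> 3 \<le> tm_symbols M \<and> 3 \<le> tm_tapes M \<and>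
     (\<forall>q s q' ws. q < tm_states M \<longrightarrow> length s = tm_tapes M \<longrightarrow> set s \<subseteq> {..<tm_symbols M} \<longrightarrow>
        tm_trans M q s = Some (q', ws) \<longrightarrow>
        q' < tm_states M \<and> length ws = tm_tapes M \<and> fst ` set ws \<subseteq> {..<tm_symbols M})"

text \<open>A tape is its contents together with the position of the head.\<close>

type_synonym tape = "(int \<Rightarrow> nat) \<times> int"

type_synonym config = "nat \<times> tape list"

definition tape_read :: "tape \<Rightarrow> nat" where
  "tape_read t = fst t (snd t)"

fun shift :: "move \<Rightarrow> int" where
  "shift Move_Left = -1"
| "shift Stay = 0"
| "shift Move_Right = 1"

definition tape_act :: "nat \<times> move \<Rightarrow> tape \<Rightarrow> tape" where
  "tape_act a t = ((fst t)(snd t := fst a), snd t + shift (snd a))"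

definition tm_step :: "tm \<Rightarrow> config \<Rightarrow> config option" where
  "tm_step M c = map_option (\<lambda>(q', ws). (q', map2 tape_act ws (snd c)))
                            (tm_trans M (fst c) (map tape_read (snd c)))"

definition bit_symbol :: "bool \<Rightarrow> nat" where
  "bit_symbol b = (if b then 2 else 1)"

definition input_tape :: "bool list \<Rightarrow> tape" where
  "input_tape x =
     ((\<lambda>i. if 0 \<le> i \<and> i < int (length x) then bit_symbol (x ! nat i) else 0), 0)"

definition tm_init :: "tm \<Rightarrow> bool list \<Rightarrow> bool list \<Rightarrow> config" where
  "tm_init M p y = (0, input_tape p # input_tape y # replicate (tm_tapes M - 2) (input_tape []))"

text \<open>The output is the bit string starting in cell \<open>0\<close> and ended by the first blank.\<close>

definition tape_output :: "tape \<Rightarrow> bool list \<Rightarrow> bool" where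
  "tape_output t x \<longleftrightarrow>
     (\<forall>i<length x. fst t (int i) = bit_symbol (x ! i)) \<and> fst t (int (length x)) = 0"

definition tm_computes :: "tm \<Rightarrow> bool list \<Rightarrow> bool list \<Rightarrow> bool list \<Rightarrow> bool" where
  "tm_computes M p y x \<longleftrightarrow>
     (\<exists>c. (\<lambda>c c'. tm_step M c = Some c')\<^sup>*\<^sup>* (tm_init M p y) c \<and>
          tm_step M c = None \<and> tape_output (snd c ! 2) x)"


section \<open>Plain conditional Kolmogorov complexity\<close>

text \<open>
  A universal machine simulates every machine \<open>M\<close> once the program is prefixed with a
  description \<open>q\<close> of \<open>M\<close>.
\<close>

definition universal_tm :: "tm \<Rightarrow> bool" where
  "universal_tm U \<longleftrightarrow> wf_tm U \<and>
     (\<forall>M. wf_tm M \<longrightarrow> (\<exists>q. \<forall>p y x. tm_computes U (q @ p) y x \<longleftrightarrow> tm_computes M p y x))"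

text \<open>If \<open>U\<close> is universal, the minimum is over a nonempty set of program lengths.\<close>

definition kolmogorov :: "tm \<Rightarrow> bool list \<Rightarrow> bool list \<Rightarrow> nat" where
  "kolmogorov U x y = (LEAST l. \<exists>p. length p = l \<and> tm_computes U p y x)"


section \<open>Encoding of numbers\<close>

text \<open>Binary expansion, most significant bit first; \<open>0\<close> is the empty string.\<close>

fun bin_nat :: "nat \<Rightarrow> bool list" where
  "bin_nat n = (if n = 0 then [] else bin_nat (n div 2) @ [odd n])"

declare bin_nat.simps [simp del]

text \<open>The pairing that turns \<open>x, y\<close> into \<open>1\<^sup>l0xy\<close>, where \<open>l\<close> is the length of \<open>x\<close>.\<close>

definition encode_pair :: "nat \<Rightarrow> nat \<Rightarrow> bool list" where
  "encode_pair m n =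
     replicate (length (bin_nat m)) True @ False # bin_nat m @ bin_nat n"


section \<open>Pebbles on the grid\<close>

definition grid_point :: "nat \<Rightarrow> nat \<Rightarrow> nat \<Rightarrow> real^2" where
  "grid_point K i j = vector [real i / (real K - 1), real j / (real K - 1)]"

definition grid :: "nat \<Rightarrow> (real^2) set" where
  "grid K = {grid_point K i j | i j. i < K \<and> j < K}"

definition arrangement :: "nat \<Rightarrow> nat \<Rightarrow> (real^2) set \<Rightarrow> bool" where
  "arrangement n K X \<longleftrightarrow> X \<subseteq> grid K \<and> card X = n"

text \<open>An arrangement is encoded as its row-by-row bitmap of length \<open>K\<^sup>2\<close>.\<close>

definition encode_arrangement :: "nat \<Rightarrow> (real^2) set \<Rightarrow> bool list" where
  "encode_arrangement K X =
     concat (map (\<lambda>i. map (\<lambda>j. grid_point K i j \<in> X) [0..<K]) [0..<K])"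

definition triangle_area :: "real^2 \<Rightarrow> real^2 \<Rightarrow> real^2 \<Rightarrow> real" where
  "triangle_area a b c = measure lborel (convex hull {a, b, c})"

end

theory Submission
  imports Defs "HOL-Library.Nat_Bijection" "HOL-Real_Asymp.Real_Asymp"
begin

text \<open>
  Call an \<open>n\<close>-subset of the grid spread if none of its triangles has area at most a constant
  times \<open>v / n\<^sup>3\<close>. A fixed machine that reads \<open>v\<close> in unary and then an index outputs the
  spread set with that index, by brute-force search. So it suffices that at most a fraction
  \<open>2\<^sup>-\<^sup>3\<^sup>v\<close> of all \<open>n\<close>-subsets is spread: with \<open>v = \<delta> + c\<close>, where \<open>c\<close> exceeds the length
  of the description of the machine, a spread arrangement would be too compressible.

  For the count, replace subsets by \<open>n\<close> independent uniform grid points. A group of \<open>2m\<close> points,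
  \<open>m\<close> proportional to \<open>n\<close>, spans \<open>m\<^sup>2\<close> lines, and the strips around them that spoil a further
  point have total area of order \<open>v / n\<close>. By the Bonferroni inequality their union is of the same
  order unless pairs of strips overlap too much, which by Markov's inequality has probability
  \<open>O(v / sqrt n)\<close>. Of 25 independent groups, all fail with probability below \<open>n\<^sup>-\<^sup>1\<^sup>0\<close>, which is
  negligible because \<open>v\<close> is at most about \<open>2 log n\<close>; otherwise each of the remaining \<open>n / 2\<close>
  points avoids a region of area of order \<open>v / n\<close>, which has probability \<open>exp (- \<Omega>(v))\<close>.
\<close>

section \<open>Compiling counter programs to Turing machines\<close>


text \<open>Universality quantifies over concrete Turing machines, so the decoder must be exhibited
  as one. Counter programs suffice, as only termination and output matter, not running time. The bit
  balance: \<open>v\<close> in unary costs v bits, while the rarity of spread sets shortens the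
  index by 3v bits. The net gain of about 2v beats \<delta> and all constants. The grid is discrete,
  so every area estimate is a count of lattice points satisfying |det| \<le> B. Once B is at least
  16 K, strips are wide compared with the lattice and the counts have the order of magnitude of the
  areas; this is one reason why K must be large in terms of n. Lines join two disjoint halves of a
  group. In the overlap estimate the spoiled cell is held fixed and the endpoints are averaged. Two
  lines without a common endpoint behave independently; two lines with a common endpoint are
  correlated, and they are the dominant term that yields the weak failure rate 1 / sqrt n of a
  single group, hence the repetition over many groups.\<close>

datatype atom = Inc nat | Dec nat | Read bool nat nat | Write nat

datatype com = Skip | Atom atom | Seq com com (infixr ";;" 60) | While nat com

text \<open>Registers, the unread rest of the two inputs (\<open>False\<close> for the program,
  \<open>True\<close> for the conditional string, so that input \<open>t\<close> sits on tape
  \<open>of_bool t\<close>), and the output so far.\<close>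

type_synonym state = "(nat \<Rightarrow> nat) \<times> (bool \<Rightarrow> bool list) \<times> bool list"

text \<open>\<open>Read\<close> records the presence of a bit in \<open>r\<close> and its value in
  \<open>r'\<close>. At the end of the input nothing changes, so a register \<open>r\<close> that is
  still zero reveals exhaustion.\<close>

fun act :: "atom \<Rightarrow> state \<Rightarrow> state" where
  "act (Inc r) (s, i, u) = (s(r := Suc (s r)), i, u)"
| "act (Dec r) (s, i, u) = (s(r := s r - 1), i, u)"
| "act (Read t r r') (s, i, u) =
     (case i t of [] \<Rightarrow> (s, i, u)
      | b # bs \<Rightarrow> (\<lambda>x. if x = r \<or> x = r' \<and> b then Suc (s x) else s x, i(t := bs), u))"
| "act (Write r) (s, i, u) = (s, i, u @ [s r \<noteq> 0])"

inductive big_step :: "com \<Rightarrow> state \<Rightarrow> state \<Rightarrow> bool" where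
  Skip: "big_step Skip st st"
| Atom: "big_step (Atom a) st (act a st)"
| Seq: "big_step c st st' \<Longrightarrow> big_step d st' st'' \<Longrightarrow> big_step (c ;; d) st st''"
| While_False: "fst st r = 0 \<Longrightarrow> big_step (While r c) st st"
| While_True: "fst st r \<noteq> 0 \<Longrightarrow> big_step c st st' \<Longrightarrow> big_step (While r c) st' st'' \<Longrightarrow>
    big_step (While r c) st st''"

inductive_cases big_step_SeqE: "big_step (c ;; d) st st''"

datatype instr = Act atom | Jz nat nat | Jmp nat

text \<open>Jump targets are absolute, so \<open>a\<close> is the address at which the block is
  placed. The exit of a loop skips the two instructions around its body; it may be the address just
  past the program, which means halting.\<close>

fun code :: "com \<Rightarrow> nat \<Rightarrow> instr list" where
  "code Skip a = []"
| "code (Atom x) a = [Act x]"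
| "code (c ;; d) a = code c a @ code d (a + length (code c a))"
| "code (While r c) a =
     Jz r (a + length (code c (Suc a)) + 2) # code c (Suc a) @ [Jmp a]"

inductive istep :: "instr list \<Rightarrow> nat \<times> state \<Rightarrow> nat \<times> state \<Rightarrow> bool" for P where
  Act: "pc < length P \<Longrightarrow> P ! pc = Act x \<Longrightarrow> istep P (pc, st) (Suc pc, act x st)"
| Jz: "pc < length P \<Longrightarrow> P ! pc = Jz r a \<Longrightarrow> a \<le> length P \<Longrightarrow>
    istep P (pc, st) (if fst st r = 0 then a else Suc pc, st)"
| Jmp: "pc < length P \<Longrightarrow> P ! pc = Jmp a \<Longrightarrow> a \<le> length P \<Longrightarrow> istep P (pc, st) (a, st)"

text \<open>The context \<open>pre\<close>, \<open>post\<close> stays general in the induction: a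
  component sits inside a longer program, and a loop is re-entered at its own address.\<close>

lemma code_correct:
  assumes "big_step c st st'" "P = pre @ code c (length pre) @ post"
  shows "(istep P)\<^sup>*\<^sup>* (length pre, st) (length pre + length (code c (length pre)), st')"
  using assms
proof (induction arbitrary: pre post rule: big_step.induct)
  case (Skip st)
  then show ?case by simp
next
  case (Atom a st)
  have "istep P (length pre, st) (Suc (length pre), act a st)"
    using Atom by (intro istep.Act) auto
  then show ?case by auto
next
  case (Seq c st st' d st'')
  have "(istep P)\<^sup>*\<^sup>* (length pre, st) (length pre + length (code c (length pre)), st')"
    by (rule Seq.IH(1)[of pre "code d (length pre + length (code c (length pre))) @ post"])
       (simp add: Seq.prems)
  moreover have "(istep P)\<^sup>*\<^sup>* (length (pre @ code c (length pre)), st')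
    (length (pre @ code c (length pre)) + length (code d (length (pre @ code c (length pre)))), st'')"
    by (rule Seq.IH(2)[of _ post]) (simp add: Seq.prems)
  ultimately show ?case by (simp add: add.assoc)
next
  case (While_False st r c)
  have "istep P (length pre, st)
     (if fst st r = 0 then length pre + length (code c (Suc (length pre))) + 2 else Suc (length pre), st)"
    using While_False by (intro istep.Jz) auto
  then show ?case using While_False by auto
next
  case (While_True st r c st' st'')
  let ?l = "code c (Suc (length pre))"
  let ?J = "Jz r (length pre + length ?l + 2)"
  have P: "P = pre @ ?J # ?l @ Jmp (length pre) # post"
    using While_True.prems by simp
  have "istep P (length pre, st)
     (if fst st r = 0 then length pre + length ?l + 2 else Suc (length pre), st)"
    unfolding P by (intro istep.Jz) auto
  then have 1: "istep P (length pre, st) (Suc (length pre), st)"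
    using While_True by simp
  have 2: "(istep P)\<^sup>*\<^sup>* (length (pre @ [?J]), st) (length (pre @ [?J]) + length (code c (length (pre @ [?J]))), st')"
    by (rule While_True.IH(1)[of _ "Jmp (length pre) # post"]) (simp add: P)
  have 3: "istep P (Suc (length pre) + length ?l, st') (length pre, st')"
    unfolding P by (intro istep.Jmp) (auto simp: nth_append)
  have 4: "(istep P)\<^sup>*\<^sup>* (length pre, st') (length pre + length (code (While r c) (length pre)), st'')"
    by (rule While_True.IH(2)[OF While_True.prems])
  note 1
  also have "(istep P)\<^sup>*\<^sup>* (Suc (length pre), st) (Suc (length pre) + length ?l, st')"
    using 2 by simp
  also note 3
  also note 4
  finally show ?case .
qed

text \<open>
  Register \<open>r\<close> lives on tape \<open>r + 3\<close>: its value is the position of the head, and cell \<open>0\<close> is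
  marked by the symbol \<open>1\<close>, so that reading \<open>1\<close> means that the register is zero.
\<close>

fun tape_action :: "atom \<Rightarrow> nat list \<Rightarrow> nat \<Rightarrow> nat \<times> move" where
  "tape_action (Inc r) s k = (s ! k, if k = r + 3 then Move_Right else Stay)"
| "tape_action (Dec r) s k = (s ! k, if k = r + 3 \<and> s ! k = 0 then Move_Left else Stay)"
| "tape_action (Read t r r') s k =
    (s ! k, if s ! of_bool t \<noteq> 0 \<and> (k = of_bool t \<or> k = r + 3 \<or> k = r' + 3 \<and> s ! of_bool t = 2)
            then Move_Right else Stay)"
| "tape_action (Write r) s k =
    (if k = 2 then (if s ! (r + 3) = 0 then 2 else 1, Move_Right) else (s ! k, Stay))"

declare upt_Suc [simp del]

definition machine_trans :: "instr list \<Rightarrow> nat \<Rightarrow> nat \<Rightarrow> nat list \<Rightarrow> (nat \<times> (nat \<times> move) list) option" where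
  "machine_trans P R q s =
    (if q = 0 then Some (1, map (\<lambda>k. (if k < 3 then s ! k else 1, Stay)) [0..<R + 3])
     else if q \<le> length P then
       (case P ! (q - 1) of
          Act x \<Rightarrow> Some (Suc q, map (tape_action x s) [0..<R + 3])
        | Jz r a \<Rightarrow> Some (if s ! (r + 3) = 1 then Suc (min a (length P)) else Suc q,
                        map (\<lambda>k. (s ! k, Stay)) [0..<R + 3])
        | Jmp a \<Rightarrow> Some (Suc (min a (length P)), map (\<lambda>k. (s ! k, Stay)) [0..<R + 3]))
     else None)"

definition machine :: "instr list \<Rightarrow> nat \<Rightarrow> tm" where
  "machine P R = \<lparr>tm_states = length P + 2, tm_symbols = 3, tm_tapes = R + 3, tm_trans = machine_trans P R\<rparr>"

lemma wf_machine: "wf_tm (machine P R)"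
proof -
  have ta: "fst (tape_action x s k) < 3" if "k < length s" "set s \<subseteq> {..<3}" for x s k
  proof -
    have "s ! k < 3" using that nth_mem by blast
    then show ?thesis by (cases x) auto
  qed
  have nth: "s ! k < 3" if "k < length s" "set s \<subseteq> {..<3}" for s :: "nat list" and k
    using that nth_mem by blast
  have "q' < length P + 2 \<and> length ws = R + 3 \<and> fst ` set ws \<subseteq> {..<3}"
    if "length s = R + 3" "set s \<subseteq> {..<3}" "machine_trans P R q s = Some (q', ws)" for q s q' ws
    using that unfolding machine_trans_def
    by (auto split: if_splits instr.splits intro!: nth) (metis fst_conv ta)
  then show ?thesis
    unfolding wf_tm_def machine_def by auto
qed

text \<open>Input heads never move left, so only the cells from the head onwards are
  compared.\<close>

definition in_tape :: "bool list \<Rightarrow> tape \<Rightarrow> bool" where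
  "in_tape bs t \<longleftrightarrow> (\<forall>k. fst t (snd t + int k) = fst (input_tape bs) (int k))"

definition out_tape :: "bool list \<Rightarrow> tape \<Rightarrow> bool" where
  "out_tape u t \<longleftrightarrow> snd t = int (length u) \<and>
     (\<forall>k. fst t (int k) = (if k < length u then bit_symbol (u ! k) else 0))"

definition reg_tape :: "nat \<Rightarrow> tape" where
  "reg_tape n = ((\<lambda>k. if k = 0 then 1 else 0), int n)"

definition represents :: "nat \<Rightarrow> nat \<times> state \<Rightarrow> config \<Rightarrow> bool" where
  "represents R = (\<lambda>(pc, s, i, u) (q, ts). q = Suc pc \<and> length ts = R + 3 \<and>
     (\<forall>t. in_tape (i t) (ts ! of_bool t)) \<and> out_tape u (ts ! 2) \<and>
     (\<forall>r<R. ts ! (r + 3) = reg_tape (s r)))"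

fun atom_reg :: "atom \<Rightarrow> nat" where
  "atom_reg (Inc r) = r" | "atom_reg (Dec r) = r"
| "atom_reg (Read t r r') = max r r'" | "atom_reg (Write r) = r"

fun instr_reg :: "instr \<Rightarrow> nat" where
  "instr_reg (Act x) = atom_reg x" | "instr_reg (Jz r a) = r" | "instr_reg (Jmp a) = 0"

section \<open>Simulation of one instruction by one machine step\<close>

lemma tape_act_stay [simp]: "tape_act (tape_read t, Stay) t = t"
  by (simp add: tape_act_def tape_read_def)

lemma tape_read_reg [simp]: "tape_read (reg_tape n) = (if n = 0 then 1 else 0)"
  by (simp add: tape_read_def reg_tape_def)

lemma tape_read_in:
  assumes "in_tape bs t"
  shows "tape_read t = (case bs of [] \<Rightarrow> 0 | b # _ \<Rightarrow> bit_symbol b)"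
proof -
  have "fst t (snd t + int 0) = fst (input_tape bs) (int 0)"
    using assms unfolding in_tape_def by blast
  then show ?thesis
    by (auto simp: tape_read_def input_tape_def split: list.splits)
qed

lemma reg_tape_right: "tape_act (tape_read (reg_tape n), Move_Right) (reg_tape n) = reg_tape (Suc n)"
  by (auto simp: tape_act_def reg_tape_def tape_read_def)

lemma reg_tape_left:
  "n \<noteq> 0 \<Longrightarrow> tape_act (0, Move_Left) (reg_tape n) = reg_tape (n - 1)"
  by (auto simp: tape_act_def reg_tape_def tape_read_def)

lemma in_tape_right:
  assumes "in_tape (b # bs) t"
  shows "in_tape bs (tape_act (tape_read t, Move_Right) t)"
proof -
  have "fst t (snd t + 1 + int k) = fst (input_tape bs) (int k)" for k
  proof -
    have "fst t (snd t + int (Suc k)) = fst (input_tape (b # bs)) (int (Suc k))"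
      using assms unfolding in_tape_def by blast
    also have "\<dots> = fst (input_tape bs) (int k)"
      by (auto simp: input_tape_def nat_add_distrib)
    finally show ?thesis by (simp add: algebra_simps)
  qed
  then show ?thesis
    by (simp add: in_tape_def tape_act_def tape_read_def)
qed

lemma out_tape_write:
  assumes "out_tape u t"
  shows "out_tape (u @ [b]) (tape_act (bit_symbol b, Move_Right) t)"
  using assms by (auto simp: out_tape_def tape_act_def nth_append less_Suc_eq)

lemma step_nth:
  assumes "machine_trans P R q (map tape_read ts) = Some (q', map f [0..<R + 3])" "length ts = R + 3"
  shows "tm_step (machine P R) (q, ts) = Some (q', map (\<lambda>k. tape_act (f k) (ts ! k)) [0..<R + 3])"
proof -
  have "map2 tape_act (map f [0..<R + 3]) ts = map (\<lambda>k. tape_act (f k) (ts ! k)) [0..<R + 3]"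
    by (rule nth_equalityI) (use assms(2) in auto)
  with assms(1) show ?thesis
    by (simp add: tm_step_def machine_def)
qed

lemma machine_step:
  assumes "istep P cf cf'" "represents R cf c" "\<forall>x\<in>set P. instr_reg x < R"
  shows "\<exists>c'. tm_step (machine P R) c = Some c' \<and> represents R cf' c'"
proof -
  obtain pc s i u where cf: "cf = (pc, s, i, u)" by (cases cf) auto
  obtain ts where c: "c = (Suc pc, ts)" and len: "length ts = R + 3"
    and ins: "\<And>t. in_tape (i t) (ts ! of_bool t)" and out: "out_tape u (ts ! 2)"
    and regs: "\<And>r. r < R \<Longrightarrow> ts ! (r + 3) = reg_tape (s r)"
    using assms(2) unfolding cf represents_def by (cases c) auto
  have lt: "of_bool t < R + 3" for t by (cases t) auto
  have stay: "map (\<lambda>k. tape_act (map tape_read ts ! k, Stay) (ts ! k)) [0..<R + 3] = ts"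
    by (rule nth_equalityI) (use len in auto)
  have reg: "map tape_read ts ! (r + 3) = (if s r = 0 then 1 else 0)" if "r < R" for r
    using that len regs by simp
  from assms(1) show ?thesis
  proof cases
    case (Act pc' x st)
    then have pc: "pc < length P" "P ! pc = Act x" and cf': "cf' = (Suc pc, act x (s, i, u))"
      using cf by auto
    have xr: "atom_reg x < R" using assms(3) pc by (metis instr_reg.simps(1) nth_mem)
    let ?ts = "map (\<lambda>k. tape_act (tape_action x (map tape_read ts) k) (ts ! k)) [0..<R + 3]"
    have st: "tm_step (machine P R) c = Some (Suc (Suc pc), ?ts)"
      unfolding c by (rule step_nth) (use pc len in \<open>auto simp: machine_trans_def\<close>)
    have nth: "?ts ! k = tape_act (tape_action x (map tape_read ts) k) (ts ! k)" if "k < R + 3" for k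
      using that by simp
    have "represents R cf' (Suc (Suc pc), ?ts)"
    proof (cases x)
      case (Inc r)
      then show ?thesis using ins out regs xr
        unfolding cf' represents_def
        by (auto simp: nth lt len numeral_2_eq_2 reg_tape_right simp del: tape_read_reg)
    next
      case (Dec r)
      \<comment> \<open>At value zero the head reads the mark \<open>1\<close> and stays, as
        truncated subtraction demands.\<close>
      have "tape_act (tape_action x (map tape_read ts) (r' + 3)) (ts ! (r' + 3))
         = reg_tape ((s(r := s r - 1)) r')" if "r' < R" for r'
        using that regs[OF that] len Dec by (auto simp: reg_tape_left split: if_splits) (auto simp: tape_act_def reg_tape_def)
      then show ?thesis using ins out regs xr Dec
        unfolding cf' represents_def
        by (auto simp: nth lt len numeral_2_eq_2 simp del: tape_read_reg)
    next
      case (Read t r r')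
      have rd: "map tape_read ts ! of_bool t = (case i t of [] \<Rightarrow> 0 | b # _ \<Rightarrow> bit_symbol b)"
        using tape_read_in[OF ins[of t]] len lt[of t] by simp
      show ?thesis
      proof (cases "i t")
        case Nil
        then show ?thesis using ins out regs xr Read rd
          unfolding cf' represents_def
          by (auto simp: nth lt len numeral_2_eq_2 simp del: tape_read_reg)
      next
        case (Cons b bs)
        have b: "(case i t of [] \<Rightarrow> 0 | b # _ \<Rightarrow> bit_symbol b) = bit_symbol b" using Cons by simp
        have in': "in_tape ((i(t := bs)) t') (?ts ! of_bool t')" for t'
        proof (cases "t' = t")
          case True
          have eq: "?ts ! of_bool t = tape_act (tape_read (ts ! of_bool t), Move_Right) (ts ! of_bool t)"
            using rd[unfolded b] Read len by (auto simp: nth lt bit_symbol_def)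
          show ?thesis unfolding True eq fun_upd_same
            by (rule in_tape_right) (use ins[of t] Cons in simp)
        next
          case False
          then have eq: "?ts ! of_bool t' = ts ! of_bool t'"
            using Read len lt[of t'] by (cases t; cases t') (auto simp: nth)
          show ?thesis unfolding eq using False ins[of t'] by simp
        qed
        have out': "out_tape u (?ts ! 2)"
          using out Read len by (cases t) (auto simp: nth numeral_2_eq_2)
        have reg': "?ts ! (x + 3) = reg_tape (if x = r \<or> x = r' \<and> b then Suc (s x) else s x)" if "x < R" for x
          using that regs[OF that] rd[unfolded b] Read len
          by (cases t) (auto simp: nth bit_symbol_def reg_tape_right simp del: tape_read_reg split: if_splits)
        have eq: "cf' = (Suc pc, \<lambda>x. if x = r \<or> x = r' \<and> b then Suc (s x) else s x, i(t := bs), u)"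
          using Read Cons cf' by simp
        show ?thesis
          unfolding eq represents_def prod.case by (intro conjI allI impI in' out' reg') simp_all
      qed
    next
      case (Write r)
      have eq: "?ts ! 2 = tape_act (bit_symbol (s r \<noteq> 0), Move_Right) (ts ! 2)"
        using Write xr reg[of r] by (auto simp: nth bit_symbol_def numeral_2_eq_2)
      have out': "out_tape (u @ [s r \<noteq> 0]) (?ts ! 2)"
        unfolding eq by (rule out_tape_write[OF out])
      have in': "in_tape (i t) (?ts ! of_bool t)" for t
        using ins[of t] Write len by (cases t) (auto simp: nth)
      have reg': "?ts ! (r' + 3) = reg_tape (s r')" if "r' < R" for r'
        using that regs[OF that] Write len by (auto simp: nth simp del: tape_read_reg)
      have eq': "cf' = (Suc pc, s, i, u @ [s r \<noteq> 0])"
        using Write cf' by simp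
      show ?thesis
        unfolding eq' represents_def prod.case by (intro conjI allI impI in' out' reg') simp_all
    qed
    with st show ?thesis by blast
  next
    case (Jz pc' r a st)
    then have pc: "pc < length P" "P ! pc = Jz r a" "a \<le> length P"
      and cf': "cf' = (if s r = 0 then a else Suc pc, s, i, u)" and "r < R"
      using cf assms(3) by (auto, metis instr_reg.simps(2) nth_mem)
    have "tm_step (machine P R) c = Some (Suc (if s r = 0 then a else Suc pc), ts)"
      unfolding c
      by (subst step_nth[where f = "\<lambda>k. (map tape_read ts ! k, Stay)" and q' = "Suc (if s r = 0 then a else Suc pc)"])
         (use pc len reg[OF \<open>r < R\<close>] in \<open>auto simp: machine_trans_def min_def stay\<close>)
    then show ?thesis
      using len ins out regs unfolding cf' represents_def by auto
  next
    case (Jmp pc' a st)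
    then have pc: "pc < length P" "P ! pc = Jmp a" "a \<le> length P" and cf': "cf' = (a, s, i, u)"
      using cf by auto
    have "tm_step (machine P R) c = Some (Suc a, ts)"
      unfolding c
      by (subst step_nth[where f = "\<lambda>k. (map tape_read ts ! k, Stay)" and q' = "Suc a"])
         (use pc len in \<open>auto simp: machine_trans_def min_def stay\<close>)
    then show ?thesis
      using len ins out regs unfolding cf' represents_def by auto
  qed
qed

lemma machine_steps:
  assumes "(istep P)\<^sup>*\<^sup>* cf cf'" "represents R cf c" "\<forall>x\<in>set P. instr_reg x < R"
  shows "\<exists>c'. (\<lambda>c c'. tm_step (machine P R) c = Some c')\<^sup>*\<^sup>* c c' \<and> represents R cf' c'"
  using assms(1)
proof induction
  case base
  then show ?case using assms(2) by blast
next
  case (step y z)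
  then show ?case using machine_step[OF step(2) _ assms(3)] by (meson rtranclp.rtrancl_into_rtrancl)
qed

definition input_of :: "bool list \<Rightarrow> bool list \<Rightarrow> bool \<Rightarrow> bool list" where
  "input_of p y t = (if t then y else p)"

theorem com_computable:
  "\<exists>M. wf_tm M \<and> (\<forall>p y s i x.
     big_step c (\<lambda>_. 0, input_of p y, []) (s, i, x) \<longrightarrow> tm_computes M p y x)"
proof -
  define P where "P = code c 0"
  define R where "R = Suc (sum_list (map instr_reg P))"
  have R: "\<forall>x\<in>set P. instr_reg x < R"
    unfolding R_def by (auto intro: member_le_sum_list simp: less_Suc_eq_le)
  have "tm_computes (machine P R) p y x"
    if b: "big_step c (\<lambda>_. 0, input_of p y, []) (s, i, x)" for p y s i x
  proof -
    let ?st = "\<lambda>c c'. tm_step (machine P R) c = Some c'"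
    define ts where "ts = input_tape p # input_tape y # replicate (Suc R) (input_tape [])"
    have init: "tm_init (machine P R) p y = (0, ts)"
      by (simp add: tm_init_def machine_def ts_def)
    have len: "length ts = R + 3" by (simp add: ts_def)
    \<comment> \<open>The tapes after the initialising step: every blank work tape has become a
      register of value zero.\<close>
    define ts' where "ts' = map (\<lambda>k. tape_act (if k < 3 then map tape_read ts ! k else 1, Stay) (ts ! k)) [0..<R + 3]"
    have st: "?st (0, ts) (1, ts')"
      unfolding ts'_def by (rule step_nth) (simp_all add: machine_trans_def len)
    have nth: "ts' ! k = tape_act (if k < 3 then map tape_read ts ! k else 1, Stay) (ts ! k)" if "k < R + 3" for k
      using that by (simp add: ts'_def)
    have 0: "ts' ! 0 = input_tape p" "ts' ! Suc 0 = input_tape y" "ts' ! 2 = input_tape []"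
      using len by (auto simp: nth) (simp_all add: ts_def eval_nat_numeral)
    have 3: "ts' ! (r + 3) = reg_tape 0" if "r < R" for r
    proof -
      have "ts ! (r + 3) = input_tape []" using that by (auto simp: ts_def eval_nat_numeral nth_Cons')
      then show ?thesis using that
        by (auto simp: nth reg_tape_def tape_act_def input_tape_def)
    qed
    have "represents R (0, \<lambda>_. 0, input_of p y, []) (1, ts')"
      using 0 3 by (auto simp: represents_def input_of_def in_tape_def out_tape_def ts'_def input_tape_def)
    moreover have "(istep P)\<^sup>*\<^sup>* (0, \<lambda>_. 0, input_of p y, []) (length P, s, i, x)"
      using code_correct[OF b, of P "[]" "[]"] by (simp add: P_def)
    ultimately obtain c' where c': "?st\<^sup>*\<^sup>* (1, ts') c'" "represents R (length P, s, i, x) c'"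
      using machine_steps R by blast
    have "tape_output (snd c' ! 2) x" "fst c' = Suc (length P)"
      using c'(2) by (auto simp: represents_def tape_output_def out_tape_def)
    moreover have "tm_step (machine P R) c' = None"
      using \<open>fst c' = _\<close> by (simp add: tm_step_def machine_def machine_trans_def)
    ultimately show ?thesis
      unfolding tm_computes_def init using st c'(1) by (meson converse_rtranclp_into_rtranclp)
  qed
  then show ?thesis using wf_machine by blast
qed

declare upt_Suc [simp]

section \<open>Computable functions\<close>


definition clear :: "nat \<Rightarrow> com" where
  "clear r = While r (Atom (Dec r))"

definition move :: "nat \<Rightarrow> nat \<Rightarrow> com" where
  "move r t = While r (Atom (Dec r) ;; Atom (Inc t))"

lemma big_step_inc: "st' = (s(r := Suc (s r)), i, u) \<Longrightarrow> big_step (Atom (Inc r)) (s, i, u) st'"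
  using big_step.Atom[of "Inc r" "(s, i, u)"] by simp

lemma big_step_dec: "st' = (s(r := s r - 1), i, u) \<Longrightarrow> big_step (Atom (Dec r)) (s, i, u) st'"
  using big_step.Atom[of "Dec r" "(s, i, u)"] by simp

text \<open>Counting loops are verified below by listing the states \<open>S j\<close> at the loop
  head, which also settles termination.\<close>

lemma big_step_While:
  assumes "\<And>j. j < n \<Longrightarrow> fst (S j) r \<noteq> 0 \<and> big_step c (S j) (S (Suc j))" "fst (S n) r = 0"
  shows "big_step (While r c) (S 0) (S n)"
proof -
  have "big_step (While r c) (S (n - k)) (S n)" if "k \<le> n" for k
    using that
  proof (induction k)
    case 0
    then show ?case using assms(2) by (simp add: While_False)
  next
    case (Suc k)
    then have "Suc (n - Suc k) = n - k" by simp
    then show ?case using Suc assms(1)[of "n - Suc k"] by (auto intro: While_True)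
  qed
  from this[of n] show ?thesis by simp
qed

lemma big_step_clear: "big_step (clear r) (s, i, u) (s(r := 0), i, u)"
proof -
  have "big_step (clear r) (s(r := s r - 0), i, u) (s(r := s r - s r), i, u)"
    unfolding clear_def
    by (rule big_step_While[where S = "\<lambda>j. (s(r := s r - j), i, u)"]) (auto intro!: big_step_dec)
  then show ?thesis by simp
qed

lemma big_step_move:
  assumes "r \<noteq> t"
  shows "big_step (move r t) (s, i, u) (s(r := 0, t := s t + s r), i, u)"
proof -
  have "big_step (move r t) (s(r := s r - 0, t := s t + 0), i, u) (s(r := s r - s r, t := s t + s r), i, u)"
    unfolding move_def
    by (rule big_step_While[where S = "\<lambda>j. (s(r := s r - j, t := s t + j), i, u)"])
       (use assms in \<open>auto intro!: big_step.Seq[OF big_step_dec[OF refl]] big_step_inc\<close>)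
  then show ?thesis by simp
qed

text \<open>Missing arguments count as zero, so one type of argument lists serves all arities and
  selecting arguments needs no length condition.\<close>

definition arg :: "nat list \<Rightarrow> nat \<Rightarrow> nat" where
  "arg xs k = (if k < length xs then xs ! k else 0)"

lemma arg_simps [simp]:
  "arg (x # xs) 0 = x" "arg (x # xs) (Suc k) = arg xs k" "arg (tl xs) k = arg xs (Suc k)"
  by (auto simp: arg_def nth_tl)

text \<open>
  The argument registers \<open>rs\<close> and the target register \<open>t\<close> are arbitrary; the registers from \<open>d\<close>
  on serve as scratch space and must be zero.
\<close>

definition computable :: "(nat list \<Rightarrow> nat) \<Rightarrow> bool" where
  "computable f \<longleftrightarrow> (\<forall>rs t d. set rs \<subseteq> {..<d} \<and> t < d \<and> t \<notin> set rs \<longrightarrow>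
     (\<exists>c. \<forall>s i u. (\<forall>r\<ge>d. s r = 0) \<and> s t = 0 \<longrightarrow>
        big_step c (s, i, u) (s(t := f (map s rs)), i, u)))"

lemma computableE:
  assumes "computable f" "set rs \<subseteq> {..<d}" "t < d" "t \<notin> set rs"
  obtains c where "\<And>s i u. (\<And>r. r \<ge> d \<Longrightarrow> s r = 0) \<Longrightarrow> s t = 0 \<Longrightarrow>
        big_step c (s, i, u) (s(t := f (map s rs)), i, u)"
  using assms unfolding computable_def by metis

lemma computable_zero: "computable (\<lambda>xs. 0)"
  unfolding computable_def
  by (intro allI impI exI[of _ Skip]) (metis big_step.Skip fun_upd_triv)

lemma computable_Suc:
  assumes "computable f"
  shows "computable (\<lambda>xs. Suc (f xs))"
  unfolding computable_def
proof (intro allI impI, elim conjE)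
  fix rs :: "nat list" and t d :: nat
  assume *: "set rs \<subseteq> {..<d}" "t < d" "t \<notin> set rs"
  obtain c where c: "\<And>s i u. (\<And>r. r \<ge> d \<Longrightarrow> s r = 0) \<Longrightarrow> s t = 0 \<Longrightarrow>
        big_step c (s, i, u) (s(t := f (map s rs)), i, u)"
    using computableE[OF assms *] by blast
  show "\<exists>c. \<forall>s i u. (\<forall>r\<ge>d. s r = 0) \<and> s t = 0 \<longrightarrow>
        big_step c (s, i, u) (s(t := Suc (f (map s rs))), i, u)"
    by (intro exI[of _ "c ;; Atom (Inc t)"] allI impI big_step.Seq[OF c] big_step_inc) auto
qed

lemma computable_arg: "computable (\<lambda>xs. arg xs k)"
  unfolding computable_def
proof (intro allI impI, elim conjE)
  fix rs :: "nat list" and t d :: nat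
  assume *: "set rs \<subseteq> {..<d}" "t < d" "t \<notin> set rs"
  show "\<exists>c. \<forall>s i u. (\<forall>r\<ge>d. s r = 0) \<and> s t = 0 \<longrightarrow>
        big_step c (s, i, u) (s(t := arg (map s rs) k), i, u)"
  proof (cases "k < length rs")
    case False
    then show ?thesis by (intro exI[of _ Skip]) (auto simp: arg_def fun_upd_idem big_step.Skip)
  next
    case True
    let ?r = "rs ! k"
    have r: "?r < d" "?r \<noteq> t" using * True by (auto dest: nth_mem)
    \<comment> \<open>A register is read by emptying it, so its value is counted both into
      \<open>t\<close> and into the scratch register \<open>d\<close>, from which it is then
      restored.\<close>
    let ?b = "Atom (Dec ?r) ;; Atom (Inc t) ;; Atom (Inc d)"
    have "big_step (While ?r ?b ;; move d ?r) (s, i, u) (s(t := arg (map s rs) k), i, u)"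
      if s: "\<forall>r\<ge>d. s r = 0" "s t = 0" for s i u
    proof -
      let ?S = "\<lambda>j. (s(?r := s ?r - j, t := j, d := j), i, u)"
      have "big_step (While ?r ?b) (?S 0) (?S (s ?r))"
        by (rule big_step_While)
           (use r * in \<open>auto intro!: big_step.Seq[OF big_step_dec[OF refl]] big_step.Seq[OF big_step_inc[OF refl]] big_step_inc\<close>)
      moreover have "?S 0 = (s, i, u)" using s by (auto simp: fun_upd_idem)
      moreover have "big_step (move d ?r) (?S (s ?r)) (s(t := arg (map s rs) k), i, u)"
      proof -
        have eq: "s(t := arg (map s rs) k) = (s(?r := s ?r - s ?r, t := s ?r, d := s ?r))
           (d := 0, ?r := (s(?r := s ?r - s ?r, t := s ?r, d := s ?r)) ?r
              + (s(?r := s ?r - s ?r, t := s ?r, d := s ?r)) d)"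
          using r * s True by (auto simp: fun_eq_iff arg_def)
        show ?thesis unfolding eq by (rule big_step_move) (use r in auto)
      qed
      ultimately show ?thesis by (auto intro: big_step.Seq)
    qed
    then show ?thesis by blast
  qed
qed

text \<open>Needed when recursion puts its counter and accumulator in front of the argument list. An
  index beyond the list is sent to register \<open>d\<close>, whose value zero is the default of
  \<open>arg\<close>.\<close>

lemma computable_args:
  assumes "computable f"
  shows "computable (\<lambda>xs. f (map (arg xs) ks @ drop m xs))"
  unfolding computable_def
proof (intro allI impI, elim conjE)
  fix rs :: "nat list" and t d :: nat
  assume *: "set rs \<subseteq> {..<d}" "t < d" "t \<notin> set rs"
  let ?rs = "map (\<lambda>k. if k < length rs then rs ! k else d) ks @ drop m rs"
  have rs: "set ?rs \<subseteq> {..<Suc d}" "t < Suc d" "t \<notin> set ?rs"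
    using * by (auto dest: nth_mem in_set_dropD)
  obtain c where c: "\<And>s i u. (\<And>r. r \<ge> Suc d \<Longrightarrow> s r = 0) \<Longrightarrow> s t = 0 \<Longrightarrow>
        big_step c (s, i, u) (s(t := f (map s ?rs)), i, u)"
    using computableE[OF assms rs] by blast
  have "big_step c (s, i, u) (s(t := f (map (arg (map s rs)) ks @ drop m (map s rs))), i, u)"
    if s: "\<forall>r\<ge>d. s r = 0" "s t = 0" for s i u
  proof -
    have "map s ?rs = map (arg (map s rs)) ks @ drop m (map s rs)"
      using s by (auto simp: arg_def drop_map)
    then show ?thesis using c[of s i u] s by (metis Suc_leD)
  qed
  then show "\<exists>c. \<forall>s i u. (\<forall>r\<ge>d. s r = 0) \<and> s t = 0 \<longrightarrow>
        big_step c (s, i, u) (s(t := f (map (arg (map s rs)) ks @ drop m (map s rs))), i, u)"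
    by blast
qed

lemma computable_tl:
  assumes "computable f"
  shows "computable (\<lambda>xs. f (tl xs))"
  using computable_args[OF assms, of "[]" 1] by (simp add: drop_Suc)

lemma computable_rec:
  assumes f: "computable f" and g: "computable g"
    and h: "computable (\<lambda>ys. h (arg ys 0) (arg ys 1) (tl (tl ys)))"
  shows "computable (\<lambda>xs. rec_nat (g xs) (\<lambda>k a. h k a xs) (f xs))"
  unfolding computable_def
proof (intro allI impI, elim conjE)
  fix rs :: "nat list" and t d :: nat
  assume *: "set rs \<subseteq> {..<d}" "t < d" "t \<notin> set rs"
  \<comment> \<open>The step function reads the accumulator in \<open>t\<close>, so its result needs
    a register of its own, \<open>?new\<close>, before it replaces the accumulator.\<close>
  let ?cnt = "d" and ?k = "d + 1" and ?new = "d + 2" and ?d = "d + 3"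
  have rs: "set rs \<subseteq> {..<?d}" using * by auto
  obtain cf where cf: "\<And>s i u. (\<And>r. r \<ge> ?d \<Longrightarrow> s r = 0) \<Longrightarrow> s ?cnt = 0 \<Longrightarrow>
        big_step cf (s, i, u) (s(?cnt := f (map s rs)), i, u)"
    using computableE[OF f rs, of ?cnt] * by auto
  obtain cg where cg: "\<And>s i u. (\<And>r. r \<ge> ?d \<Longrightarrow> s r = 0) \<Longrightarrow> s t = 0 \<Longrightarrow>
        big_step cg (s, i, u) (s(t := g (map s rs)), i, u)"
    using computableE[OF g rs, of t] * by auto
  have "set (?k # t # rs) \<subseteq> {..<?d}" "?new < ?d" "?new \<notin> set (?k # t # rs)"
    using * by auto
  then obtain ch where ch': "\<And>s i u. (\<And>r. r \<ge> ?d \<Longrightarrow> s r = 0) \<Longrightarrow> s ?new = 0 \<Longrightarrow>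
        big_step ch (s, i, u) (s(?new := h (arg (map s (?k # t # rs)) 0) (arg (map s (?k # t # rs)) 1)
           (tl (tl (map s (?k # t # rs))))), i, u)"
    using computableE[OF h] by blast
  have ch: "big_step ch (s, i, u) (s(?new := h (s ?k) (s t) (map s rs)), i, u)"
    if "\<And>r. r \<ge> ?d \<Longrightarrow> s r = 0" "s ?new = 0" for s i u
    using ch'[of s i u] that by simp
  let ?body = "Atom (Dec ?cnt) ;; ch ;; clear t ;; move ?new t ;; Atom (Inc ?k)"
  have "big_step (cf ;; cg ;; While ?cnt ?body ;; clear ?k) (s, i, u)
      (s(t := rec_nat (g (map s rs)) (\<lambda>k a. h k a (map s rs)) (f (map s rs))), i, u)"
    if s: "\<forall>r\<ge>d. s r = 0" "s t = 0" for s i u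
  proof -
    let ?xs = "map s rs"
    define V where "V = rec_nat (g ?xs) (\<lambda>k a. h k a ?xs)"
    have V: "V 0 = g ?xs" "\<And>j. V (Suc j) = h j (V j) ?xs" by (auto simp: V_def)
    let ?S = "\<lambda>j. (s(t := V j, ?cnt := f ?xs - j, ?k := j), i, u)"
    have rsu: "map s' rs = ?xs" if "\<And>r. r < d \<Longrightarrow> r \<noteq> t \<Longrightarrow> s' r = s r" for s'
      using that * by (auto intro!: map_cong)
    have 1: "big_step cf (s, i, u) (s(?cnt := f ?xs), i, u)"
      by (rule cf) (use s in auto)
    have "big_step cg (s(?cnt := f ?xs), i, u) (s(?cnt := f ?xs, t := g (map (s(?cnt := f ?xs)) rs)), i, u)"
      by (rule cg) (use s * in auto)
    moreover have "map (s(?cnt := f ?xs)) rs = ?xs" by (rule rsu) auto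
    moreover have "s(?cnt := f ?xs, t := V 0) = s(t := V 0, ?cnt := f ?xs - 0, ?k := 0)"
      using s * by (auto simp: fun_eq_iff)
    ultimately have 2: "big_step cg (s(?cnt := f ?xs), i, u) (?S 0)"
      by (simp add: V)
    have 3: "big_step (While ?cnt ?body) (?S 0) (?S (f ?xs))"
    proof (rule big_step_While, rule conjI)
      fix j assume j: "j < f ?xs"
      let ?s1 = "s(t := V j, ?cnt := f ?xs - Suc j, ?k := j)"
      have "big_step (Atom (Dec ?cnt)) (?S j) (?s1, i, u)"
        using * by (auto intro!: big_step_dec simp: fun_eq_iff)
      moreover have "big_step ch (?s1, i, u) (?s1(?new := V (Suc j)), i, u)"
      proof -
        have "big_step ch (?s1, i, u) (?s1(?new := h (?s1 ?k) (?s1 t) (map ?s1 rs)), i, u)"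
          by (rule ch) (use s * in auto)
        moreover have "map ?s1 rs = ?xs" by (rule rsu) auto
        moreover have "?s1 ?k = j" "?s1 t = V j" using * by auto
        ultimately show ?thesis by (simp only: V)
      qed
      moreover have "big_step (clear t) (?s1(?new := V (Suc j)), i, u)
          (?s1(?new := V (Suc j), t := 0), i, u)" by (rule big_step_clear)
      moreover have "big_step (move ?new t) (?s1(?new := V (Suc j), t := 0), i, u)
          (s(t := V (Suc j), ?cnt := f ?xs - Suc j, ?k := j), i, u)"
      proof -
        have "s(t := V (Suc j), ?cnt := f ?xs - Suc j, ?k := j) =
           (let s' = ?s1(?new := V (Suc j), t := 0) in s'(?new := 0, t := s' t + s' ?new))"
          using s * by (auto simp: fun_eq_iff)
        then show ?thesis using big_step_move[of ?new t "?s1(?new := V (Suc j), t := 0)" i u] *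
          by (simp add: Let_def)
      qed
      moreover have "big_step (Atom (Inc ?k)) (s(t := V (Suc j), ?cnt := f ?xs - Suc j, ?k := j), i, u) (?S (Suc j))"
        by (auto intro!: big_step_inc)
      ultimately show "big_step ?body (?S j) (?S (Suc j))"
        by (blast intro: big_step.Seq)
    qed auto
    have "s(t := V (f ?xs)) = s(t := V (f ?xs), ?cnt := f ?xs - f ?xs, ?k := f ?xs, ?k := 0)"
      using s * by (auto simp: fun_eq_iff)
    then have 4: "big_step (clear ?k) (?S (f ?xs)) (s(t := V (f ?xs)), i, u)"
      using big_step_clear[of ?k "s(t := V (f ?xs), ?cnt := f ?xs - f ?xs, ?k := f ?xs)" i u] by simp
    from 1 2 3 4 show ?thesis unfolding V_def by (blast intro: big_step.Seq)
  qed
  then show "\<exists>c. \<forall>s i u. (\<forall>r\<ge>d. s r = 0) \<and> s t = 0 \<longrightarrow>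
        big_step c (s, i, u) (s(t := rec_nat (g (map s rs)) (\<lambda>k a. h k a (map s rs)) (f (map s rs))), i, u)"
    by blast
qed

section \<open>Arithmetic, decidable relations and bounded sums\<close>

lemma computable_const: "computable (\<lambda>xs. c)"
  by (induction c) (auto intro: computable_zero computable_Suc)

lemma computable_add:
  assumes "computable f" "computable g"
  shows "computable (\<lambda>xs. f xs + g xs)"
proof -
  have "rec_nat (f xs) (\<lambda>k a. Suc a) n = f xs + n" for xs n
    by (induction n) auto
  moreover have "computable (\<lambda>xs. rec_nat (f xs) (\<lambda>k a. Suc a) (g xs))"
    by (intro computable_rec assms computable_Suc computable_arg)
  ultimately show ?thesis by simp
qed

lemma computable_mult:
  assumes "computable f" "computable g"
  shows "computable (\<lambda>xs. f xs * g xs)"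
proof -
  have "rec_nat 0 (\<lambda>k a. a + f xs) n = f xs * n" for xs n
    by (induction n) auto
  moreover have "computable (\<lambda>xs. rec_nat 0 (\<lambda>k a. a + f xs) (g xs))"
    by (intro computable_rec assms computable_zero computable_add computable_arg computable_tl)
  ultimately show ?thesis by simp
qed

lemma computable_power:
  assumes "computable f" "computable g"
  shows "computable (\<lambda>xs. f xs ^ g xs)"
proof -
  have "rec_nat 1 (\<lambda>k a. a * f xs) n = f xs ^ n" for xs n
    by (induction n) auto
  moreover have "computable (\<lambda>xs. rec_nat 1 (\<lambda>k a. a * f xs) (g xs))"
    by (intro computable_rec assms computable_const computable_mult computable_arg computable_tl)
  ultimately show ?thesis by simp
qed

lemma computable_diff:
  assumes "computable f" "computable g"
  shows "computable (\<lambda>xs. f xs - g xs)"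
proof -
  \<comment> \<open>The predecessor is the recursion that forgets its accumulator and returns the
    last counter.\<close>
  have p: "computable (\<lambda>xs. f xs - 1)" if "computable f" for f
  proof -
    have "computable (\<lambda>xs. rec_nat 0 (\<lambda>k a. k) (f xs))"
      by (intro computable_rec that computable_zero computable_arg)
    moreover have "rec_nat 0 (\<lambda>k a. k) n = n - 1" for n :: nat by (cases n) auto
    ultimately show ?thesis by simp
  qed
  have "rec_nat (f xs) (\<lambda>k a. a - 1) n = f xs - n" for xs n
    by (induction n) auto
  moreover have "computable (\<lambda>xs. rec_nat (f xs) (\<lambda>k a. a - 1) (g xs))"
    by (intro computable_rec assms p computable_arg)
  ultimately show ?thesis by simp
qed

lemma computable_le:
  assumes "computable f" "computable g"
  shows "computable (\<lambda>xs. of_bool (f xs \<le> g xs))"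
proof -
  have "computable (\<lambda>xs. 1 - (f xs - g xs))"
    by (intro computable_diff computable_const assms)
  moreover have "(1 - (f xs - g xs)) = of_bool (f xs \<le> g xs)" for xs by auto
  ultimately show ?thesis by simp
qed

lemma computable_less:
  assumes "computable f" "computable g"
  shows "computable (\<lambda>xs. of_bool (f xs < g xs))"
  using computable_le[OF computable_Suc[OF assms(1)] assms(2)] by (simp add: Suc_le_eq)

lemma computable_conj:
  assumes "computable (\<lambda>xs. of_bool (P xs))" "computable (\<lambda>xs. of_bool (Q xs))"
  shows "computable (\<lambda>xs. of_bool (P xs \<and> Q xs))"
  using computable_mult[OF assms] by (simp only: of_bool_conj)

lemma computable_eq:
  assumes "computable f" "computable g"
  shows "computable (\<lambda>xs. of_bool (f xs = g xs))"
  using computable_conj[OF computable_le[OF assms] computable_le[OF assms(2,1)]]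
  by (simp add: eq_iff)

text \<open>Bounded sums later express universal quantifiers (the sum of violations is zero), ranks,
  and the selection of a unique witness.\<close>

lemma computable_sum:
  assumes f: "computable f" and h: "computable (\<lambda>ys. h (arg ys 0) (tl ys))"
  shows "computable (\<lambda>xs. \<Sum>k<f xs. h k xs)"
proof -
  have "rec_nat 0 (\<lambda>k a. a + h k xs) n = (\<Sum>k<n. h k xs)" for xs n
    by (induction n) auto
  moreover have "computable (\<lambda>xs. rec_nat 0 (\<lambda>k a. a + h k xs) (f xs))"
  proof (intro computable_rec f computable_zero computable_add computable_arg)
    show "computable (\<lambda>ys. h (arg ys 0) (tl (tl ys)))"
      using computable_args[OF h, of "[0]" 2] by (simp add: drop_Suc numeral_2_eq_2)
  qed
  ultimately show ?thesis by simp
qed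

text \<open>The quotient counts the positive multiples of the divisor up to the dividend; the
  conjunct \<open>0 < g xs\<close> reproduces the convention \<open>x div 0 = 0\<close>.\<close>

lemma computable_div:
  assumes "computable f" "computable g"
  shows "computable (\<lambda>xs. f xs div g xs)"
proof -
  have "computable (\<lambda>xs. \<Sum>k<f xs. of_bool (Suc k * g xs \<le> f xs \<and> 0 < g xs))"
    by (intro computable_sum computable_conj computable_le computable_less computable_mult
        computable_Suc computable_zero computable_arg computable_tl assms)
  moreover have "(\<Sum>k<a. of_bool (Suc k * b \<le> a \<and> 0 < b)) = a div b" for a b :: nat
  proof (cases "b = 0")
    case False
    have "Suc k * b \<le> a \<longleftrightarrow> k < a div b" for k
      using False by (simp add: less_eq_div_iff_mult_less_eq flip: Suc_le_eq)
    moreover have "k < a" if "k < a div b" for k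
      using that by (meson div_le_dividend order_less_le_trans)
    ultimately have "{..<a} \<inter> {k. Suc k * b \<le> a \<and> 0 < b} = {..<a div b}"
      using False by auto
    then show ?thesis by (simp add: sum_of_bool_eq del: mult_Suc)
  qed auto
  ultimately show ?thesis by simp
qed

lemma computable_mod:
  assumes "computable f" "computable g"
  shows "computable (\<lambda>xs. f xs mod g xs)"
  unfolding modulo_nat_def by (intro computable_diff computable_mult computable_div assms)

lemmas computable_intros =
  computable_arg computable_const computable_Suc computable_add computable_mult computable_power
  computable_diff computable_div computable_mod computable_le computable_less computable_eq
  computable_conj computable_sum

section \<open>Parsing the input and writing a bitmap\<close>


definition bits_value :: "bool list \<Rightarrow> nat" where
  "bits_value bs = foldl (\<lambda>a b. 2 * a + of_bool b) 0 bs"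

lemma bits_value_bin_nat: "bits_value (bin_nat n) = n"
proof (induction n rule: bin_nat.induct)
  case (1 n)
  then show ?case
    by (subst bin_nat.simps) (auto simp: bits_value_def odd_iff_mod_2_eq_one)
qed

text \<open>Register \<open>4\<close> signals that a bit has been read, register \<open>5\<close> holds it.\<close>

definition read_bit :: "bool \<Rightarrow> com" where
  "read_bit t = Atom (Read t 4 5)"

definition push_bit :: "nat \<Rightarrow> com" where
  "push_bit r = While r (Atom (Dec r) ;; Atom (Inc 6) ;; Atom (Inc 6)) ;; move 6 r ;; move 5 r"

definition read_unary :: "bool \<Rightarrow> nat \<Rightarrow> com" where
  "read_unary t r = read_bit t ;;
     While 5 (Atom (Dec 5) ;; Atom (Dec 4) ;; Atom (Inc r) ;; read_bit t) ;; Atom (Dec 4)"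

text \<open>For the last number of an input, which ends where the input ends: register
  \<open>4\<close> then stays zero. \<open>read_block\<close> serves a number whose length was
  announced in unary.\<close>

definition read_bits :: "bool \<Rightarrow> nat \<Rightarrow> com" where
  "read_bits t r = read_bit t ;; While 4 (Atom (Dec 4) ;; push_bit r ;; read_bit t)"

definition read_block :: "bool \<Rightarrow> nat \<Rightarrow> nat \<Rightarrow> com" where
  "read_block t l r = While l (Atom (Dec l) ;; read_bit t ;; Atom (Dec 4) ;; push_bit r)"

section \<open>Correctness of the parsing programs\<close>

lemma big_step_read_Nil: "i t = [] \<Longrightarrow> big_step (read_bit t) (s, i, u) (s, i, u)"
  using big_step.Atom[of "Read t 4 5" "(s, i, u)"] by (simp add: read_bit_def)

lemma big_step_read_Cons:
  assumes "i t = b # bs" "s 4 = 0" "s 5 = 0"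
  shows "big_step (read_bit t) (s, i, u) (s(4 := 1, 5 := of_bool b), i(t := bs), u)"
proof -
  have "(\<lambda>x. if x = 4 \<or> x = 5 \<and> b then Suc (s x) else s x) = s(4 := 1, 5 := of_bool b)"
    using assms by (auto simp: fun_eq_iff)
  then show ?thesis
    using big_step.Atom[of "Read t 4 5" "(s, i, u)"] assms by (simp add: read_bit_def)
qed

lemma big_step_push_bit:
  assumes "r \<notin> {5, 6}" "s 6 = 0"
  shows "big_step (push_bit r) (s, i, u) (s(r := 2 * s r + s 5, 5 := 0), i, u)"
proof -
  let ?S = "\<lambda>j. (s(r := s r - j, 6 := 2 * j), i, u)"
  have "big_step (While r (Atom (Dec r) ;; Atom (Inc 6) ;; Atom (Inc 6))) (?S 0) (?S (s r))"
    by (rule big_step_While)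
       (use assms in \<open>auto intro!: big_step.Seq[OF big_step_dec[OF refl]] big_step.Seq[OF big_step_inc[OF refl]] big_step_inc\<close>)
  moreover have "?S 0 = (s, i, u)" using assms by (auto simp: fun_eq_iff)
  moreover have "big_step (move 6 r) (?S (s r)) (s(r := 2 * s r), i, u)"
  proof -
    have "s(r := 2 * s r) = (let s' = s(r := s r - s r, 6 := 2 * s r) in s'(6 := 0, r := s' r + s' 6))"
      using assms by (auto simp: fun_eq_iff)
    then show ?thesis using big_step_move[of 6 r "s(r := s r - s r, 6 := 2 * s r)" i u] assms
      by (simp add: Let_def)
  qed
  moreover have "big_step (move 5 r) (s(r := 2 * s r), i, u) (s(r := 2 * s r + s 5, 5 := 0), i, u)"
  proof -
    have "s(r := 2 * s r + s 5, 5 := 0) = (let s' = s(r := 2 * s r) in s'(5 := 0, r := s' r + s' 5))"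
      using assms by (auto simp: fun_eq_iff)
    then show ?thesis using big_step_move[of 5 r "s(r := 2 * s r)" i u] assms
      by (simp add: Let_def)
  qed
  ultimately show ?thesis unfolding push_bit_def by (auto intro: big_step.Seq)
qed

lemma big_step_read_unary:
  assumes "i t = replicate n True @ False # bs" "s 4 = 0" "s 5 = 0" "r \<notin> {4, 5}"
  shows "big_step (read_unary t r) (s, i, u) (s(r := s r + n), i(t := bs), u)"
proof -
  let ?rest = "\<lambda>j. drop (Suc j) (replicate n True @ False # bs)"
  \<comment> \<open>State at the loop head after \<open>j\<close> ones: the next bit has already
    been consumed into register \<open>5\<close>, hence \<open>Suc j\<close> bits are gone.\<close>
  let ?S = "\<lambda>j. (s(r := s r + j, 4 := 1, 5 := of_bool (j < n)), i(t := ?rest j), u)"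
  have split: "drop j (replicate n True @ False # bs) = (j < n) # ?rest j" if "j \<le> n" for j
  proof -
    have "drop j (replicate n True @ False # bs)
       = (replicate n True @ False # bs) ! j # ?rest j"
      by (rule Cons_nth_drop_Suc[symmetric]) (use that in simp)
    then show ?thesis using that by (auto simp: nth_append)
  qed
  have "i t = (0 < n) # ?rest 0" using split[of 0] assms by simp
  then have 1: "big_step (read_bit t) (s, i, u) (?S 0)"
    using big_step_read_Cons[of i t "0 < n" "?rest 0" s u] assms by (simp add: fun_upd_twist)
  have 2: "big_step (While 5 (Atom (Dec 5) ;; Atom (Dec 4) ;; Atom (Inc r) ;; read_bit t)) (?S 0) (?S n)"
  proof (rule big_step_While, rule conjI)
    fix j assume j: "j < n"
    let ?s = "s(r := s r + Suc j)"
    have a: "big_step (Atom (Dec 5)) (?S j) (s(r := s r + j, 4 := 1), i(t := ?rest j), u)"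
      by (rule big_step_dec) (use j assms in \<open>auto simp: fun_eq_iff\<close>)
    have b: "big_step (Atom (Dec 4)) (s(r := s r + j, 4 := 1), i(t := ?rest j), u) (s(r := s r + j), i(t := ?rest j), u)"
      by (rule big_step_dec) (use j assms in \<open>auto simp: fun_eq_iff\<close>)
    have c: "big_step (Atom (Inc r)) (s(r := s r + j), i(t := ?rest j), u) (?s, i(t := ?rest j), u)"
      by (rule big_step_inc) simp
    have d: "big_step (read_bit t) (?s, i(t := ?rest j), u) (?S (Suc j))"
      using big_step_read_Cons[of "i(t := ?rest j)" t "Suc j < n" "?rest (Suc j)" ?s u] assms split[of "Suc j"] j
      by simp
    show "big_step (Atom (Dec 5) ;; Atom (Dec 4) ;; Atom (Inc r) ;; read_bit t) (?S j) (?S (Suc j))"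
      by (rule big_step.Seq[OF a big_step.Seq[OF b big_step.Seq[OF c d]]])
  qed auto
  have 3: "big_step (Atom (Dec 4)) (?S n) (s(r := s r + n), i(t := bs), u)"
    by (rule big_step_dec) (use assms in \<open>auto simp: fun_eq_iff\<close>)
  show ?thesis unfolding read_unary_def by (rule big_step.Seq[OF 1 big_step.Seq[OF 2 3]])
qed

lemma big_step_read_bits:
  assumes "i t = bs" "s 4 = 0" "s 5 = 0" "s 6 = 0" "r \<notin> {4, 5, 6}"
  shows "big_step (read_bits t r) (s, i, u)
    (s(r := foldl (\<lambda>a b. 2 * a + of_bool b) (s r) bs), i(t := []), u)"
  using assms
proof (induction bs arbitrary: s i)
  case Nil
  then have "i(t := []) = i" by auto
  then show ?case
    using Nil unfolding read_bits_def
    by (auto intro!: big_step.Seq[OF big_step_read_Nil] While_False)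
next
  case (Cons b bs)
  let ?s = "s(r := 2 * s r + of_bool b)"
  let ?c = "Atom (Dec 4) ;; push_bit r ;; read_bit t"
  have 1: "big_step (read_bit t) (s, i, u) (s(4 := 1, 5 := of_bool b), i(t := bs), u)"
    by (rule big_step_read_Cons) (use Cons.prems in auto)
  have 2: "big_step (Atom (Dec 4)) (s(4 := 1, 5 := of_bool b), i(t := bs), u) (s(5 := of_bool b), i(t := bs), u)"
    by (rule big_step_dec) (use Cons.prems in \<open>auto simp: fun_eq_iff\<close>)
  have eq: "?s = (s(5 := of_bool b))(r := 2 * (s(5 := of_bool b)) r + (s(5 := of_bool b)) 5, 5 := 0)"
    using Cons.prems by (auto simp: fun_eq_iff)
  have 3: "big_step (push_bit r) (s(5 := of_bool b), i(t := bs), u) (?s, i(t := bs), u)"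
    by (subst eq, rule big_step_push_bit) (use Cons.prems in auto)
  have "big_step (read_bits t r) (?s, i(t := bs), u)
     (?s(r := foldl (\<lambda>a b. 2 * a + of_bool b) (?s r) bs), (i(t := bs))(t := []), u)"
    by (rule Cons.IH) (use Cons.prems in auto)
  then have "big_step (read_bits t r) (?s, i(t := bs), u)
    (s(r := foldl (\<lambda>a b. 2 * a + of_bool b) (s r) (b # bs)), i(t := []), u)" by simp
  \<comment> \<open>The run on the remaining bits is cut after its first read: that read closes the
    present iteration, and what follows is the rest of the loop.\<close>
  then obtain st where st: "big_step (read_bit t) (?s, i(t := bs), u) st"
    "big_step (While 4 ?c) st (s(r := foldl (\<lambda>a b. 2 * a + of_bool b) (s r) (b # bs)), i(t := []), u)"
    unfolding read_bits_def by (rule big_step_SeqE)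
  have "big_step ?c (s(4 := 1, 5 := of_bool b), i(t := bs), u) st"
    by (rule big_step.Seq[OF 2 big_step.Seq[OF 3 st(1)]])
  then have 4: "big_step (While 4 ?c) (s(4 := 1, 5 := of_bool b), i(t := bs), u)
      (s(r := foldl (\<lambda>a b. 2 * a + of_bool b) (s r) (b # bs)), i(t := []), u)"
    by (intro While_True[OF _ _ st(2)]) auto
  show ?case unfolding read_bits_def by (rule big_step.Seq[OF 1 4])
qed

lemma big_step_read_block:
  assumes "i t = bs @ cs" "s l = length bs" "s 4 = 0" "s 5 = 0" "s 6 = 0"
    "r \<notin> {4, 5, 6, l}" "l \<notin> {4, 5, 6}"
  shows "big_step (read_block t l r) (s, i, u)
    (s(l := 0, r := foldl (\<lambda>a b. 2 * a + of_bool b) (s r) bs), i(t := cs), u)"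
  using assms
proof (induction bs arbitrary: s i)
  case Nil
  then have "i(t := cs) = i" "s(l := 0) = s" by auto
  then show ?case
    using Nil unfolding read_block_def by (auto intro!: While_False)
next
  case (Cons b bs)
  let ?sl = "s(l := length bs)"
  let ?s = "?sl(r := 2 * s r + of_bool b)"
  have 0: "big_step (Atom (Dec l)) (s, i, u) (?sl, i, u)"
    by (rule big_step_dec) (use Cons.prems in auto)
  have 1: "big_step (read_bit t) (?sl, i, u) (?sl(4 := 1, 5 := of_bool b), i(t := bs @ cs), u)"
    by (rule big_step_read_Cons) (use Cons.prems in auto)
  have 2: "big_step (Atom (Dec 4)) (?sl(4 := 1, 5 := of_bool b), i(t := bs @ cs), u) (?sl(5 := of_bool b), i(t := bs @ cs), u)"
    by (rule big_step_dec) (use Cons.prems in \<open>auto simp: fun_eq_iff\<close>)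
  have eq: "?s = (?sl(5 := of_bool b))(r := 2 * (?sl(5 := of_bool b)) r + (?sl(5 := of_bool b)) 5, 5 := 0)"
    using Cons.prems by (auto simp: fun_eq_iff)
  have 3: "big_step (push_bit r) (?sl(5 := of_bool b), i(t := bs @ cs), u) (?s, i(t := bs @ cs), u)"
    by (subst eq, rule big_step_push_bit) (use Cons.prems in auto)
  have "big_step (read_block t l r) (?s, i(t := bs @ cs), u)
     (?s(l := 0, r := foldl (\<lambda>a b. 2 * a + of_bool b) (?s r) bs), (i(t := bs @ cs))(t := cs), u)"
    by (rule Cons.IH) (use Cons.prems in auto)
  moreover have "?s(l := 0, r := foldl (\<lambda>a b. 2 * a + of_bool b) (?s r) bs)
      = s(l := 0, r := foldl (\<lambda>a b. 2 * a + of_bool b) (s r) (b # bs))"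
    using Cons.prems by (auto simp: fun_eq_iff)
  ultimately have 4: "big_step (read_block t l r) (?s, i(t := bs @ cs), u)
     (s(l := 0, r := foldl (\<lambda>a b. 2 * a + of_bool b) (s r) (b # bs)), i(t := cs), u)" by simp
  show ?case unfolding read_block_def
    by (rule While_True[OF _ big_step.Seq[OF 0 big_step.Seq[OF 1 big_step.Seq[OF 2 3]]]
          4[unfolded read_block_def]])
       (use Cons.prems in simp)
qed

definition output_loop :: "com \<Rightarrow> com" where
  "output_loop c = While 8 (Atom (Dec 8) ;; c ;; Atom (Write 10) ;; clear 10 ;; Atom (Inc 9))"

text \<open>Registers \<open>0\<close> to \<open>3\<close> hold \<open>v\<close>, the index,
  \<open>n\<close> and \<open>K\<close>; \<open>4\<close> to \<open>6\<close> serve parsing,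
  \<open>7\<close> the length of \<open>bin_nat n\<close>, and \<open>8\<close> to \<open>10\<close>
  the remaining length, the position and the value of the output. The unary prefix is
  self-delimiting, so the index may be any string.\<close>

theorem bitmap_machine:
  assumes "computable g" "computable l"
  shows "\<exists>M. wf_tm M \<and> (\<forall>v bs n K.
     tm_computes M (replicate v True @ False # bs) (encode_pair n K)
       (map (\<lambda>k. g [k, bits_value bs, v, n, K] \<noteq> 0) [0..<l [K]]))"
proof -
  obtain cl where cl: "\<And>s i u. (\<And>r. r \<ge> 9 \<Longrightarrow> s r = 0) \<Longrightarrow> s 8 = 0 \<Longrightarrow>
        big_step cl (s, i, u) (s(8 := l (map s [3])), i, u)"
    using computableE[OF assms(2), of "[3]" 9 8] by auto
  obtain cg where cg: "\<And>s i u. (\<And>r. r \<ge> 11 \<Longrightarrow> s r = 0) \<Longrightarrow> s 10 = 0 \<Longrightarrow>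
        big_step cg (s, i, u) (s(10 := g (map s [9, 1, 0, 2, 3])), i, u)"
    using computableE[OF assms(1), of "[9, 1, 0, 2, 3]" 11 10] by auto
  let ?c = "read_unary False 0 ;; read_bits False 1 ;;
      read_unary True 7 ;; read_block True 7 2 ;; read_bits True 3 ;; cl ;; output_loop cg"
  obtain M where M: "wf_tm M" "\<And>p y s i x.
     big_step ?c (\<lambda>_. 0, input_of p y, []) (s, i, x) \<Longrightarrow> tm_computes M p y x"
    using com_computable[of ?c] by blast
  have "tm_computes M (replicate v True @ False # bs) (encode_pair n K)
       (map (\<lambda>k. g [k, bits_value bs, v, n, K] \<noteq> 0) [0..<l [K]])" for v bs n K
  proof -
    let ?p = "replicate v True @ False # bs" and ?y = "encode_pair n K"
    let ?i = "input_of ?p ?y"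
    define s where "s = (\<lambda>_ :: nat. 0 :: nat)(0 := v, 1 := bits_value bs, 2 := n, 3 := K)"
    have s_eq: "(\<lambda>_ :: nat. 0)(0 := v, 1 := bits_value bs, 7 := 0, 2 := n, 3 := K) = s"
      by (auto simp: s_def)
    have 1: "big_step (read_unary False 0) (\<lambda>_. 0, ?i, []) ((\<lambda>_. 0)(0 := v), ?i(False := bs), [])"
      using big_step_read_unary[of ?i False v bs "\<lambda>_. 0" 0 "[]"] by (simp add: input_of_def)
    have 2: "big_step (read_bits False 1) ((\<lambda>_. 0)(0 := v), ?i(False := bs), [])
        ((\<lambda>_. 0)(0 := v, 1 := bits_value bs), ?i(False := []), [])"
      using big_step_read_bits[of "?i(False := bs)" False bs "(\<lambda>_. 0)(0 := v)" 1 "[]"]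
      by (simp add: bits_value_def)
    have 3: "big_step (read_unary True 7) ((\<lambda>_. 0)(0 := v, 1 := bits_value bs), ?i(False := []), [])
        ((\<lambda>_. 0)(0 := v, 1 := bits_value bs, 7 := length (bin_nat n)),
          ?i(False := [], True := bin_nat n @ bin_nat K), [])"
      using big_step_read_unary[of "?i(False := [])" True "length (bin_nat n)" "bin_nat n @ bin_nat K"
          "(\<lambda>_. 0)(0 := v, 1 := bits_value bs)" 7 "[]"]
      by (simp add: input_of_def encode_pair_def)
    have 4: "big_step (read_block True 7 2)
        ((\<lambda>_. 0)(0 := v, 1 := bits_value bs, 7 := length (bin_nat n)),
          ?i(False := [], True := bin_nat n @ bin_nat K), [])
        ((\<lambda>_. 0)(0 := v, 1 := bits_value bs, 7 := 0, 2 := n), ?i(False := [], True := bin_nat K), [])"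
      using big_step_read_block[of "?i(False := [], True := bin_nat n @ bin_nat K)" True "bin_nat n" "bin_nat K"
        "(\<lambda>_. 0)(0 := v, 1 := bits_value bs, 7 := length (bin_nat n))" 7 2 "[]"]
        bits_value_bin_nat[of n]
      by (simp add: bits_value_def)
    have 5: "big_step (read_bits True 3)
        ((\<lambda>_. 0)(0 := v, 1 := bits_value bs, 7 := 0, 2 := n), ?i(False := [], True := bin_nat K), [])
        (s, ?i(False := [], True := []), [])"
      using big_step_read_bits[of "?i(False := [], True := bin_nat K)" True "bin_nat K"
        "(\<lambda>_. 0)(0 := v, 1 := bits_value bs, 7 := 0, 2 := n)" 3 "[]"]
        bits_value_bin_nat[of K] s_eq
      by (simp add: bits_value_def)
    have 6: "big_step cl (s, ?i(False := [], True := []), []) (s(8 := l [K]), ?i(False := [], True := []), [])"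
      using cl[of s "?i(False := [], True := [])" "[]"] by (simp add: s_def)
    have 7: "big_step (output_loop cg) (s(8 := l [K]), ?i(False := [], True := []), [])
       (s(9 := l [K]), ?i(False := [], True := []), map (\<lambda>k. g [k, bits_value bs, v, n, K] \<noteq> 0) [0..<l [K]])"
    proof -
      let ?f = "\<lambda>k. g [k, bits_value bs, v, n, K]"
      let ?j = "?i(False := [], True := [])"
      let ?s = "\<lambda>k. s(8 := l [K] - k, 9 := k)"
      let ?S = "\<lambda>k. (?s k, ?j, map (\<lambda>k. ?f k \<noteq> 0) [0..<k])"
      have "big_step (output_loop cg) (?S 0) (?S (l [K]))"
        unfolding output_loop_def
      proof (rule big_step_While, rule conjI)
        fix k assume k: "k < l [K]"
        let ?u = "map (\<lambda>k. ?f k \<noteq> 0) [0..<k]" and ?u' = "map (\<lambda>k. ?f k \<noteq> 0) [0..<Suc k]"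
        let ?s1 = "s(8 := l [K] - Suc k, 9 := k)"
        have a: "big_step (Atom (Dec 8)) (?S k) (?s1, ?j, ?u)"
          by (rule big_step_dec) (auto simp: fun_eq_iff)
        have b: "big_step cg (?s1, ?j, ?u) (?s1(10 := ?f k), ?j, ?u)"
          using cg[of ?s1 ?j ?u] by (simp add: s_def)
        have c: "big_step (Atom (Write 10)) (?s1(10 := ?f k), ?j, ?u) (?s1(10 := ?f k), ?j, ?u')"
          using big_step.Atom[of "Write 10" "(?s1(10 := ?f k), ?j, ?u)"] by simp
        have "?s1(10 := ?f k, 10 := 0) = ?s1" by (auto simp: fun_eq_iff s_def)
        then have d: "big_step (clear 10) (?s1(10 := ?f k), ?j, ?u') (?s1, ?j, ?u')"
          using big_step_clear[of 10 "?s1(10 := ?f k)" ?j ?u'] by (simp only:)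
        have e: "big_step (Atom (Inc 9)) (?s1, ?j, ?u') (?S (Suc k))"
          by (rule big_step_inc) simp
        show "big_step (Atom (Dec 8) ;; cg ;; Atom (Write 10) ;; clear 10 ;; Atom (Inc 9)) (?S k) (?S (Suc k))"
          by (rule big_step.Seq[OF a big_step.Seq[OF b big_step.Seq[OF c big_step.Seq[OF d e]]]])
      qed auto
      moreover have "?s 0 = s(8 := l [K])" "?s (l [K]) = s(9 := l [K])"
        by (auto simp: fun_eq_iff s_def)
      ultimately show ?thesis by simp
    qed
    show ?thesis
      by (rule M(2)[OF big_step.Seq[OF 1 big_step.Seq[OF 2 big_step.Seq[OF 3 big_step.Seq[OF 4
            big_step.Seq[OF 5 big_step.Seq[OF 6 7]]]]]]])
  qed
  with M(1) show ?thesis by blast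
qed

section \<open>Enumerating spread sets\<close>


text \<open>Twice the signed area of the triangle, in lattice units.\<close>

definition det3 :: "int \<times> int \<Rightarrow> int \<times> int \<Rightarrow> int \<times> int \<Rightarrow> int" where
  "det3 a b c = (fst b - fst a) * (snd c - snd a) - (fst c - fst a) * (snd b - snd a)"

definition cell :: "nat \<Rightarrow> nat \<Rightarrow> int \<times> int" where
  "cell K a = (int (a div K), int (a mod K))"

text \<open>In the unit square this says that the area is at most \<open>T / (2 n^3)\<close>;
  denominators are cleared so that natural arithmetic can decide it.\<close>

definition small :: "nat \<Rightarrow> nat \<Rightarrow> nat \<Rightarrow> int \<times> int \<Rightarrow> int \<times> int \<Rightarrow> int \<times> int \<Rightarrow> bool" where
  "small n K T a b c \<longleftrightarrow> \<bar>det3 a b c\<bar> * int (n ^ 3) \<le> int (T * (K - 1)\<^sup>2)"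

definition spread_sets :: "nat \<Rightarrow> nat \<Rightarrow> nat \<Rightarrow> nat set set" where
  "spread_sets n K T = {S. S \<subseteq> {..<K * K} \<and> card S = n \<and>
     (\<forall>a\<in>S. \<forall>b\<in>S. \<forall>c\<in>S. a < b \<and> b < c \<longrightarrow> \<not> small n K T (cell K a) (cell K b) (cell K c))}"

definition digit :: "nat \<Rightarrow> nat \<Rightarrow> nat" where
  "digit N a = N div 2 ^ a mod 2"

text \<open>One of the two truncated differences is zero, so their sum is the absolute value of the
  expanded determinant, obtained without signed numbers.\<close>

definition abs_det :: "nat \<Rightarrow> nat \<Rightarrow> nat \<Rightarrow> nat \<Rightarrow> nat" where
  "abs_det K a b c =
     ((a div K) * (b mod K) + (b div K) * (c mod K) + (c div K) * (a mod K)
        - ((b div K) * (a mod K) + (c div K) * (b mod K) + (a div K) * (c mod K)))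
     + ((b div K) * (a mod K) + (c div K) * (b mod K) + (a div K) * (c mod K)
        - ((a div K) * (b mod K) + (b div K) * (c mod K) + (c div K) * (a mod K)))"

definition valid :: "nat \<Rightarrow> nat \<Rightarrow> nat \<Rightarrow> nat \<Rightarrow> bool" where
  "valid n K T N \<longleftrightarrow> (\<Sum>a<K * K. digit N a) = n \<and>
     (\<Sum>a<K * K. \<Sum>b<K * K. \<Sum>c<K * K. digit N a * digit N b * digit N c *
        of_bool (a < b \<and> b < c \<and> abs_det K a b c * n ^ 3 \<le> T * (K - 1)\<^sup>2)) = 0"

text \<open>Arguments: position, index, \<open>v\<close>, \<open>n\<close>, \<open>K\<close>. The
  sum over all bitmaps, coded as numbers \<open>N\<close>, has one term for the valid number
  preceded by exactly \<open>index\<close> valid ones, and returns its digit at the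
  position.\<close>

definition decode :: "nat \<Rightarrow> nat list \<Rightarrow> nat" where
  "decode D xs = (\<Sum>N<2 ^ (arg xs 4 * arg xs 4).
     of_bool (valid (arg xs 3) (arg xs 4) (D * arg xs 2) N \<and>
              (\<Sum>N'<N. of_bool (valid (arg xs 3) (arg xs 4) (D * arg xs 2) N')) = arg xs 1) *
     digit N (arg xs 0))"

lemma computable_decode: "computable (decode D)"
  unfolding decode_def valid_def digit_def abs_det_def
  by (intro computable_intros; simp add: computable_arg)

section \<open>Correctness of the enumeration and length of an index\<close>

lemma abs_det_eq: "int (abs_det K a b c) = \<bar>det3 (cell K a) (cell K b) (cell K c)\<bar>"
proof -
  define p q where
    "p = (a div K) * (b mod K) + (b div K) * (c mod K) + (c div K) * (a mod K)" and
    "q = (b div K) * (a mod K) + (c div K) * (b mod K) + (a div K) * (c mod K)"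
  have "det3 (cell K a) (cell K b) (cell K c) = int p - int q"
    unfolding p_def q_def det3_def cell_def by (simp add: algebra_simps)
  moreover have "abs_det K a b c = (p - q) + (q - p)"
    unfolding abs_det_def p_def q_def by simp
  ultimately show ?thesis by (simp add: abs_if)
qed

lemma digit_eq: "digit N a = of_bool (a \<in> set_decode N)"
  by (simp add: digit_def set_decode_def odd_iff_mod_2_eq_one)

lemma set_decode_subset:
  assumes "N < 2 ^ L"
  shows "set_decode N \<subseteq> {..<L}"
proof
  fix a assume "a \<in> set_decode N"
  then have "odd (N div 2 ^ a)" by (simp add: set_decode_def)
  then have "N div 2 ^ a \<noteq> 0" by (intro notI) simp
  then have "2 ^ a \<le> N" by (simp add: div_eq_0_iff)
  with assms have "2 ^ a < (2 :: nat) ^ L" by linarith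
  then show "a \<in> {..<L}" by simp
qed

lemma set_encode_less:
  assumes "S \<subseteq> {..<L}"
  shows "set_encode S < 2 ^ L"
proof -
  have "set_encode S \<le> (\<Sum>a<L. 2 ^ a)"
    unfolding set_encode_def using assms by (intro sum_mono2) auto
  also have "\<dots> < 2 ^ L" by (induction L) auto
  finally show ?thesis .
qed

lemma valid_iff:
  assumes "N < 2 ^ (K * K)"
  shows "valid n K T N \<longleftrightarrow> set_decode N \<in> spread_sets n K T"
proof -
  have sub: "set_decode N \<subseteq> {..<K * K}" using set_decode_subset[OF assms] .
  have 1: "(\<Sum>a<K * K. digit N a) = card (set_decode N)"
  proof -
    have "(\<Sum>a<K * K. digit N a) = card ({..<K * K} \<inter> {a. a \<in> set_decode N})"
      unfolding digit_eq by simp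
    also have "{..<K * K} \<inter> {a. a \<in> set_decode N} = set_decode N" using sub by auto
    finally show ?thesis .
  qed
  have sm: "small n K T (cell K a) (cell K b) (cell K c) \<longleftrightarrow> abs_det K a b c * n ^ 3 \<le> T * (K - 1)\<^sup>2" for a b c
    unfolding small_def abs_det_eq[symmetric] by (metis of_nat_le_iff of_nat_mult)
  show ?thesis
    unfolding valid_def 1 spread_sets_def sm using sub
    by (auto simp: digit_eq subset_iff)
qed

lemma length_bin_nat: "2 ^ length (bin_nat n) \<le> max 1 (2 * n)"
proof (induction n rule: bin_nat.induct)
  case (1 n)
  show ?case
  proof (cases "n = 0")
    case True
    then show ?thesis by (subst bin_nat.simps) simp
  next
    case False
    then have "2 ^ length (bin_nat n) = 2 * 2 ^ length (bin_nat (n div 2))"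
      by (subst bin_nat.simps) simp
    also have "\<dots> \<le> 2 * max 1 (2 * (n div 2))" using 1 False by simp
    also have "\<dots> \<le> max 1 (2 * n)" using False by auto
    finally show ?thesis .
  qed
qed

lemma finite_spread_sets: "finite (spread_sets n K T)"
  by (rule finite_subset[of _ "Pow {..<K * K}"]) (auto simp: spread_sets_def)

lemma decode_complete:
  assumes S: "S \<in> spread_sets n K (D * v)"
  shows "\<exists>bs. 2 ^ length bs \<le> 2 * card (spread_sets n K (D * v)) \<and>
    (\<forall>k<K * K. decode D [k, bits_value bs, v, n, K] \<noteq> 0 \<longleftrightarrow> k \<in> S)"
proof -
  let ?V = "valid n K (D * v)"
  define N0 where "N0 = set_encode S"
  \<comment> \<open>The index is the rank among valid numbers; it is strictly increasing on them and
    therefore identifies \<open>N0\<close>.\<close>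
  define rk where "rk N = card {M. M < N \<and> ?V M}" for N
  have sub: "S \<subseteq> {..<K * K}" using S by (simp add: spread_sets_def)
  then have fin: "finite S" using finite_subset by blast
  have N0: "N0 < 2 ^ (K * K)" using set_encode_less[OF sub] by (simp add: N0_def)
  have dec: "set_decode N0 = S" using fin by (simp add: N0_def)
  have V0: "?V N0" using valid_iff[OF N0] S dec by simp
  have rk_less: "rk M < rk N" if "M < N" "?V M" for M N
    unfolding rk_def by (rule psubset_card_mono) (use that in auto)
  then have uniq: "?V N \<and> rk N = rk N0 \<longleftrightarrow> N = N0" for N
    using V0 by (metis linorder_neqE_nat less_irrefl)
  have rk_sum: "(\<Sum>M<N. of_bool (?V M)) = rk N" for N
  proof -
    have "(\<Sum>M<N. of_bool (?V M)) = card ({..<N} \<inter> {M. ?V M})"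
      by simp
    also have "{..<N} \<inter> {M. ?V M} = {M. M < N \<and> ?V M}" by auto
    finally show ?thesis by (simp add: rk_def)
  qed
  have "rk N0 < rk (2 ^ (K * K))" using rk_less N0 V0 by blast
  also have "\<dots> = card (set_decode ` {M. M < 2 ^ (K * K) \<and> ?V M})"
    unfolding rk_def by (rule card_image[symmetric]) (metis inj_onI set_decode_inverse)
  also have "\<dots> \<le> card (spread_sets n K (D * v))"
    by (rule card_mono[OF finite_spread_sets]) (auto simp: valid_iff)
  finally have "rk N0 < card (spread_sets n K (D * v))" .
  then have "2 ^ length (bin_nat (rk N0)) \<le> 2 * card (spread_sets n K (D * v))"
    using length_bin_nat[of "rk N0"] by linarith
  moreover have "decode D [k, bits_value (bin_nat (rk N0)), v, n, K] = digit N0 k" for k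
  proof -
    have "decode D [k, bits_value (bin_nat (rk N0)), v, n, K]
       = (\<Sum>N<2 ^ (K * K). of_bool (?V N \<and> rk N = rk N0) * digit N k)"
      by (simp add: decode_def bits_value_bin_nat rk_sum arg_def)
    also have "\<dots> = (\<Sum>N<2 ^ (K * K). if N = N0 then digit N k else 0)"
      unfolding uniq by (intro sum.cong) auto
    also have "\<dots> = digit N0 k" using N0 by simp
    finally show ?thesis .
  qed
  ultimately show ?thesis
    by (intro exI[of _ "bin_nat (rk N0)"]) (auto simp: digit_eq dec)
qed

theorem spread_sets_compression:
  assumes "universal_tm U"
  shows "\<exists>q. \<forall>n K v S. S \<in> spread_sets n K (D * v) \<longrightarrow>
    (\<exists>m. 2 ^ m \<le> 2 * card (spread_sets n K (D * v)) \<and>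
       kolmogorov U (map (\<lambda>k. k \<in> S) [0..<K * K]) (encode_pair n K) \<le> q + v + m)"
proof -
  have "computable (\<lambda>xs. arg xs 0 * arg xs 0)" by (intro computable_intros)
  from bitmap_machine[OF computable_decode[of D] this]
  obtain M where M: "wf_tm M" "\<And>v bs n K.
     tm_computes M (replicate v True @ False # bs) (encode_pair n K)
       (map (\<lambda>k. decode D [k, bits_value bs, v, n, K] \<noteq> 0) [0..<K * K])"
    by auto
  then obtain q where q: "\<And>p y x. tm_computes M p y x \<Longrightarrow> tm_computes U (q @ p) y x"
    using assms unfolding universal_tm_def by meson
  show ?thesis
  \<comment> \<open>The additional one pays for the separator \<open>False\<close> between the unary
    prefix and the index.\<close>
  proof (rule exI[of _ "Suc (length q)"], intro allI impI)
    fix n K v S assume S: "S \<in> spread_sets n K (D * v)"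
    obtain bs where bs: "2 ^ length bs \<le> 2 * card (spread_sets n K (D * v))"
      "\<And>k. k < K * K \<Longrightarrow> decode D [k, bits_value bs, v, n, K] \<noteq> 0 \<longleftrightarrow> k \<in> S"
      using decode_complete[OF S] by blast
    have eq: "map (\<lambda>k. decode D [k, bits_value bs, v, n, K] \<noteq> 0) [0..<K * K]
        = map (\<lambda>k. k \<in> S) [0..<K * K]"
      using bs(2) by auto
    have "tm_computes U (q @ replicate v True @ False # bs) (encode_pair n K) (map (\<lambda>k. k \<in> S) [0..<K * K])"
      using q[OF M(2)[of v bs n K]] unfolding eq .
    then have "kolmogorov U (map (\<lambda>k. k \<in> S) [0..<K * K]) (encode_pair n K)
        \<le> length (q @ replicate v True @ False # bs)"
      unfolding kolmogorov_def by (intro Least_le) blast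
    then show "\<exists>m. 2 ^ m \<le> 2 * card (spread_sets n K (D * v)) \<and>
       kolmogorov U (map (\<lambda>k. k \<in> S) [0..<K * K]) (encode_pair n K) \<le> Suc (length q) + v + m"
      using bs(1) by (intro exI[of _ "length bs"]) simp
  qed
qed

section \<open>Lattice points in strips\<close>


definition cells :: "nat \<Rightarrow> (int \<times> int) set" where
  "cells K = {0..<int K} \<times> {0..<int K}"

text \<open>For \<open>a \<noteq> b\<close> the points \<open>c\<close> form a strip around the
  line, of half-width \<open>B\<close> divided by the length of the segment; for
  \<open>a = b\<close> the determinant vanishes.\<close>

definition thin :: "real \<Rightarrow> int \<times> int \<Rightarrow> int \<times> int \<Rightarrow> int \<times> int \<Rightarrow> bool" where
  "thin B a b c \<longleftrightarrow> real_of_int \<bar>det3 a b c\<bar> \<le> B"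

lemma finite_cells [simp]: "finite (cells K)"
  by (simp add: cells_def)

lemma card_cells: "card (cells K) = K\<^sup>2"
  by (simp add: cells_def power2_eq_square)

lemma det3_perm:
  "det3 b a c = - det3 a b c" "det3 a c b = - det3 a b c"
  by (simp_all add: det3_def algebra_simps)

lemma thin_swap1: "thin B b a c \<longleftrightarrow> thin B a b c"
  and thin_swap2: "thin B a c b \<longleftrightarrow> thin B a b c"
  unfolding thin_def det3_perm(1)[of b a c] det3_perm(2)[of a c b] by simp_all

lemma thin_rot: "thin B a b c \<longleftrightarrow> thin B c a b"
  by (metis thin_swap1 thin_swap2)

lemma thin_transpose: "thin B (prod.swap a) (prod.swap b) (prod.swap c) \<longleftrightarrow> thin B a b c"
proof -
  have "det3 (prod.swap a) (prod.swap b) (prod.swap c) = - det3 a b c"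
    by (simp add: det3_def)
  then show ?thesis by (simp add: thin_def)
qed

lemma swap_cells [simp]: "prod.swap p \<in> cells K \<longleftrightarrow> p \<in> cells K"
  by (cases p) (auto simp: cells_def)

lemma card_thin_transpose:
  "card {z \<in> cells K. thin B (prod.swap a) (prod.swap b) z} = card {z \<in> cells K. thin B a b z}"
proof -
  have "{z \<in> cells K. thin B (prod.swap a) (prod.swap b) z} = prod.swap ` {z \<in> cells K. thin B a b z}"
    (is "?L = _ ` ?R")
  proof (intro equalityI subsetI)
    fix z assume "z \<in> ?L"
    then have "prod.swap z \<in> ?R"
      using thin_transpose[of B a b "prod.swap z"] by simp
    then show "z \<in> prod.swap ` ?R" by (metis imageI swap_swap)
  next
    fix z assume "z \<in> prod.swap ` ?R"
    then obtain w where "z = prod.swap w" "w \<in> ?R" by blast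
    then show "z \<in> ?L" by (simp add: thin_transpose del: swap_simp)
  qed
  then show ?thesis by (simp add: card_image)
qed

text \<open>Only columns between \<open>a\<close> and \<open>b\<close> are counted, where the line
  certainly runs inside the square: \<open>d\<close> columns with a number of cells of order
  \<open>B / d\<close> each, so the separation cancels.\<close>

lemma card_strip_ge_aux:
  assumes a: "a \<in> cells K" and b: "b \<in> cells K"
    and d: "0 < fst b - fst a" "\<bar>snd b - snd a\<bar> \<le> fst b - fst a"
    and B: "16 * real K \<le> B" "B \<le> (real K)\<^sup>2"
  shows "B / 8 \<le> card {z \<in> cells K. thin B a b z}"
proof -
  define d e where "d = fst b - fst a" and "e = snd b - snd a"
  have de: "0 < d" "\<bar>e\<bar> \<le> d" using d by (auto simp: d_def e_def)
  have ab: "0 \<le> fst a" "0 \<le> snd a" "fst a < K" "snd a < K" "0 \<le> fst b" "0 \<le> snd b" "fst b < K" "snd b < K"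
    using a b by (auto simp: cells_def)
  have dK: "d < K" using ab by (simp add: d_def)
  have K: "K > 0" using dK de by simp
  have det: "det3 a b z = d * (snd z - snd a) - (fst z - fst a) * e" for z
    by (simp add: det3_def d_def e_def)
  have B0: "B > 0" using B(1) K by (smt (verit) of_nat_0_less_iff)
  show ?thesis
  \<comment> \<open>In the first case the points are so close that the strip covers the whole
    grid.\<close>
  proof (cases "2 * real K * d \<le> B")
    case True
    have "thin B a b z" if "z \<in> cells K" for z
    proof -
      have z: "\<bar>snd z - snd a\<bar> \<le> K" "\<bar>fst z - fst a\<bar> \<le> K"
        using that ab by (auto simp: cells_def)
      have "\<bar>det3 a b z\<bar> \<le> \<bar>d * (snd z - snd a)\<bar> + \<bar>(fst z - fst a) * e\<bar>"
        unfolding det by (rule abs_triangle_ineq4)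
      also have "\<dots> \<le> d * K + K * d"
        unfolding abs_mult using z de by (intro add_mono mult_mono) auto
      finally have "real_of_int \<bar>det3 a b z\<bar> \<le> real_of_int (2 * K * d)"
        unfolding of_int_le_iff by (simp add: mult_ac)
      with True show ?thesis by (simp add: thin_def)
    qed
    then have "{z \<in> cells K. thin B a b z} = cells K" by auto
    then show ?thesis using B B0 by (simp add: card_cells)
  next
    case False
    \<comment> \<open>A quarter of the vertical half-height \<open>B / d\<close> of the strip,
      rounded down. It leaves room for rounding the line, and \<open>2 * m < K\<close> below lets
      \<open>m\<close> cells fit on one side of the line.\<close>
    define m where "m = \<lfloor>B / (4 * d)\<rfloor>"
    have m_le: "real_of_int m \<le> B / (4 * d)" by (simp add: m_def)
    then have dm: "4 * (real_of_int d * m) \<le> B" using de by (simp add: field_simps)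
    have "B / (4 * d) < K / 2" using False de by (simp add: field_simps)
    then have "real_of_int (2 * m) < real K" using m_le by simp
    then have mK: "2 * m < K" by linarith
    have "B / (8 * d) \<ge> 1" using B(1) dK de by (simp add: field_simps)
    moreover have "B / (4 * d) < real_of_int m + 1" unfolding m_def by linarith
    moreover have "B / (4 * d) = 2 * (B / (8 * d))" by simp
    ultimately have m_ge: "B / (8 * d) \<le> m" by linarith
    then have m0: "m \<ge> 1" using \<open>B / (8 * d) \<ge> 1\<close> by linarith
    \<comment> \<open>\<open>y x\<close> is the line rounded down in column \<open>x\<close>. The
      \<open>m\<close> chosen cells start there and run towards the middle of the column, so they
      stay in the grid.\<close>
    define y where "y x = snd a + ((x - fst a) * e) div d" for x
    define z where "z = (\<lambda>(x, i). (x, if 2 * y x < K then y x + i else y x - i))"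
    let ?D = "{fst a..<fst b} \<times> {0..<m}"
    have inj: "inj_on z ?D" by (auto simp: inj_on_def z_def split: if_splits)
    have "z p \<in> {z \<in> cells K. thin B a b z}" if pD: "p \<in> ?D" for p
    proof -
      obtain x i where p: "p = (x, i)" and x: "fst a \<le> x" "x < fst b" and i: "0 \<le> i" "i < m"
        using pD by auto
      define t where "t = x - fst a"
      have t: "0 \<le> t" "t < d" using x by (auto simp: t_def d_def)
      have y: "0 \<le> y x" "y x < K"
      proof -
        have "min 0 e \<le> (t * e) div d \<and> (t * e) div d \<le> max 0 e"
        proof (cases "e \<ge> 0")
          case True
          have "t * e \<le> d * e" using t True by (intro mult_right_mono) auto
          then have "(t * e) div d \<le> (d * e) div d" using de by (intro zdiv_mono1) auto
          moreover have "0 \<le> (t * e) div d" using t True de by (simp add: pos_imp_zdiv_nonneg_iff)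
          ultimately show ?thesis using True de by simp
        next
          case False
          have "d * e \<le> t * e" using t False by (intro mult_right_mono_neg) auto
          then have "(d * e) div d \<le> (t * e) div d" using de by (intro zdiv_mono1) auto
          moreover have "t * e \<le> 0" using t False by (simp add: mult_nonneg_nonpos)
          then have "(t * e) div d \<le> 0" using de by (simp add: div_nonpos_pos_le0)
          ultimately show ?thesis using False de by simp
        qed
        then show "0 \<le> y x" "y x < K" using ab by (auto simp: y_def t_def e_def)
      qed
      define w where "w = (if 2 * y x < K then i else - i)"
      have zp: "z p = (x, y x + w)" by (simp add: z_def p w_def)
      have "z p \<in> cells K" using ab x y i mK by (auto simp: zp cells_def w_def)
      moreover have "thin B a b (z p)"
      proof -
        have "det3 a b (z p) = d * ((t * e) div d) - t * e + d * w"
          by (simp add: det zp y_def t_def algebra_simps)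
        also have "\<dots> = d * w - (t * e) mod d"
          by (simp add: minus_mod_eq_mult_div[symmetric])
        finally have "\<bar>det3 a b (z p)\<bar> \<le> \<bar>d * w\<bar> + \<bar>(t * e) mod d\<bar>" by linarith
        also have "\<dots> \<le> d * i + d"
          using de i by (auto simp: abs_mult w_def intro!: add_mono less_imp_le)
        also have "\<dots> = d * (i + 1)" by (simp add: algebra_simps)
        also have "\<dots> \<le> d * m" using de i by (intro mult_left_mono) auto
        finally have "real_of_int \<bar>det3 a b (z p)\<bar> \<le> real_of_int (d * m)" by (simp only: of_int_le_iff)
        also have "\<dots> \<le> B" using dm B0 by simp
        finally show ?thesis by (simp add: thin_def)
      qed
      ultimately show ?thesis by simp
    qed
    then have "card ?D \<le> card {z \<in> cells K. thin B a b z}"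
      by (intro card_inj_on_le[OF inj]) auto
    moreover have "real (card ?D) = d * m"
      using de m0 by (simp add: d_def)
    moreover have "d * m \<ge> B / 8"
      using m_ge de by (simp add: field_simps)
    ultimately show ?thesis by linarith
  qed
qed

text \<open>Exchanging the endpoints and transposing the coordinates reduce the claim to a line of
  slope at most one in absolute value; coincident points give all cells.\<close>

lemma card_strip_ge:
  assumes a: "a \<in> cells K" and b: "b \<in> cells K"
    and B: "16 * real K \<le> B" "B \<le> (real K)\<^sup>2"
  shows "B / 8 \<le> card {z \<in> cells K. thin B a b z}"
proof -
  have K: "K > 0" using a by (auto simp: cells_def)
  then have B0: "B > 0" using B(1) by (smt (verit) of_nat_0_less_iff)
  have flip: "card {z \<in> cells K. thin B b a z} = card {z \<in> cells K. thin B a b z}" for a b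
    using thin_swap1 by metis
  have aux: "B / 8 \<le> card {z \<in> cells K. thin B a b z}"
    if "a \<in> cells K" "b \<in> cells K" "\<bar>snd b - snd a\<bar> \<le> \<bar>fst b - fst a\<bar>" "a \<noteq> b" for a b
  proof -
    have "fst a \<noteq> fst b" using that by (auto simp: prod_eq_iff)
    then consider "0 < fst b - fst a" | "0 < fst a - fst b" by linarith
    then show ?thesis
      using card_strip_ge_aux[of a K b B] card_strip_ge_aux[of b K a B] that B flip[of a b]
      by cases (auto simp: abs_minus_commute)
  qed
  show ?thesis
  proof (cases "a = b")
    case True
    then have "{z \<in> cells K. thin B a b z} = cells K"
      using B0 by (auto simp: thin_def det3_def)
    then show ?thesis using B B0 by (simp add: card_cells)
  next
    case False
    show ?thesis
    proof (cases "\<bar>snd b - snd a\<bar> \<le> \<bar>fst b - fst a\<bar>")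
      case True
      then show ?thesis using aux a b False by simp
    next
      case F: False
      have "B / 8 \<le> card {z \<in> cells K. thin B (prod.swap a) (prod.swap b) z}"
        by (rule aux) (use a b F False in \<open>auto simp: prod_eq_iff\<close>)
      then show ?thesis by (simp add: card_thin_transpose)
    qed
  qed
qed

section \<open>Upper bounds for strips through a fixed cell, summed over the second point\<close>

lemma card_int_band:
  fixes d c :: int
  assumes "d \<noteq> 0" "B \<ge> 0"
  shows "finite {y::int. real_of_int \<bar>d * y - c\<bar> \<le> B}"
    "card {y::int. real_of_int \<bar>d * y - c\<bar> \<le> B} \<le> 2 * B / \<bar>d\<bar> + 1"
proof -
  define d' c' where "d' = \<bar>d\<bar>" and "c' = sgn d * c"
  have d': "d' > 0" using assms by (simp add: d'_def)
  have "\<bar>d * y - c\<bar> = \<bar>d' * y - c'\<bar>" for y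
    using assms(1) by (cases "d > 0") (auto simp: d'_def c'_def)
  then have "{y::int. real_of_int \<bar>d * y - c\<bar> \<le> B} \<subseteq> {\<lceil>(c' - B) / d'\<rceil>..\<lfloor>(c' + B) / d'\<rfloor>}" (is "?S \<subseteq> ?I")
    using d' by (auto simp: ceiling_le_iff le_floor_iff field_simps abs_le_iff)
  moreover have "real (card ?I) \<le> 2 * B / d' + 1"
  proof -
    have "(c' + B) / d' - (c' - B) / d' = 2 * B / d'" by (simp add: diff_divide_distrib[symmetric])
    moreover have "0 \<le> 2 * B / d'" using d' assms by simp
    ultimately show ?thesis by simp linarith
  qed
  ultimately show "finite ?S" "card ?S \<le> 2 * B / \<bar>d\<bar> + 1"
    using finite_subset[of ?S ?I] card_mono[of ?I ?S] by (auto simp: d'_def)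
qed

text \<open>The maximum norm: up to transposition it is the horizontal separation by which
  \<open>card_strip_le_aux\<close> divides.\<close>

definition sup_dist :: "int \<times> int \<Rightarrow> int \<times> int \<Rightarrow> nat" where
  "sup_dist z p = nat (max \<bar>fst p - fst z\<bar> \<bar>snd p - snd z\<bar>)"

lemma card_strip_le_aux:
  assumes "fst p \<noteq> fst z" "B \<ge> 0"
  shows "card {q \<in> cells K. thin B z p q} \<le> K * (2 * B / real_of_int \<bar>fst p - fst z\<bar> + 1)"
proof -
  define d where "d = fst p - fst z"
  define Y where "Y x = {y::int. real_of_int \<bar>d * y - (d * snd z + (x - fst z) * (snd p - snd z))\<bar> \<le> B}" for x
  have d: "d \<noteq> 0" using assms by (simp add: d_def)
  have "{q \<in> cells K. thin B z p q} \<subseteq> Sigma {0..<int K} Y"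
    by (auto simp: cells_def thin_def det3_def Y_def d_def algebra_simps)
  moreover have fin: "finite (Y x)" for x
    unfolding Y_def by (rule card_int_band(1)[OF d assms(2)])
  then have "finite (Sigma {0..<int K} Y)" by auto
  ultimately have "real (card {q \<in> cells K. thin B z p q}) \<le> card (Sigma {0..<int K} Y)"
    by (simp add: card_mono)
  also have "\<dots> = (\<Sum>x\<in>{0..<int K}. real (card (Y x)))"
    using fin by (subst card_SigmaI) auto
  also have "\<dots> \<le> (\<Sum>x\<in>{0..<int K}. 2 * B / \<bar>d\<bar> + 1)"
    unfolding Y_def by (intro sum_mono card_int_band(2) d assms)
  also have "\<dots> = K * (2 * B / \<bar>d\<bar> + 1)" by simp
  finally show ?thesis by (simp add: d_def)
qed

lemma card_strip_le:
  assumes p: "p \<in> cells K" and z: "z \<in> cells K" and "p \<noteq> z" and B: "real K \<le> B"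
  shows "card {q \<in> cells K. thin B z p q} \<le> 3 * real K * B / sup_dist z p"
proof -
  have B0: "B \<ge> 0" using B by (meson of_nat_0_le_iff order_trans)
  have fin: "K * (2 * B / s + 1) \<le> 3 * real K * B / s" if "0 < s" "s \<le> K" for s :: nat
  proof -
    \<comment> \<open>Since \<open>s \<le> K \<le> B\<close>, the extra cell per column due to
      rounding is absorbed into the main term.\<close>
    have "1 \<le> B / s" using that B by (simp add: field_simps)
    then have "K * (2 * B / s + 1) \<le> K * (2 * B / s + B / s)"
      by (intro mult_left_mono add_left_mono) auto
    also have "\<dots> = 3 * real K * B / s" by (simp add: field_simps)
    finally show ?thesis .
  qed
  have sd: "0 < sup_dist z p" "sup_dist z p \<le> K"
    using p z \<open>p \<noteq> z\<close> by (auto simp: sup_dist_def cells_def prod_eq_iff)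
  show ?thesis
  proof (cases "\<bar>snd p - snd z\<bar> \<le> \<bar>fst p - fst z\<bar>")
    case True
    then have s: "sup_dist z p = nat \<bar>fst p - fst z\<bar>" "fst p \<noteq> fst z"
      using sd by (auto simp: sup_dist_def)
    then have "real (sup_dist z p) = real_of_int \<bar>fst p - fst z\<bar>" by simp
    then show ?thesis using card_strip_le_aux[OF s(2) B0, of K] fin[OF sd] by (simp only:)
  next
    case False
    then have s: "sup_dist z p = nat \<bar>snd p - snd z\<bar>" "fst (prod.swap p) \<noteq> fst (prod.swap z)"
      using sd by (auto simp: sup_dist_def)
    then have "real (sup_dist z p) = real_of_int \<bar>fst (prod.swap p) - fst (prod.swap z)\<bar>" by simp
    then show ?thesis using card_strip_le_aux[OF s(2) B0, of K] fin[OF sd]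
      by (simp only: card_thin_transpose)
  qed
qed

text \<open>The shell is covered by four sides of \<open>2 * s + 1\<close> cells.\<close>

lemma card_sup_dist:
  assumes "0 < s"
  shows "card {p \<in> cells K. sup_dist z p = s} \<le> 12 * s"
proof -
  let ?I = "\<lambda>x. {x - int s, x + int s}" and ?J = "\<lambda>x. {x - int s..x + int s}"
  have "{p \<in> cells K. sup_dist z p = s} \<subseteq> ?I (fst z) \<times> ?J (snd z) \<union> ?J (fst z) \<times> ?I (snd z)"
  proof
    fix p assume "p \<in> {p \<in> cells K. sup_dist z p = s}"
    then have "max \<bar>fst p - fst z\<bar> \<bar>snd p - snd z\<bar> = int s" by (auto simp: sup_dist_def)
    then have "\<bar>fst p - fst z\<bar> \<le> int s \<and> \<bar>snd p - snd z\<bar> \<le> int s \<and>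
        (\<bar>fst p - fst z\<bar> = int s \<or> \<bar>snd p - snd z\<bar> = int s)"
      by linarith
    then have "fst p \<in> ?J (fst z) \<and> snd p \<in> ?J (snd z) \<and> (fst p \<in> ?I (fst z) \<or> snd p \<in> ?I (snd z))"
      by (simp only: insert_iff empty_iff atLeastAtMost_iff) linarith
    then show "p \<in> ?I (fst z) \<times> ?J (snd z) \<union> ?J (fst z) \<times> ?I (snd z)"
      unfolding mem_Times_iff Un_iff by blast
  qed
  then have "card {p \<in> cells K. sup_dist z p = s} \<le> card (?I (fst z) \<times> ?J (snd z) \<union> ?J (fst z) \<times> ?I (snd z))"
    by (intro card_mono) auto
  also have "\<dots> \<le> card (?I (fst z) \<times> ?J (snd z)) + card (?J (fst z) \<times> ?I (snd z))"
    by (rule card_Un_le)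
  also have "\<dots> = 4 * (2 * s + 1)"
    using assms by (simp add: card_cartesian_product nat_add_distrib)
  also have "\<dots> \<le> 12 * s" using assms by simp
  finally show ?thesis .
qed

lemma sum_sup_dist_le:
  assumes h: "\<And>s. h s \<ge> (0::real)" and z: "z \<in> cells K"
  shows "(\<Sum>p\<in>cells K - {z}. h (sup_dist z p)) \<le> (\<Sum>s=1..K. 12 * real s * h s)"
proof -
  let ?g = "sup_dist z"
  have g: "?g ` (cells K - {z}) \<subseteq> {1..K}"
    using z by (auto simp: sup_dist_def cells_def)
  have "(\<Sum>p\<in>cells K - {z}. h (?g p)) = (\<Sum>s=1..K. \<Sum>p | p \<in> cells K - {z} \<and> ?g p = s. h (?g p))"
    by (rule sum.group[symmetric]) (use g in auto)
  also have "\<dots> \<le> (\<Sum>s=1..K. 12 * real s * h s)"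
  proof (rule sum_mono)
    fix s assume s: "s \<in> {1..K}"
    have "(\<Sum>p | p \<in> cells K - {z} \<and> ?g p = s. h (?g p)) = card {p \<in> cells K - {z}. ?g p = s} * h s"
      by simp
    also have "\<dots> \<le> 12 * real s * h s"
    proof (rule mult_right_mono)
      have "card {p \<in> cells K - {z}. ?g p = s} \<le> card {p \<in> cells K. ?g p = s}"
        by (intro card_mono) auto
      also have "\<dots> \<le> 12 * s" using card_sup_dist s by simp
      finally show "real (card {p \<in> cells K - {z}. ?g p = s}) \<le> 12 * real s"
        by linarith
    qed (rule h)
    finally show "(\<Sum>p | p \<in> cells K - {z} \<and> ?g p = s. h (?g p)) \<le> 12 * real s * h s" .
  qed
  finally show ?thesis .
qed

lemma sum_inverse_sqrt_le: "(\<Sum>s=1..K. 1 / sqrt (real s)) \<le> 2 * sqrt (real K)"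
proof (induction K)
  case (Suc K)
  define a b where "a = sqrt (real K)" and "b = sqrt (real (Suc K))"
  have ab: "0 \<le> a" "0 < b" "b * b = a * a + 1" by (auto simp: a_def b_def)
  have "2 * (a * b) \<le> a * a + b * b" using sum_squares_bound[of a b] by (simp add: power2_eq_square)
  then have "2 * a + 1 / b \<le> 2 * b" using ab by (simp add: field_simps)
  then show ?case using Suc by (simp add: a_def b_def)
qed simp

definition strip_count :: "nat \<Rightarrow> real \<Rightarrow> int \<times> int \<Rightarrow> int \<times> int \<Rightarrow> real" where
  "strip_count K B z p = real (card {q \<in> cells K. thin B z p q})"

lemma strip_count_le: "strip_count K B z p \<le> (real K)\<^sup>2"
proof -
  have "card {q \<in> cells K. thin B z p q} \<le> card (cells K)" by (intro card_mono) auto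
  then show ?thesis by (simp add: strip_count_def card_cells flip: of_nat_power)
qed

text \<open>A shell at distance \<open>s\<close> has at most \<open>12 * s\<close> cells, each with
  a strip of at most \<open>3 * K * B / s\<close> cells, so each of the \<open>K\<close> shells
  contributes at most \<open>36 * K * B\<close>; the degenerate pair \<open>p = z\<close> adds at
  most \<open>K^2 * B\<close>.\<close>

lemma sum_strip_count:
  assumes z: "z \<in> cells K" and B: "real K \<le> B"
  shows "(\<Sum>p\<in>cells K. strip_count K B z p) \<le> 37 * (real K)\<^sup>2 * B"
proof -
  have K: "1 \<le> real K" using z by (auto simp: cells_def)
  then have B1: "1 \<le> B" using B by linarith
  have "(\<Sum>p\<in>cells K. strip_count K B z p) = strip_count K B z z + (\<Sum>p\<in>cells K - {z}. strip_count K B z p)"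
    using z by (intro sum.remove) auto
  also have "strip_count K B z z \<le> (real K)\<^sup>2 * B"
    using strip_count_le[of K B z z] mult_left_mono[OF B1, of "(real K)\<^sup>2"] by simp
  also have "(\<Sum>p\<in>cells K - {z}. strip_count K B z p) \<le> (\<Sum>p\<in>cells K - {z}. 3 * real K * B / sup_dist z p)"
    unfolding strip_count_def by (intro sum_mono card_strip_le[OF _ z _ B]) blast+
  also have "\<dots> \<le> (\<Sum>s=1..K. 12 * real s * (3 * real K * B / s))"
    by (rule sum_sup_dist_le) (use z B1 in auto)
  also have "\<dots> = (\<Sum>s=1..K. 36 * real K * B)" by (intro sum.cong) auto
  also have "\<dots> = 36 * (real K)\<^sup>2 * B" by (simp add: power2_eq_square)
  finally show ?thesis by (simp add: mult_ac)
qed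

text \<open>The logarithmically divergent sum of \<open>1/s\<close> is avoided by bounding the square of a count by
  \<open>K\<close> times its power \<open>3/2\<close>.\<close>

lemma sum_strip_count_square:
  assumes z: "z \<in> cells K" and B: "real K \<le> B"
  shows "(\<Sum>p\<in>cells K. (strip_count K B z p)\<^sup>2) \<le> 145 * real K ^ 3 * B * sqrt B"
proof -
  have K: "1 \<le> real K" using z by (auto simp: cells_def)
  then have B1: "1 \<le> B" using B by linarith
  have sB: "1 \<le> sqrt B" using B1 by simp
  define h where "h s = real K * (3 * real K * B / real s) * sqrt (3 * real K * B / real s)" for s :: nat
  have h0: "h s \<ge> 0" for s using B1 by (simp add: h_def)
  have "(\<Sum>p\<in>cells K. (strip_count K B z p)\<^sup>2)
      = (strip_count K B z z)\<^sup>2 + (\<Sum>p\<in>cells K - {z}. (strip_count K B z p)\<^sup>2)"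
    using z by (intro sum.remove) auto
  also have "(strip_count K B z z)\<^sup>2 \<le> real K ^ 3 * B * sqrt B"
  proof -
    have "(strip_count K B z z)\<^sup>2 \<le> ((real K)\<^sup>2)\<^sup>2"
      using strip_count_le by (intro power_mono) (auto simp: strip_count_def)
    also have "\<dots> = real K ^ 3 * real K * 1" by (simp add: power_numeral_reduce)
    also have "\<dots> \<le> real K ^ 3 * B * sqrt B"
      using B sB K B1 by (intro mult_mono) auto
    finally show ?thesis .
  qed
  also have "(\<Sum>p\<in>cells K - {z}. (strip_count K B z p)\<^sup>2) \<le> (\<Sum>p\<in>cells K - {z}. h (sup_dist z p))"
  proof (rule sum_mono)
    fix p assume p: "p \<in> cells K - {z}"
    define x y where "x = strip_count K B z p" and "y = 3 * real K * B / sup_dist z p"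
    have xy: "0 \<le> x" "x \<le> y" "x \<le> (real K)\<^sup>2"
      using card_strip_le[of p K z B] strip_count_le p z B by (auto simp: x_def y_def strip_count_def)
    have "x\<^sup>2 = x * (sqrt x * sqrt x)" using xy by (simp add: power2_eq_square)
    also have "\<dots> \<le> y * (sqrt y * real K)"
    proof (intro mult_mono)
      show "sqrt x \<le> real K" using xy(3) by (simp add: real_le_lsqrt xy)
    qed (use xy in auto)
    finally show "(strip_count K B z p)\<^sup>2 \<le> h (sup_dist z p)"
      by (simp add: x_def y_def h_def mult_ac)
  qed
  also have "\<dots> \<le> (\<Sum>s=1..K. 12 * real s * h s)"
    by (rule sum_sup_dist_le) (use z h0 in auto)
  also have "\<dots> \<le> (\<Sum>s=1..K. 72 * (real K)\<^sup>2 * B * sqrt K * sqrt B * (1 / sqrt s))"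
  proof (rule sum_mono)
    fix s assume s: "s \<in> {1..K}"
    have "12 * real s * h s = 36 * (real K)\<^sup>2 * B * sqrt K * sqrt B * (1 / sqrt s) * sqrt 3"
      using s by (simp add: h_def real_sqrt_mult real_sqrt_divide power2_eq_square field_simps)
    also have "\<dots> \<le> 36 * (real K)\<^sup>2 * B * sqrt K * sqrt B * (1 / sqrt s) * 2"
      by (rule mult_left_mono) (use B1 in \<open>auto intro!: real_le_lsqrt\<close>)
    finally show "12 * real s * h s \<le> 72 * (real K)\<^sup>2 * B * sqrt K * sqrt B * (1 / sqrt s)" by simp
  qed
  also have "\<dots> = 72 * (real K)\<^sup>2 * B * sqrt K * sqrt B * (\<Sum>s=1..K. 1 / sqrt s)"
    by (rule sum_distrib_left[symmetric])
  also have "\<dots> \<le> 72 * (real K)\<^sup>2 * B * sqrt K * sqrt B * (2 * sqrt K)"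
    by (intro mult_left_mono sum_inverse_sqrt_le) (use B1 in auto)
  also have "\<dots> = 144 * real K ^ 3 * B * sqrt B"
    by (simp add: power_numeral_reduce)
  finally show ?thesis by (simp add: mult_ac)
qed

section \<open>Overlap of random strips\<close>


lemma sum_PiE_split:
  assumes "finite I" "i \<in> I"
  shows "(\<Sum>P\<in>I \<rightarrow>\<^sub>E A. F P) = (\<Sum>P\<in>(I - {i}) \<rightarrow>\<^sub>E A. \<Sum>a\<in>A. F (P(i := a)))"
proof -
  have "I \<rightarrow>\<^sub>E A = (\<lambda>(a, P). P(i := a)) ` (A \<times> ((I - {i}) \<rightarrow>\<^sub>E A))"
    using PiE_insert_eq[of i "I - {i}" "\<lambda>_. A"] assms(2) by (simp add: insert_absorb)
  moreover have "inj_on (\<lambda>(a, P). P(i := a)) (A \<times> ((I - {i}) \<rightarrow>\<^sub>E A))"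
    using inj_combinator[of i "I - {i}" "\<lambda>_. A"] by simp
  ultimately have "(\<Sum>P\<in>I \<rightarrow>\<^sub>E A. F P) = (\<Sum>(a, P)\<in>A \<times> ((I - {i}) \<rightarrow>\<^sub>E A). F (P(i := a)))"
    by (simp add: sum.reindex case_prod_unfold)
  also have "\<dots> = (\<Sum>a\<in>A. \<Sum>P\<in>(I - {i}) \<rightarrow>\<^sub>E A. F (P(i := a)))"
    by (rule sum.cartesian_product[symmetric])
  also have "\<dots> = (\<Sum>P\<in>(I - {i}) \<rightarrow>\<^sub>E A. \<Sum>a\<in>A. F (P(i := a)))"
    by (rule sum.swap)
  finally show ?thesis .
qed

lemma sum_PiE_3:
  fixes F :: "'a \<Rightarrow> 'a \<Rightarrow> 'a \<Rightarrow> real"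
  assumes "finite I" "{i, j, k} \<subseteq> I" "distinct [i, j, k]"
  shows "(\<Sum>P\<in>I \<rightarrow>\<^sub>E A. F (P i) (P j) (P k)) =
    real (card A) ^ (card I - 3) * (\<Sum>a\<in>A. \<Sum>b\<in>A. \<Sum>c\<in>A. F a b c)"
proof -
  have c: "card (I - {k} - {j} - {i}) = card I - 3"
    using assms by (simp add: card_Diff_singleton)
  have "(\<Sum>P\<in>I \<rightarrow>\<^sub>E A. F (P i) (P j) (P k)) =
     (\<Sum>P\<in>(I - {k} - {j} - {i}) \<rightarrow>\<^sub>E A. \<Sum>a\<in>A. \<Sum>b\<in>A. \<Sum>c\<in>A. F a b c)"
    using assms by (simp add: sum_PiE_split[of I k] sum_PiE_split[of "I - {k}" j] sum_PiE_split[of "I - {k} - {j}" i])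
  also have "\<dots> = real (card A) ^ (card I - 3) * (\<Sum>a\<in>A. \<Sum>b\<in>A. \<Sum>c\<in>A. F a b c)"
    using assms(1) by (simp add: card_PiE c)
  finally show ?thesis .
qed

lemma sum_PiE_4:
  fixes F :: "'a \<Rightarrow> 'a \<Rightarrow> 'a \<Rightarrow> 'a \<Rightarrow> real"
  assumes "finite I" "{i, j, k, l} \<subseteq> I" "distinct [i, j, k, l]"
  shows "(\<Sum>P\<in>I \<rightarrow>\<^sub>E A. F (P i) (P j) (P k) (P l)) =
    real (card A) ^ (card I - 4) * (\<Sum>a\<in>A. \<Sum>b\<in>A. \<Sum>c\<in>A. \<Sum>d\<in>A. F a b c d)"
proof -
  have c: "card (I - {l} - {k} - {j} - {i}) = card I - 4"
    using assms by (simp add: card_Diff_singleton)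
  have "(\<Sum>P\<in>I \<rightarrow>\<^sub>E A. F (P i) (P j) (P k) (P l)) =
     (\<Sum>P\<in>(I - {l} - {k} - {j} - {i}) \<rightarrow>\<^sub>E A. \<Sum>a\<in>A. \<Sum>b\<in>A. \<Sum>c\<in>A. \<Sum>d\<in>A. F a b c d)"
    using assms by (simp add: sum_PiE_split[of I l] sum_PiE_split[of "I - {l}" k]
        sum_PiE_split[of "I - {l} - {k}" j] sum_PiE_split[of "I - {l} - {k} - {j}" i])
  also have "\<dots> = real (card A) ^ (card I - 4) * (\<Sum>a\<in>A. \<Sum>b\<in>A. \<Sum>c\<in>A. \<Sum>d\<in>A. F a b c d)"
    using assms(1) by (simp add: card_PiE c)
  finally show ?thesis .
qed

definition forbidden :: "nat \<Rightarrow> real \<Rightarrow> nat set \<Rightarrow> nat set \<Rightarrow> (nat \<Rightarrow> int \<times> int) \<Rightarrow> (int \<times> int) set" where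
  "forbidden K B I J P = {z \<in> cells K. \<exists>i\<in>I. \<exists>j\<in>J. thin B (P i) (P j) z}"

text \<open>Pairs of lines are ordered, so each unordered pair counts twice; the halving in
  \<open>card_forbidden_ge\<close> compensates.\<close>

definition overlap :: "nat \<Rightarrow> real \<Rightarrow> nat set \<Rightarrow> nat set \<Rightarrow> (nat \<Rightarrow> int \<times> int) \<Rightarrow> real" where
  "overlap K B I J P = (\<Sum>z\<in>cells K. \<Sum>e\<in>I \<times> J. \<Sum>e'\<in>I \<times> J - {e}.
     of_bool (thin B (P (fst e)) (P (snd e)) z) * of_bool (thin B (P (fst e')) (P (snd e')) z))"

text \<open>A cell lying in N strips contributes N - N(N - 1)/2 on the left. This is zero for N = 0
  and otherwise at most one, because (N - 1)(N - 2) is nonnegative for integers.\<close>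

lemma card_forbidden_ge:
  assumes "finite I" "finite J"
  shows "(\<Sum>e\<in>I \<times> J. real (card {z \<in> cells K. thin B (P (fst e)) (P (snd e)) z}))
    - overlap K B I J P / 2 \<le> card (forbidden K B I J P)"
proof -
  define t :: "nat \<times> nat \<Rightarrow> int \<times> int \<Rightarrow> real"
    where "t e z = of_bool (thin B (P (fst e)) (P (snd e)) z)" for e z
  have fin: "finite (I \<times> J)" using assms by simp
  have pt: "(\<Sum>e\<in>I \<times> J. t e z) - (\<Sum>e\<in>I \<times> J. \<Sum>e'\<in>I \<times> J - {e}. t e z * t e' z) / 2
      \<le> of_bool (z \<in> forbidden K B I J P)" if z: "z \<in> cells K" for z
  proof -
    define N where "N = card {e \<in> I \<times> J. thin B (P (fst e)) (P (snd e)) z}"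
    have T: "(\<Sum>e\<in>I \<times> J. t e z) = real N"
      unfolding t_def N_def using fin by (simp add: Int_def)
    have "(\<Sum>e'\<in>I \<times> J - {e}. t e z * t e' z) = t e z * real N - t e z" if "e \<in> I \<times> J" for e
    proof -
      have "(\<Sum>e'\<in>I \<times> J. t e z * t e' z) = t e z * t e z + (\<Sum>e'\<in>I \<times> J - {e}. t e z * t e' z)"
        using fin that by (rule sum.remove)
      moreover have "(\<Sum>e'\<in>I \<times> J. t e z * t e' z) = t e z * real N"
        unfolding T[symmetric] by (rule sum_distrib_left[symmetric])
      moreover have "t e z * t e z = t e z" by (simp add: t_def)
      ultimately show ?thesis by simp
    qed
    then have W: "(\<Sum>e\<in>I \<times> J. \<Sum>e'\<in>I \<times> J - {e}. t e z * t e' z) = real N * real N - real N"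
      by (simp add: sum_subtractf T flip: sum_distrib_right)
    show ?thesis
    proof (cases "N = 0")
      case True
      then show ?thesis by (simp add: T W)
    next
      case False
      then have "{e \<in> I \<times> J. thin B (P (fst e)) (P (snd e)) z} \<noteq> {}"
        unfolding N_def by (metis card.empty)
      then have "z \<in> forbidden K B I J P" using z by (auto simp: forbidden_def)
      moreover have "0 \<le> (real N - 1) * (real N - 2)"
        using False by (cases "N = 1") auto
      ultimately show ?thesis by (simp add: T W field_simps)
    qed
  qed
  have "(\<Sum>e\<in>I \<times> J. real (card {z \<in> cells K. thin B (P (fst e)) (P (snd e)) z}))
      = (\<Sum>e\<in>I \<times> J. \<Sum>z\<in>cells K. t e z)"
    unfolding t_def by (simp add: Int_def)
  also have "\<dots> = (\<Sum>z\<in>cells K. \<Sum>e\<in>I \<times> J. t e z)" by (rule sum.swap)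
  finally have "(\<Sum>e\<in>I \<times> J. real (card {z \<in> cells K. thin B (P (fst e)) (P (snd e)) z}))
    - overlap K B I J P / 2 = (\<Sum>z\<in>cells K. (\<Sum>e\<in>I \<times> J. t e z)
       - (\<Sum>e\<in>I \<times> J. \<Sum>e'\<in>I \<times> J - {e}. t e z * t e' z) / 2)"
    by (simp add: overlap_def t_def sum_subtractf sum_divide_distrib)
  also have "\<dots> \<le> (\<Sum>z\<in>cells K. of_bool (z \<in> forbidden K B I J P))"
    by (rule sum_mono) (rule pt)
  also have "\<dots> = card (forbidden K B I J P)"
  proof -
    have "cells K \<inter> {z. z \<in> forbidden K B I J P} = forbidden K B I J P"
      by (auto simp: forbidden_def)
    then show ?thesis by simp
  qed
  finally show ?thesis .
qed

lemma sum_thin: "(\<Sum>q\<in>cells K. of_bool (thin B z p q)) = strip_count K B z p"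
  by (simp add: strip_count_def Int_def)

text \<open>With four separate endpoints the sum factors; rotating the triple to put
  \<open>z\<close> first turns each factor into a sum of strip counts at \<open>z\<close>.\<close>

lemma sum_thin_disjoint:
  assumes B: "real K \<le> B" and z: "z \<in> cells K"
  shows "(\<Sum>a\<in>cells K. \<Sum>b\<in>cells K. \<Sum>c\<in>cells K. \<Sum>d\<in>cells K.
      of_bool (thin B a b z) * of_bool (thin B c d z)) \<le> (37 * (real K)\<^sup>2 * B)\<^sup>2"
proof -
  let ?S = "\<Sum>a\<in>cells K. \<Sum>b\<in>cells K. of_bool (thin B a b z) :: real"
  have S: "?S = (\<Sum>a\<in>cells K. strip_count K B z a)"
    unfolding sum_thin[symmetric] by (simp only: thin_rot[of B _ _ z])
  have "(\<Sum>a\<in>cells K. \<Sum>b\<in>cells K. \<Sum>c\<in>cells K. \<Sum>d\<in>cells K.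
      of_bool (thin B a b z) * of_bool (thin B c d z)) =
      (\<Sum>a\<in>cells K. \<Sum>b\<in>cells K. of_bool (thin B a b z) * ?S)"
    by (simp only: sum_distrib_left)
  also have "\<dots> = ?S * ?S"
    by (simp only: sum_distrib_right)
  also have "\<dots> \<le> (37 * (real K)\<^sup>2 * B) * (37 * (real K)\<^sup>2 * B)"
    unfolding S using sum_strip_count[OF z B] B
    by (intro mult_mono) (auto intro!: sum_nonneg simp: strip_count_def)
  finally show ?thesis by (simp add: power2_eq_square)
qed

text \<open>With a common endpoint \<open>a\<close>, both other endpoints must lie in the same strip
  through \<open>z\<close> and \<open>a\<close>, which gives the square of one strip count.\<close>

lemma sum_thin_shared:
  assumes B: "real K \<le> B" and z: "z \<in> cells K"
  shows "(\<Sum>a\<in>cells K. \<Sum>b\<in>cells K. \<Sum>c\<in>cells K.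
      of_bool (thin B a b z) * of_bool (thin B a c z)) \<le> 145 * real K ^ 3 * B * sqrt B"
proof -
  have "(\<Sum>b\<in>cells K. \<Sum>c\<in>cells K. of_bool (thin B a b z) * of_bool (thin B a c z))
      = (strip_count K B z a)\<^sup>2" for a
    unfolding sum_thin[symmetric] power2_eq_square thin_rot[of B _ _ z]
    by (simp only: sum_distrib_left sum_distrib_right mult.commute)
  then show ?thesis using sum_strip_count_square[OF z B] by simp
qed

lemma sum_overlap:
  assumes I: "finite I" "finite J" "I \<inter> J = {}" "card I = m" "card J = m" "m > 0"
    and B: "real K \<le> B" and K: "K > 0"
  shows "(\<Sum>P\<in>(I \<union> J) \<rightarrow>\<^sub>E cells K. overlap K B I J P) \<le>
    (real K)\<^sup>2 ^ (2 * m) * (1369 * real m ^ 4 * B\<^sup>2 / (real K)\<^sup>2 + 290 * real m ^ 3 * B * sqrt B / K)"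
proof -
  define X where "X = (I \<union> J) \<rightarrow>\<^sub>E cells K"
  define t :: "nat \<times> nat \<Rightarrow> (nat \<Rightarrow> int \<times> int) \<Rightarrow> int \<times> int \<Rightarrow> real"
    where "t e P z = of_bool (thin B (P (fst e)) (P (snd e)) z)" for e P z
  define Q where "Q = (real K)\<^sup>2 ^ (2 * m)"
  \<comment> \<open>Bounds for one pair of lines, without and with a common endpoint: the number of
    cells \<open>z\<close>, times the choices of the coordinates not involved, times the sum over
    the endpoints.\<close>
  define c1 c2 where "c1 = Q * (1369 * B\<^sup>2 / (real K)\<^sup>2)" and "c2 = Q * (145 * B * sqrt B / K)"
  have fin: "finite (I \<union> J)" using I by simp
  have cIJ: "card (I \<union> J) = 2 * m" using I by (simp add: card_Un_disjoint)
  have B0: "0 \<le> B" using B by (meson of_nat_0_le_iff order_trans)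
  have c0: "0 \<le> c1" "0 \<le> c2" using B0 by (auto simp: c1_def c2_def Q_def)
  have cc: "real (card (cells K)) = (real K)\<^sup>2" by (simp add: card_cells)
  have Qr: "(real K)\<^sup>2 ^ (2 * m - r) * (real K)\<^sup>2 ^ r = Q" if "r \<le> 2 * m" for r
    using that by (simp add: Q_def flip: power_add)
  have main: "(\<Sum>z\<in>cells K. \<Sum>P\<in>X. t e P z * t e' P z)
      \<le> c1 + of_bool (fst e = fst e') * c2 + of_bool (snd e = snd e') * c2"
    if e: "e \<in> I \<times> J" and e': "e' \<in> I \<times> J - {e}" for e e'
  proof -
    obtain i j where ij: "e = (i, j)" "i \<in> I" "j \<in> J" using e by auto
    obtain k l where kl: "e' = (k, l)" "k \<in> I" "l \<in> J" using e' by auto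
    have ne: "i \<noteq> k \<or> j \<noteq> l" using e' ij kl by auto
    have dis: "i \<noteq> j" "i \<noteq> l" "k \<noteq> j" "k \<noteq> l" using ij kl I(3) by auto
    consider "i \<noteq> k" "j \<noteq> l" | "i = k" "j \<noteq> l" | "i \<noteq> k" "j = l" using ne by blast
    then show ?thesis
    proof cases
      case 1
      \<comment> \<open>Four distinct indices exist, so the exponent \<open>2 * m - 4\<close> is not
        truncated.\<close>
      have "4 \<le> 2 * m"
      proof -
        have "card {i, j, k, l} \<le> card (I \<union> J)" using fin ij kl by (intro card_mono) auto
        then show ?thesis using 1 dis cIJ by simp
      qed
      then have Q4: "(real K)\<^sup>2 ^ (2 * m - 4) * (real K)\<^sup>2 ^ 4 = Q" by (rule Qr)
      have "(\<Sum>P\<in>X. t e P z * t e' P z) \<le> (real K)\<^sup>2 ^ (2 * m - 4) * (37 * (real K)\<^sup>2 * B)\<^sup>2"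
        if z: "z \<in> cells K" for z
      proof -
        have "(\<Sum>P\<in>X. t e P z * t e' P z) = (real K)\<^sup>2 ^ (2 * m - 4) *
           (\<Sum>a\<in>cells K. \<Sum>b\<in>cells K. \<Sum>c\<in>cells K. \<Sum>d\<in>cells K. of_bool (thin B a b z) * of_bool (thin B c d z))"
          using sum_PiE_4[OF fin, of i j k l "\<lambda>a b c d. of_bool (thin B a b z) * of_bool (thin B c d z)" "cells K"]
            ij kl dis 1 by (simp add: X_def t_def cIJ cc)
        also have "\<dots> \<le> (real K)\<^sup>2 ^ (2 * m - 4) * (37 * (real K)\<^sup>2 * B)\<^sup>2"
          by (intro mult_left_mono sum_thin_disjoint B z) auto
        finally show ?thesis .
      qed
      then have "(\<Sum>z\<in>cells K. \<Sum>P\<in>X. t e P z * t e' P z)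
          \<le> (\<Sum>z\<in>cells K. (real K)\<^sup>2 ^ (2 * m - 4) * (37 * (real K)\<^sup>2 * B)\<^sup>2)" by (rule sum_mono)
      also have "\<dots> = (real K)\<^sup>2 * ((real K)\<^sup>2 ^ (2 * m - 4) * (37 * (real K)\<^sup>2 * B)\<^sup>2)" by (simp add: cc)
      also have "\<dots> = c1"
        unfolding c1_def Q4[symmetric] using K by (simp add: field_simps power2_eq_square power_numeral_reduce)
      finally show ?thesis using ij kl 1 by simp
    next
      case 2
      have "3 \<le> 2 * m"
      proof -
        have "card {i, j, l} \<le> card (I \<union> J)" using fin ij kl by (intro card_mono) auto
        then show ?thesis using 2 dis cIJ by simp
      qed
      then have Q3: "(real K)\<^sup>2 ^ (2 * m - 3) * (real K)\<^sup>2 ^ 3 = Q" by (rule Qr)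
      have "(\<Sum>P\<in>X. t e P z * t e' P z) \<le> (real K)\<^sup>2 ^ (2 * m - 3) * (145 * real K ^ 3 * B * sqrt B)"
        if z: "z \<in> cells K" for z
      proof -
        have "(\<Sum>P\<in>X. t e P z * t e' P z) = (real K)\<^sup>2 ^ (2 * m - 3) *
           (\<Sum>a\<in>cells K. \<Sum>b\<in>cells K. \<Sum>c\<in>cells K. of_bool (thin B a b z) * of_bool (thin B a c z))"
          using sum_PiE_3[OF fin, of i j l "\<lambda>a b c. of_bool (thin B a b z) * of_bool (thin B a c z)" "cells K"]
            ij kl dis 2 by (simp add: X_def t_def cIJ cc)
        also have "\<dots> \<le> (real K)\<^sup>2 ^ (2 * m - 3) * (145 * real K ^ 3 * B * sqrt B)"
          by (intro mult_left_mono sum_thin_shared B z) auto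
        finally show ?thesis .
      qed
      then have "(\<Sum>z\<in>cells K. \<Sum>P\<in>X. t e P z * t e' P z)
          \<le> (\<Sum>z\<in>cells K. (real K)\<^sup>2 ^ (2 * m - 3) * (145 * real K ^ 3 * B * sqrt B))" by (rule sum_mono)
      also have "\<dots> = (real K)\<^sup>2 * ((real K)\<^sup>2 ^ (2 * m - 3) * (145 * real K ^ 3 * B * sqrt B))" by (simp add: cc)
      also have "\<dots> = c2"
        unfolding c2_def Q3[symmetric] using K by (simp add: field_simps power2_eq_square power_numeral_reduce)
      finally show ?thesis using ij kl 2 c0 by simp
    next
      case 3
      have "3 \<le> 2 * m"
      proof -
        have "card {i, j, k} \<le> card (I \<union> J)" using fin ij kl by (intro card_mono) auto
        then show ?thesis using 3 dis cIJ by simp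
      qed
      then have Q3: "(real K)\<^sup>2 ^ (2 * m - 3) * (real K)\<^sup>2 ^ 3 = Q" by (rule Qr)
      have "(\<Sum>P\<in>X. t e P z * t e' P z) \<le> (real K)\<^sup>2 ^ (2 * m - 3) * (145 * real K ^ 3 * B * sqrt B)"
        if z: "z \<in> cells K" for z
      proof -
        have "(\<Sum>P\<in>X. t e P z * t e' P z) = (real K)\<^sup>2 ^ (2 * m - 3) *
           (\<Sum>a\<in>cells K. \<Sum>b\<in>cells K. \<Sum>c\<in>cells K. of_bool (thin B b a z) * of_bool (thin B c a z))"
          using sum_PiE_3[OF fin, of j i k "\<lambda>a b c. of_bool (thin B b a z) * of_bool (thin B c a z)" "cells K"]
            ij kl dis 3 by (auto simp: X_def t_def cIJ cc)
        also have "\<dots> \<le> (real K)\<^sup>2 ^ (2 * m - 3) * (145 * real K ^ 3 * B * sqrt B)"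
          using sum_thin_shared[OF B z] by (intro mult_left_mono) (simp_all add: thin_swap1)
        finally show ?thesis .
      qed
      then have "(\<Sum>z\<in>cells K. \<Sum>P\<in>X. t e P z * t e' P z)
          \<le> (\<Sum>z\<in>cells K. (real K)\<^sup>2 ^ (2 * m - 3) * (145 * real K ^ 3 * B * sqrt B))" by (rule sum_mono)
      also have "\<dots> = (real K)\<^sup>2 * ((real K)\<^sup>2 ^ (2 * m - 3) * (145 * real K ^ 3 * B * sqrt B))" by (simp add: cc)
      also have "\<dots> = c2"
        unfolding c2_def Q3[symmetric] using K by (simp add: field_simps power2_eq_square power_numeral_reduce)
      finally show ?thesis using ij kl 3 c0 by simp
    qed
  qed
  have "(\<Sum>P\<in>X. overlap K B I J P)
      = (\<Sum>P\<in>X. \<Sum>z\<in>cells K. \<Sum>e\<in>I \<times> J. \<Sum>e'\<in>I \<times> J - {e}. t e P z * t e' P z)"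
    by (simp only: overlap_def t_def)
  also have "\<dots> = (\<Sum>z\<in>cells K. \<Sum>P\<in>X. \<Sum>e\<in>I \<times> J. \<Sum>e'\<in>I \<times> J - {e}. t e P z * t e' P z)"
    by (rule sum.swap)
  also have "\<dots> = (\<Sum>z\<in>cells K. \<Sum>e\<in>I \<times> J. \<Sum>e'\<in>I \<times> J - {e}. \<Sum>P\<in>X. t e P z * t e' P z)"
    by (intro sum.cong refl) (simp only: sum.swap[of _ _ X])
  also have "\<dots> = (\<Sum>e\<in>I \<times> J. \<Sum>z\<in>cells K. \<Sum>e'\<in>I \<times> J - {e}. \<Sum>P\<in>X. t e P z * t e' P z)"
    by (rule sum.swap)
  also have "\<dots> = (\<Sum>e\<in>I \<times> J. \<Sum>e'\<in>I \<times> J - {e}. \<Sum>z\<in>cells K. \<Sum>P\<in>X. t e P z * t e' P z)"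
    by (intro sum.cong refl sum.swap)
  also have "\<dots> \<le> (\<Sum>e\<in>I \<times> J. \<Sum>e'\<in>I \<times> J - {e}.
      c1 + of_bool (fst e = fst e') * c2 + of_bool (snd e = snd e') * c2)"
    by (intro sum_mono main)
  also have "\<dots> \<le> (\<Sum>e\<in>I \<times> J. \<Sum>e'\<in>I \<times> J.
      c1 + of_bool (fst e = fst e') * c2 + of_bool (snd e = snd e') * c2)"
    using I c0 by (intro sum_mono sum_mono2) auto
  also have "\<dots> = (\<Sum>e\<in>I \<times> J. real m * real m * c1 + real m * c2 + real m * c2)"
  proof (rule sum.cong[OF refl])
    fix e assume e: "e \<in> I \<times> J"
    then have "I \<inter> {fst e} = {fst e}" "J \<inter> {snd e} = {snd e}" by auto
    then have "(\<Sum>k\<in>I. \<Sum>l\<in>J. c1 + of_bool (fst e = k) * c2 + of_bool (snd e = l) * c2)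
        = real m * real m * c1 + real m * c2 + real m * c2"
      using I by (simp add: sum.distrib algebra_simps flip: sum_distrib_left)
    then show "(\<Sum>e'\<in>I \<times> J. c1 + of_bool (fst e = fst e') * c2 + of_bool (snd e = snd e') * c2)
        = real m * real m * c1 + real m * c2 + real m * c2"
      by (simp add: sum.cartesian_product case_prod_unfold)
  qed
  also have "\<dots> = real m ^ 4 * c1 + 2 * real m ^ 3 * c2"
    using I by (simp add: algebra_simps power_numeral_reduce)
  also have "\<dots> = Q * (1369 * real m ^ 4 * B\<^sup>2 / (real K)\<^sup>2 + 290 * real m ^ 3 * B * sqrt B / K)"
    by (simp add: c1_def c2_def algebra_simps)
  finally show ?thesis by (simp add: X_def Q_def)
qed

section \<open>Counting spread tuples\<close>


text \<open>The threshold is half of \<open>m^2 * B / 8\<close>, which by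
  \<open>card_strip_ge\<close> bounds the total size of the \<open>m^2\<close> strips from
  below.\<close>

definition bad_group :: "nat \<Rightarrow> real \<Rightarrow> nat set \<Rightarrow> nat set \<Rightarrow> nat \<Rightarrow> (nat \<Rightarrow> int \<times> int) set" where
  "bad_group K B I J m =
     {P \<in> (I \<union> J) \<rightarrow>\<^sub>E cells K. real (card (forbidden K B I J P)) < (real m)\<^sup>2 * B / 16}"

text \<open>A bad choice loses more than half of \<open>m^2 * B / 8\<close> to overlap, so its
  \<open>overlap\<close> is at least that number. Dividing the sum of all overlaps by it is Markov's
  inequality.\<close>

lemma card_bad_group:
  assumes I: "finite I" "finite J" "I \<inter> J = {}" "card I = m" "card J = m" "m > 0"
    and B: "16 * real K \<le> B" "B \<le> (real K)\<^sup>2" and K: "K > 0"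
    and \<beta>: "\<beta> = B / (real K)\<^sup>2"
  shows "card (bad_group K B I J m) \<le>
    (real K)\<^sup>2 ^ (2 * m) * (8 * (1369 * (real m)\<^sup>2 * \<beta> + 290 * real m * sqrt \<beta>))"
proof -
  let ?X = "(I \<union> J) \<rightarrow>\<^sub>E cells K" and ?bad = "bad_group K B I J m"
  let ?t = "(real m)\<^sup>2 * B / 8"
  have B0: "B > 0" using B(1) K by (smt (verit) of_nat_0_less_iff)
  have BK: "real K \<le> B" using B(1) by (smt (verit) of_nat_0_le_iff)
  have t0: "?t > 0" using I B0 by simp
  have finX: "finite ?X" using I by (intro finite_PiE) auto
  have sub: "?bad \<subseteq> ?X" by (auto simp: bad_group_def)
  have ov: "?t \<le> overlap K B I J P" if P: "P \<in> ?bad" for P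
  proof -
    have PX: "P i \<in> cells K" if "i \<in> I \<union> J" for i
      using P that by (auto simp: bad_group_def)
    have "(\<Sum>e\<in>I \<times> J. B / 8) \<le> (\<Sum>e\<in>I \<times> J. real (card {z \<in> cells K. thin B (P (fst e)) (P (snd e)) z}))"
      using PX B by (intro sum_mono card_strip_ge) auto
    moreover have "(\<Sum>e\<in>I \<times> J. B / 8) = ?t"
      using I by (simp add: card_cartesian_product power2_eq_square)
    moreover have "real (card (forbidden K B I J P)) < ?t / 2"
      using P by (simp add: bad_group_def)
    ultimately show ?thesis using card_forbidden_ge[OF I(1,2), of K B P] by linarith
  qed
  have "card ?bad * ?t = (\<Sum>P\<in>?bad. ?t)" by simp
  also have "\<dots> \<le> (\<Sum>P\<in>?bad. overlap K B I J P)" by (rule sum_mono) (rule ov)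
  also have "\<dots> \<le> (\<Sum>P\<in>?X. overlap K B I J P)"
    by (rule sum_mono2[OF finX sub]) (auto simp: overlap_def intro!: sum_nonneg)
  also have "\<dots> \<le> (real K)\<^sup>2 ^ (2 * m) * (1369 * real m ^ 4 * B\<^sup>2 / (real K)\<^sup>2 + 290 * real m ^ 3 * B * sqrt B / K)"
    by (rule sum_overlap[OF I BK K])
  finally have "card ?bad * ?t \<le> (real K)\<^sup>2 ^ (2 * m) * (1369 * real m ^ 4 * B\<^sup>2 / (real K)\<^sup>2 + 290 * real m ^ 3 * B * sqrt B / K)" .
  also have "1369 * real m ^ 4 * B\<^sup>2 / (real K)\<^sup>2 + 290 * real m ^ 3 * B * sqrt B / K
      = (8 * (1369 * (real m)\<^sup>2 * \<beta> + 290 * real m * sqrt \<beta>)) * ?t"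
    using K by (simp add: \<beta> real_sqrt_divide field_simps power_numeral_reduce)
  finally have "card ?bad * ?t \<le> ((real K)\<^sup>2 ^ (2 * m) * (8 * (1369 * (real m)\<^sup>2 * \<beta> + 290 * real m * sqrt \<beta>))) * ?t"
    by (simp only: mult.assoc)
  then show ?thesis using t0 by (simp only: mult_le_cancel_right_pos)
qed

definition spread_tuples :: "nat \<Rightarrow> nat \<Rightarrow> real \<Rightarrow> (nat \<Rightarrow> int \<times> int) set" where
  "spread_tuples n K B = {x \<in> {..<n} \<rightarrow>\<^sub>E cells K.
     \<forall>i<n. \<forall>j<n. \<forall>l<n. distinct [i, j, l] \<longrightarrow> \<not> thin B (x i) (x j) (x l)}"

text \<open>
  The first \<open>2mk\<close> points are divided into \<open>k\<close> independent groups. Either all of them are bad, or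
  the remaining points all avoid the large forbidden region of some group.
\<close>

lemma card_spread_tuples:
  assumes n: "2 * m * k \<le> n" and m: "m > 0"
    and B: "16 * real K \<le> B" "B \<le> (real K)\<^sup>2" and K: "K > 0"
    and \<beta>: "\<beta> = B / (real K)\<^sup>2"
    and \<eta>: "\<eta> = 8 * (1369 * (real m)\<^sup>2 * \<beta> + 290 * real m * sqrt \<beta>)"
  shows "card (spread_tuples n K B) \<le>
    (real K)\<^sup>2 ^ n * (\<eta> ^ k + exp (- ((real m)\<^sup>2 * \<beta> / 16 * real (n - 2 * m * k))))"
proof -
  define I where "I g = {2 * m * g..<2 * m * g + m}" for g
  define J where "J g = {2 * m * g + m..<2 * m * g + 2 * m}" for g
  define H where "H = {..<2 * m * k}"
  define R where "R = {2 * m * k..<n}"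
  define bad where "bad g = bad_group K B (I g) (J g) m" for g
  define F where "F = (real m)\<^sup>2 * B / 16"
  define Q where "Q = (real K)\<^sup>2"
  define X where "X = {..<n} \<rightarrow>\<^sub>E cells K"
  let ?S = "spread_tuples n K B"
  let ?S1 = "{x \<in> X. \<forall>g<k. restrict x (I g \<union> J g) \<in> bad g}"
  let ?S2 = "{x \<in> ?S. \<exists>g<k. restrict x (I g \<union> J g) \<notin> bad g}"
  have Q: "Q > 0" "real (card (cells K)) = Q" using K by (auto simp: Q_def card_cells)
  have B0: "B > 0" using B(1) K by (smt (verit) of_nat_0_less_iff)
  have \<eta>0: "\<eta> \<ge> 0" using B0 by (simp add: \<eta> \<beta>)
  have IJ_sub: "I g \<union> J g \<subseteq> H" if "g < k" for g
  proof -
    have "2 * m * g + 2 * m \<le> 2 * m * k"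
      using mult_le_mono2[of "Suc g" k "2 * m"] that by simp
    then show ?thesis by (auto simp: I_def J_def H_def)
  qed
  have H_sub: "H \<subseteq> {..<n}" using n by (auto simp: H_def)
  have finS: "finite X" unfolding X_def by (intro finite_PiE) auto
  have group: "\<exists>g<k. i \<in> I g \<union> J g" if "i \<in> H" for i
  proof (intro exI conjI)
    have i: "i < k * (2 * m)" using that by (simp add: H_def mult_ac)
    show "i div (2 * m) < k" using i m by (simp add: less_mult_imp_div_less)
    have "i = 2 * m * (i div (2 * m)) + i mod (2 * m)" by simp
    moreover have "i mod (2 * m) < 2 * m" using m by simp
    ultimately show "i \<in> I (i div (2 * m)) \<union> J (i div (2 * m))"
      unfolding I_def J_def Un_iff atLeastLessThan_iff by linarith
  qed
  have cR: "card R = n - 2 * m * k" by (simp add: R_def)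
  have "?S \<subseteq> ?S1 \<union> ?S2" by (auto simp: spread_tuples_def X_def)
  moreover have fin12: "finite ?S1" "finite ?S2"
    using finS by (auto simp: spread_tuples_def X_def intro: rev_finite_subset)
  ultimately have "card ?S \<le> card ?S1 + card ?S2"
    by (meson card_Un_le card_mono finite_UnI order_trans)
  moreover have "card ?S1 \<le> Q ^ n * \<eta> ^ k"
  proof -
    \<comment> \<open>The groups and \<open>R\<close> cover all indices, so the restrictions
      determine the tuple, and the bound for one bad group enters once per group.\<close>
    let ?f = "\<lambda>x. (\<lambda>g\<in>{..<k}. restrict x (I g \<union> J g), restrict x R)"
    let ?T = "(\<Pi>\<^sub>E g\<in>{..<k}. bad g) \<times> (R \<rightarrow>\<^sub>E cells K)"
    have "inj_on ?f ?S1"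
    proof (rule inj_onI)
      fix x y assume x: "x \<in> ?S1" and y: "y \<in> ?S1" and eq: "?f x = ?f y"
      show "x = y"
      proof (rule PiE_ext)
        show "x \<in> {..<n} \<rightarrow>\<^sub>E cells K" "y \<in> {..<n} \<rightarrow>\<^sub>E cells K" using x y by (auto simp: X_def)
        fix i assume i: "i \<in> {..<n}"
        show "x i = y i"
        proof (cases "i \<in> H")
          case True
          then obtain g where g: "g < k" "i \<in> I g \<union> J g" using group by blast
          have "(\<lambda>g\<in>{..<k}. restrict x (I g \<union> J g)) = (\<lambda>g\<in>{..<k}. restrict y (I g \<union> J g))"
            using eq by simp
          from fun_cong[OF this, of g] g have "restrict x (I g \<union> J g) = restrict y (I g \<union> J g)" by simp
          from fun_cong[OF this, of i] g show ?thesis by auto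
        next
          case False
          then have "i \<in> R" using i by (auto simp: H_def R_def)
          moreover have "restrict x R = restrict y R" using eq by simp
          ultimately show ?thesis by (metis restrict_apply')
        qed
      qed
    qed
    moreover have "?f ` ?S1 \<subseteq> ?T"
      by (auto simp: X_def R_def)
    moreover have finbad: "finite (bad g)" for g
      unfolding bad_def bad_group_def by (rule finite_subset[of _ "(I g \<union> J g) \<rightarrow>\<^sub>E cells K"])
        (auto simp: I_def J_def intro!: finite_PiE)
    then have "finite ?T" by (auto intro!: finite_PiE simp: R_def)
    ultimately have "card ?S1 \<le> card ?T" by (rule card_inj_on_le)
    then have "real (card ?S1) \<le> real (card ?T)" by simp
    also have "\<dots> = (\<Prod>g<k. real (card (bad g))) * Q ^ (n - 2 * m * k)"
      using Q cR by (simp add: card_cartesian_product card_PiE R_def)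
    also have "\<dots> \<le> (\<Prod>g<k. Q ^ (2 * m) * \<eta>) * Q ^ (n - 2 * m * k)"
    proof (intro mult_right_mono prod_mono conjI)
      fix g
      show "real (card (bad g)) \<le> Q ^ (2 * m) * \<eta>"
        unfolding bad_def Q_def \<eta>
        by (rule card_bad_group[OF _ _ _ _ _ m B K \<beta>]) (auto simp: I_def J_def)
    qed (use Q in auto)
    also have "\<dots> = (Q ^ (2 * m * k) * Q ^ (n - 2 * m * k)) * \<eta> ^ k"
      by (simp add: power_mult_distrib mult_ac flip: power_mult)
    also have "\<dots> = Q ^ n * \<eta> ^ k"
      using n by (simp flip: power_add)
    finally show ?thesis .
  qed
  moreover have "card ?S2 \<le> Q ^ n * exp (- ((real m)\<^sup>2 * \<beta> / 16 * real (n - 2 * m * k)))"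
  proof -
    \<comment> \<open>The union over all groups depends on the first points alone, so the count need
      not record which group is good.\<close>
    define Fb where "Fb h = (\<Union>g\<in>{..<k}. forbidden K B (I g) (J g) h)" for h
    let ?Y = "{h \<in> H \<rightarrow>\<^sub>E cells K. F \<le> card (Fb h)}"
    let ?f = "\<lambda>x. (restrict x H, restrict x R)"
    let ?T = "Sigma ?Y (\<lambda>h. R \<rightarrow>\<^sub>E (cells K - Fb h))"
    have Fb_sub: "Fb h \<subseteq> cells K" for h by (auto simp: Fb_def forbidden_def)
    have finY: "finite ?Y"
      by (rule finite_subset[of _ "H \<rightarrow>\<^sub>E cells K"]) (auto simp: H_def intro!: finite_PiE)
    have finT: "finite ?T" using finY by (auto intro!: finite_SigmaI finite_PiE simp: R_def)
    have "inj_on ?f ?S2"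
    proof (rule inj_onI)
      fix x y assume x: "x \<in> ?S2" and y: "y \<in> ?S2" and eq: "?f x = ?f y"
      show "x = y"
      proof (rule PiE_ext)
        show "x \<in> {..<n} \<rightarrow>\<^sub>E cells K" "y \<in> {..<n} \<rightarrow>\<^sub>E cells K" using x y by (auto simp: spread_tuples_def)
        fix i assume "i \<in> {..<n}"
        then have "i \<in> H \<or> i \<in> R" by (auto simp: H_def R_def)
        then show "x i = y i" using eq by (metis Pair_inject restrict_apply')
      qed
    qed
    moreover have "?f x \<in> ?T" if x: "x \<in> ?S2" for x
    proof -
      let ?h = "restrict x H"
      have xX: "\<And>i. i < n \<Longrightarrow> x i \<in> cells K" and xs: "\<And>i j l. i < n \<Longrightarrow> j < n \<Longrightarrow> l < n \<Longrightarrow>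
          distinct [i, j, l] \<Longrightarrow> \<not> thin B (x i) (x j) (x l)"
        using x by (auto simp: spread_tuples_def)
      obtain g where g: "g < k" "restrict x (I g \<union> J g) \<notin> bad g" using x by blast
      have "I g \<union> J g \<subseteq> {..<n}" using IJ_sub[OF g(1)] H_sub by (rule subset_trans)
      then have "restrict x (I g \<union> J g) \<in> (I g \<union> J g) \<rightarrow>\<^sub>E cells K"
        unfolding restrict_PiE_iff using xX by blast
      then have "F \<le> card (forbidden K B (I g) (J g) (restrict x (I g \<union> J g)))"
        using g(2) by (auto simp: bad_def bad_group_def F_def)
      also have "forbidden K B (I g) (J g) (restrict x (I g \<union> J g)) = forbidden K B (I g) (J g) ?h"
        using IJ_sub[OF g(1)] by (auto simp: forbidden_def subset_iff)
      also have "real (card (forbidden K B (I g) (J g) ?h)) \<le> card (Fb ?h)"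
        using g(1) finite_subset[OF Fb_sub] by (auto simp: Fb_def intro!: card_mono)
      finally have "F \<le> card (Fb ?h)" .
      moreover have "?h \<in> H \<rightarrow>\<^sub>E cells K"
        unfolding restrict_PiE_iff using H_sub xX by blast
      moreover have "x r \<notin> Fb ?h" if r: "r \<in> R" for r
      proof
        assume "x r \<in> Fb ?h"
        then obtain g i j where g': "g < k" "i \<in> I g" "j \<in> J g" "thin B (?h i) (?h j) (x r)"
          by (auto simp: Fb_def forbidden_def)
        then have ij: "i \<in> H" "j \<in> H" "i \<noteq> j" using IJ_sub[of g] by (auto simp: I_def J_def)
        then have "distinct [i, j, r]" "i < n" "j < n" "r < n"
          using r H_sub by (auto simp: H_def R_def)
        then show False using xs g'(4) ij by auto
      qed
      then have "restrict x R \<in> R \<rightarrow>\<^sub>E (cells K - Fb ?h)"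
        using xX by (auto simp: R_def)
      ultimately show ?thesis by auto
    qed
    then have "?f ` ?S2 \<subseteq> ?T" by blast
    ultimately have "card ?S2 \<le> card ?T" using finT by (rule card_inj_on_le)
    then have "real (card ?S2) \<le> real (card ?T)" by simp
    also have "\<dots> = (\<Sum>h\<in>?Y. real (card (cells K - Fb h)) ^ card R)"
      using finY by (subst card_SigmaI) (auto simp: card_PiE R_def intro!: finite_PiE)
    also have "\<dots> \<le> (\<Sum>h\<in>?Y. (Q * exp (- ((real m)\<^sup>2 * \<beta> / 16))) ^ card R)"
    proof (intro sum_mono power_mono)
      fix h assume h: "h \<in> ?Y"
      have "real (card (cells K - Fb h)) = Q - card (Fb h)"
        using Fb_sub[of h] Q by (simp add: card_Diff_subset finite_subset of_nat_diff card_mono)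
      also have "\<dots> \<le> Q - F" using h by simp
      also have "\<dots> = Q * (1 - (real m)\<^sup>2 * \<beta> / 16)"
        using Q by (simp add: F_def \<beta> Q_def[symmetric] field_simps)
      also have "\<dots> \<le> Q * exp (- ((real m)\<^sup>2 * \<beta> / 16))"
        using Q exp_ge_add_one_self[of "- ((real m)\<^sup>2 * \<beta> / 16)"] by (intro mult_left_mono) auto
      finally show "real (card (cells K - Fb h)) \<le> Q * exp (- ((real m)\<^sup>2 * \<beta> / 16))" .
    qed auto
    also have "\<dots> = card ?Y * (Q * exp (- ((real m)\<^sup>2 * \<beta> / 16))) ^ card R" by simp
    also have "\<dots> \<le> Q ^ (2 * m * k) * (Q * exp (- ((real m)\<^sup>2 * \<beta> / 16))) ^ card R"
    proof (rule mult_right_mono)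
      have "card ?Y \<le> card (H \<rightarrow>\<^sub>E cells K)"
        by (intro card_mono) (auto simp: H_def intro!: finite_PiE)
      then have "real (card ?Y) \<le> real (card (H \<rightarrow>\<^sub>E cells K))" by simp
      then show "real (card ?Y) \<le> Q ^ (2 * m * k)" using Q by (simp add: card_PiE H_def)
    qed (use Q in auto)
    also have "\<dots> = (Q ^ (2 * m * k) * Q ^ (n - 2 * m * k)) * exp (- ((real m)\<^sup>2 * \<beta> / 16)) ^ (n - 2 * m * k)"
      by (simp add: cR power_mult_distrib)
    also have "\<dots> = Q ^ n * exp (- ((real m)\<^sup>2 * \<beta> / 16)) ^ (n - 2 * m * k)"
      using n by (simp flip: power_add)
    also have "exp (- ((real m)\<^sup>2 * \<beta> / 16)) ^ (n - 2 * m * k) = exp (- ((real m)\<^sup>2 * \<beta> / 16 * real (n - 2 * m * k)))"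
      by (simp add: exp_of_nat_mult[symmetric] mult.commute)
    finally show ?thesis .
  qed
  ultimately have "real (card ?S) \<le> Q ^ n * \<eta> ^ k + Q ^ n * exp (- ((real m)\<^sup>2 * \<beta> / 16 * real (n - 2 * m * k)))"
    by linarith
  then show ?thesis by (simp add: Q_def distrib_left)
qed

section \<open>From spread tuples to spread sets\<close>

lemma small_iff_thin:
  assumes "n > 0" "K > 0"
  shows "small n K T a b c \<longleftrightarrow> thin (real T * (real K - 1)\<^sup>2 / real n ^ 3) a b c"
proof -
  have "small n K T a b c \<longleftrightarrow> real_of_int (\<bar>det3 a b c\<bar> * int (n ^ 3)) \<le> real_of_int (int (T * (K - 1)\<^sup>2))"
    unfolding small_def of_int_le_iff ..
  also have "\<dots> \<longleftrightarrow> thin (real T * (real K - 1)\<^sup>2 / real n ^ 3) a b c"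
    using assms by (simp add: thin_def field_simps of_nat_diff)
  finally show ?thesis .
qed

lemma bij_betw_cell: "bij_betw (cell K) {..<K * K} (cells K)"
proof (rule bij_betwI[where g = "\<lambda>p. nat (fst p) * K + nat (snd p)"])
  show "cell K \<in> {..<K * K} \<rightarrow> cells K"
    by (auto simp: cell_def cells_def less_mult_imp_div_less) (metis gr_implies_not0 mod_less_divisor mult_eq_0_iff neq0_conv)
  show "(\<lambda>p. nat (fst p) * K + nat (snd p)) \<in> cells K \<rightarrow> {..<K * K}"
  proof (intro Pi_I, clarsimp simp: cells_def)
    fix a b assume "0 \<le> a" "a < int K" "0 \<le> b" "b < int K"
    then have "Suc (nat a) \<le> K" "nat b < K" by auto
    then show "nat a * K + nat b < K * K"
      using mult_le_mono1[of "Suc (nat a)" K K] by simp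
  qed
qed (auto simp: cell_def cells_def)

text \<open>Each spread set has \<open>n!\<close> injective enumerations, all of them spread tuples.
  The image of an enumeration recovers the set, so different sets contribute disjointly.\<close>

lemma card_spread_sets_fact:
  assumes "n > 0" "K > 0"
  shows "card (spread_sets n K T) * fact n \<le>
    card (spread_tuples n K (real T * (real K - 1)\<^sup>2 / real n ^ 3))"
proof -
  define B where "B = real T * (real K - 1)\<^sup>2 / real n ^ 3"
  let ?c = "cell K"
  have inj: "inj_on ?c {..<K * K}" and img: "?c ` {..<K * K} = cells K"
    using bij_betw_cell[of K] by (auto simp: bij_betw_def)
  define A where "A S = {x \<in> {..<n} \<rightarrow>\<^sub>E (?c ` S). inj_on x {..<n}}" for S
  have S: "S \<subseteq> {..<K * K}" "card S = n" "finite S" "card (?c ` S) = n" if "S \<in> spread_sets n K T" for S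
  proof -
    show 1: "S \<subseteq> {..<K * K}" "card S = n" using that by (auto simp: spread_sets_def)
    then show "finite S" using finite_subset by blast
    show "card (?c ` S) = n" using 1 inj by (simp add: card_image inj_on_subset)
  qed
  have surj: "x ` {..<n} = ?c ` S" if "S \<in> spread_sets n K T" "x \<in> A S" for x S
  proof (rule card_subset_eq)
    show "finite (?c ` S)" using S that by simp
    show "x ` {..<n} \<subseteq> ?c ` S" using that by (simp add: A_def PiE_iff image_subset_iff)
    show "card (x ` {..<n}) = card (?c ` S)" using that S by (simp add: A_def card_image)
  qed
  have cardA: "card (A S) = fact n" if "S \<in> spread_sets n K T" for S
    using card_inj_on_subset_funcset[of "{..<n}" "?c ` S" "{..<n}"] S[OF that]
    unfolding A_def by (simp add: fact_prod_rev)
  have "card (spread_sets n K T) * fact n = (\<Sum>S\<in>spread_sets n K T. card (A S))"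
    by (simp add: cardA)
  also have "\<dots> = card (\<Union>S\<in>spread_sets n K T. A S)"
  proof (rule card_UN_disjoint[symmetric])
    show "\<forall>S\<in>spread_sets n K T. finite (A S)"
      using cardA by (metis card.infinite fact_nonzero)
    show "\<forall>S\<in>spread_sets n K T. \<forall>S'\<in>spread_sets n K T. S \<noteq> S' \<longrightarrow> A S \<inter> A S' = {}"
    proof (intro ballI impI)
      fix S S' assume *: "S \<in> spread_sets n K T" "S' \<in> spread_sets n K T" "S \<noteq> S'"
      show "A S \<inter> A S' = {}"
      proof (rule ccontr)
        assume "A S \<inter> A S' \<noteq> {}"
        then obtain x where "x \<in> A S" "x \<in> A S'" by auto
        then have "?c ` S = ?c ` S'" using surj * by metis
        then show False using * S inj by (metis inj_on_image_eq_iff)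
      qed
    qed
  qed (rule finite_spread_sets)
  also have "\<dots> \<le> card (spread_tuples n K B)"
  proof (rule card_mono)
    show "finite (spread_tuples n K B)"
      by (rule finite_subset[of _ "{..<n} \<rightarrow>\<^sub>E cells K"]) (auto simp: spread_tuples_def intro!: finite_PiE)
    show "(\<Union>S\<in>spread_sets n K T. A S) \<subseteq> spread_tuples n K B"
    proof (intro UN_least subsetI)
      fix S x assume *: "S \<in> spread_sets n K T" "x \<in> A S"
      have ns: "\<not> thin B (?c a) (?c b) (?c c)" if "a \<in> S" "b \<in> S" "c \<in> S" "a < b" "b < c" for a b c
        using * that small_iff_thin[OF assms] by (auto simp: spread_sets_def B_def)
      have ns': "\<not> thin B (?c a) (?c b) (?c c)" if "a \<in> S" "b \<in> S" "c \<in> S" "distinct [a, b, c]" for a b c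
      proof -
        consider "a < b" "b < c" | "a < c" "c < b" | "b < a" "a < c" | "b < c" "c < a" | "c < a" "a < b" | "c < b" "b < a"
          using \<open>distinct [a, b, c]\<close> by fastforce
        then show ?thesis
          using ns that by cases (metis thin_swap1 thin_swap2)+
      qed
      have "\<not> thin B (x i) (x j) (x l)" if ijl: "i < n" "j < n" "l < n" "distinct [i, j, l]" for i j l
      proof -
        have "x i \<in> ?c ` S" "x j \<in> ?c ` S" "x l \<in> ?c ` S" "inj_on x {..<n}"
          using * ijl by (auto simp: A_def)
        then obtain a b c where abc: "x i = ?c a" "x j = ?c b" "x l = ?c c" "a \<in> S" "b \<in> S" "c \<in> S" by auto
        have "x i \<noteq> x j" "x i \<noteq> x l" "x j \<noteq> x l"
          using \<open>inj_on x {..<n}\<close> ijl by (auto simp: inj_on_eq_iff)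
        then have "distinct [a, b, c]" using abc by auto
        then show ?thesis using ns' abc by simp
      qed
      moreover have "x \<in> {..<n} \<rightarrow>\<^sub>E cells K"
      proof -
        have "?c ` S \<subseteq> cells K" using S(1)[OF *(1)] img by blast
        then have "{..<n} \<rightarrow>\<^sub>E ?c ` S \<subseteq> {..<n} \<rightarrow>\<^sub>E cells K" by (intro PiE_mono)
        then show ?thesis using *(2) unfolding A_def by blast
      qed
      ultimately show "x \<in> spread_tuples n K B" unfolding spread_tuples_def by blast
    qed
  qed
  finally show ?thesis by (simp add: B_def)
qed

section \<open>Incompressible arrangements\<close>


text \<open>Bernoulli's inequality for \<open>(1 - n/q)^n\<close>: for such \<open>q\<close>,
  allowing repetitions at most doubles the number of tuples.\<close>

lemma power_le_fact_binomial:
  fixes q n :: nat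
  assumes "2 * n\<^sup>2 \<le> q" "0 < n"
  shows "real q ^ n \<le> 2 * (fact n * real (q choose n))"
proof -
  have "n * 1 \<le> n * n" using assms(2) by (intro mult_le_mono2) simp
  then have nq: "n \<le> q" "0 < q" using assms unfolding power2_eq_square by linarith+
  have "1 / 2 \<le> 1 + real n * (- (real n / real q))"
    using assms nq by (simp add: field_simps power2_eq_square flip: of_nat_mult)
  also have "\<dots> \<le> (1 + (- (real n / real q))) ^ n"
    by (rule Bernoulli_inequality) (use nq in simp)
  finally have "real q ^ n * (1 / 2) \<le> real q ^ n * (1 - real n / real q) ^ n"
    by (intro mult_left_mono) auto
  also have "\<dots> = (real q - real n) ^ n"
    using nq by (simp add: field_simps flip: power_mult_distrib)
  also have "\<dots> = (\<Prod>i = 0..<n. real q - real n)" by simp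
  also have "\<dots> \<le> (\<Prod>i = 0..<n. real q - real i)"
    using nq by (intro prod_mono) auto
  also have "\<dots> = fact n * real (q choose n)"
    by (simp add: binomial_gbinomial gbinomial_mult_fact)
  finally show ?thesis by simp
qed

lemma few_spread_sets:
  fixes c :: nat
  defines "D \<equiv> 20480000 :: nat"
  shows "\<forall>\<^sub>F n in sequentially. \<forall>v. 2 \<le> v \<and> real v \<le> 2 * log 2 (real n) + real c \<longrightarrow>
    (\<forall>\<^sub>F K in sequentially. real (card (spread_sets n K (D * v))) \<le> real (K\<^sup>2 choose n) / 2 ^ (3 * v))"
proof -
  \<comment> \<open>A group fails with probability at most a multiple of \<open>T / sqrt n\<close>,
    where \<open>T\<close> is logarithmic. The exponent 2/5 below 1/2 absorbs the logarithm, and 25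
    times 2/5 is 10.\<close>
  have E2: "\<forall>\<^sub>F n in sequentially. 14000 * (real D * (2 * log 2 (real n) + real c)) / sqrt (real n)
      \<le> real n powr (- 2 / 5)"
    unfolding D_def by real_asymp
  have E3: "\<forall>\<^sub>F n in sequentially. real D * (2 * log 2 (real n) + real c) \<le> real n"
    unfolding D_def by real_asymp
  have E4: "\<forall>\<^sub>F n in sequentially. 2 ^ (4 * c) \<le> (real n)\<^sup>2"
    by real_asymp
  show ?thesis
    using E2 E3 E4 eventually_ge_at_top[of 200]
  proof eventually_elim
    case (elim n)
    note n2 = elim(1) and n3 = elim(2) and n4 = elim(3) and n = elim(4)
    show ?case
    proof (intro allI impI, elim conjE)
      fix v assume v: "2 \<le> v" "real v \<le> 2 * log 2 (real n) + real c"
      define T where "T = D * v"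
      \<comment> \<open>The 25 groups of \<open>2 * m\<close> points then use at most half of all
        points.\<close>
      define m where "m = n div 100"
      have T: "1 \<le> real T" "real T = real D * real v" using v by (auto simp: T_def D_def)
      have Tle: "real T \<le> real D * (2 * log 2 (real n) + real c)"
        unfolding T(2) using v by (intro mult_left_mono) auto
      then have Tn: "real T \<le> real n" using n3 by linarith
      have m: "m > 0" "real n / 200 \<le> real m" "2 * m * 25 \<le> n" "real m \<le> real n"
        "real n / 2 \<le> real (n - 2 * m * 25)"
        using n by (auto simp: m_def)
      show "\<forall>\<^sub>F K in sequentially. real (card (spread_sets n K (D * v))) \<le> real (K\<^sup>2 choose n) / 2 ^ (3 * v)"
        \<comment> \<open>\<open>K \<ge> 2 * n\<close> serves \<open>power_le_fact_binomial\<close>;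
          \<open>K \<ge> 64 * n^3\<close> raises \<open>B\<close>, which is at least
          \<open>K^2 / (4 * n^3)\<close>, to at least \<open>16 * K\<close>.\<close>
        using eventually_ge_at_top[of "2 * n + 64 * n ^ 3"]
      proof eventually_elim
        case (elim K)
        have K: "2 * n \<le> K" "64 * n ^ 3 \<le> K" "2 \<le> K" using elim n by auto
        define B where "B = real T * (real K - 1)\<^sup>2 / real n ^ 3"
        define \<beta> where "\<beta> = B / (real K)\<^sup>2"
        define \<eta> where "\<eta> = 8 * (1369 * (real m)\<^sup>2 * \<beta> + 290 * real m * sqrt \<beta>)"
        have K1: "(real K)\<^sup>2 / 4 \<le> (real K - 1)\<^sup>2" "(real K - 1)\<^sup>2 \<le> (real K)\<^sup>2"
        proof -
          have "(real K / 2)\<^sup>2 \<le> (real K - 1)\<^sup>2" using K by (intro power_mono) auto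
          then show "(real K)\<^sup>2 / 4 \<le> (real K - 1)\<^sup>2" by (simp add: power_divide)
          show "(real K - 1)\<^sup>2 \<le> (real K)\<^sup>2" using K by (intro power_mono) auto
        qed
        have nn: "real n ^ 3 > 0" "real n \<le> real n ^ 3" "1 \<le> real n"
          using n self_le_power[of "real n" 3] by auto
        have \<beta>1: "real T / (4 * real n ^ 3) \<le> \<beta>"
        proof -
          have "real T / (4 * real n ^ 3) = real T * ((real K)\<^sup>2 / 4) / real n ^ 3 / (real K)\<^sup>2"
            using K nn by (simp add: field_simps)
          also have "\<dots> \<le> \<beta>"
            unfolding \<beta>_def B_def using K1 nn by (intro divide_right_mono mult_left_mono) auto
          finally show ?thesis .
        qed
        have \<beta>2: "\<beta> \<le> real T / real n ^ 3"
        proof -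
          have "\<beta> \<le> real T * (real K)\<^sup>2 / real n ^ 3 / (real K)\<^sup>2"
            unfolding \<beta>_def B_def using K1 nn by (intro divide_right_mono mult_left_mono) auto
          also have "\<dots> = real T / real n ^ 3" using K by simp
          finally show ?thesis .
        qed
        have BB: "B = \<beta> * (real K)\<^sup>2" using K by (simp add: \<beta>_def)
        have \<beta>0: "0 \<le> \<beta>" using \<beta>1 T nn by (smt (verit) divide_nonneg_pos)
        have B2: "B \<le> (real K)\<^sup>2"
        proof -
          have "\<beta> \<le> 1" using \<beta>2 Tn nn by (smt (verit) divide_le_eq_1_pos)
          then show ?thesis unfolding BB by (simp add: mult_left_le_one_le \<beta>0)
        qed
        have B1: "16 * real K \<le> B"
        proof -
          have "real (64 * n ^ 3) \<le> real K" using K(2) by (simp only: of_nat_le_iff)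
          then have "16 \<le> 1 / (4 * real n ^ 3) * real K" using nn by (simp add: field_simps)
          also have "\<dots> \<le> \<beta> * real K"
            using \<beta>1 T nn by (intro mult_right_mono) (smt (verit) divide_right_mono, simp)
          finally have "16 * real K \<le> \<beta> * real K * real K" by (intro mult_right_mono) auto
          then show ?thesis by (simp add: BB power2_eq_square mult.assoc)
        qed
        have m\<beta>: "(real m)\<^sup>2 * \<beta> \<le> real T / real n"
        proof -
          have "(real m)\<^sup>2 * \<beta> \<le> (real n)\<^sup>2 * (real T / real n ^ 3)"
            using m \<beta>2 \<beta>0 by (intro mult_mono power_mono) auto
          also have "\<dots> = real T / real n" using nn by (simp add: field_simps power_numeral_reduce)
          finally show ?thesis .
        qed
        have \<eta>: "\<eta> \<le> real n powr (- 2 / 5)"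
        proof -
          have sq: "sqrt x \<le> x" if "1 \<le> x" for x :: real
            using mult_left_mono[of 1 "sqrt x" "sqrt x"] that by simp
          have "real T / real n \<le> real T / sqrt (real n)"
            using nn sq[of "real n"] by (intro divide_left_mono) auto
          then have a: "(real m)\<^sup>2 * \<beta> \<le> real T / sqrt (real n)" using m\<beta> by linarith
          have "real m * sqrt \<beta> = sqrt ((real m)\<^sup>2 * \<beta>)" by (simp add: real_sqrt_mult)
          also have "\<dots> \<le> sqrt (real T / real n)" using m\<beta> by simp
          also have "\<dots> = sqrt (real T) / sqrt (real n)" by (rule real_sqrt_divide)
          also have "\<dots> \<le> real T / sqrt (real n)"
            using T sq by (intro divide_right_mono) auto
          finally have b: "real m * sqrt \<beta> \<le> real T / sqrt (real n)" .
          have "\<eta> \<le> 14000 * (real T / sqrt (real n))"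
          proof -
            have "\<eta> = 10952 * ((real m)\<^sup>2 * \<beta>) + 2320 * (real m * sqrt \<beta>)" by (simp add: \<eta>_def)
            moreover have "0 \<le> real T / sqrt (real n)" by simp
            ultimately show ?thesis using a b by linarith
          qed
          also have "\<dots> \<le> 14000 * (real D * (2 * log 2 (real n) + real c)) / sqrt (real n)"
            using Tle by (simp add: divide_right_mono)
          finally show ?thesis using n2 by linarith
        qed
        \<comment> \<open>The logarithmic bound on \<open>v\<close> leaves
          \<open>n^8 * 2^(4 * c)\<close>; the spare factor \<open>n^2\<close> absorbs the
          constant.\<close>
        have p4: "2 ^ (4 * v) \<le> real n ^ 10"
        proof -
          have "(2::real) ^ (4 * v) = 2 powr (4 * real v)" by (simp flip: powr_realpow)
          also have "\<dots> \<le> 2 powr (log 2 (real n) * 8 + real (4 * c))"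
            using v by (intro powr_mono) auto
          also have "\<dots> = (2 powr log 2 (real n)) powr 8 * 2 powr real (4 * c)"
            by (simp only: powr_add powr_powr)
          also have "\<dots> = real n ^ 8 * 2 ^ (4 * c)"
          proof -
            have "(2::real) powr real (4 * c) = 2 ^ (4 * c)" by (rule powr_realpow) simp
            moreover have "(2 powr log 2 (real n)) powr 8 = real n ^ 8" using nn by simp
            ultimately show ?thesis by simp
          qed
          also have "\<dots> \<le> real n ^ 8 * (real n)\<^sup>2" using n4 by (intro mult_left_mono) auto
          also have "\<dots> = real n ^ 10" by (simp flip: power_add)
          finally show ?thesis .
        qed
        have \<eta>25: "\<eta> ^ 25 \<le> 1 / 2 ^ (4 * v)"
        proof -
          have "\<eta> ^ 25 \<le> (real n powr (- 2 / 5)) ^ 25"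
            using \<eta> \<beta>0 by (intro power_mono) (auto simp: \<eta>_def)
          also have "\<dots> = real n powr (- 10)"
            using powr_power[of "real n" "- 2 / 5" 25] nn by simp
          also have "\<dots> = 1 / real n ^ 10"
            using nn by (simp add: powr_minus field_simps powr_numeral)
          also have "\<dots> \<le> 1 / 2 ^ (4 * v)" using p4 nn by (intro divide_left_mono) auto
          finally show ?thesis .
        qed
        have ex: "exp (- ((real m)\<^sup>2 * \<beta> / 16 * real (n - 2 * m * 25))) \<le> 1 / 2 ^ (4 * v)"
        proof -
          \<comment> \<open>Origin of \<open>D\<close>: it is
            \<open>4 * (200^2 * 4 * 16 * 2)\<close>, the factors in parentheses coming from the
            group size, the lower bound for \<open>\<beta>\<close>, the threshold of
            \<open>bad_group\<close> and the remaining half of the points.\<close>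
          have "4 * real v = (real n / 200)\<^sup>2 * (real T / (4 * real n ^ 3)) / 16 * (real n / 2)"
            using nn by (simp add: T(2) D_def field_simps power_numeral_reduce)
          also have "\<dots> \<le> (real m)\<^sup>2 * \<beta> / 16 * real (n - 2 * m * 25)"
            using m \<beta>1 \<beta>0 nn by (intro mult_mono divide_right_mono power_mono) auto
          finally have "exp (- ((real m)\<^sup>2 * \<beta> / 16 * real (n - 2 * m * 25))) \<le> exp (- (4 * real v))" by simp
          also have "\<dots> = 1 / exp 1 ^ (4 * v)"
            by (simp add: exp_minus field_simps flip: exp_of_nat_mult)
          also have "\<dots> \<le> 1 / 2 ^ (4 * v)"
            using exp_ge_add_one_self[of 1] by (intro divide_left_mono power_mono) auto
          finally show ?thesis .
        qed
        have np: "0 < n" "0 < K" using n K by auto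
        have "real (card (spread_sets n K T) * fact n) \<le> real (card (spread_tuples n K B))"
          using card_spread_sets_fact[OF np, of T] unfolding B_def by (simp only: of_nat_le_iff)
        also have "\<dots> \<le> (real K)\<^sup>2 ^ n * (\<eta> ^ 25 + exp (- ((real m)\<^sup>2 * \<beta> / 16 * real (n - 2 * m * 25))))"
          by (rule card_spread_tuples[OF m(3) m(1) B1 B2 np(2) \<beta>_def \<eta>_def])
        also have "\<dots> \<le> (real K)\<^sup>2 ^ n * (1 / 2 ^ (4 * v) + 1 / 2 ^ (4 * v))"
          using \<eta>25 ex by (intro mult_left_mono add_mono) auto
        also have "\<dots> \<le> 2 * (fact n * real (K\<^sup>2 choose n)) * (1 / 2 ^ (4 * v) + 1 / 2 ^ (4 * v))"
        proof (rule mult_right_mono)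
          have "(2 * n) * (2 * n) \<le> K * K" using K by (intro mult_le_mono) auto
          then have "2 * n\<^sup>2 \<le> K\<^sup>2" by (simp add: power2_eq_square)
          from power_le_fact_binomial[OF this np(1)]
          show "(real K)\<^sup>2 ^ n \<le> 2 * (fact n * real (K\<^sup>2 choose n))" by simp
        qed auto
        also have "\<dots> = (4 / 2 ^ v) * (real (K\<^sup>2 choose n) / 2 ^ (3 * v)) * fact n"
          by (simp add: field_simps flip: power_add)
        \<comment> \<open>The two failure events and the factor 2 of the binomial bound make up the
          4; since \<open>v \<ge> 2\<close> it is paid for by passing from \<open>4 * v\<close> to
          \<open>3 * v\<close>.\<close>
        also have "\<dots> \<le> 1 * (real (K\<^sup>2 choose n) / 2 ^ (3 * v)) * fact n"
        proof (intro mult_right_mono)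
          have "(2::real) ^ 2 \<le> 2 ^ v" using v by (intro power_increasing) auto
          then show "4 / 2 ^ v \<le> (1::real)" by simp
        qed auto
        finally have "real (card (spread_sets n K T)) * fact n \<le> real (K\<^sup>2 choose n) / 2 ^ (3 * v) * fact n"
          by simp
        then show ?case unfolding T_def by (simp only: mult_le_cancel_right_pos fact_gt_zero)
      qed
    qed
  qed
qed

section \<open>The grid in the unit square and its integer model\<close>

definition grid_cell :: "nat \<Rightarrow> nat \<Rightarrow> real ^ 2" where
  "grid_cell K a = grid_point K (a div K) (a mod K)"

lemma encode_arrangement_eq:
  "encode_arrangement K X = map (\<lambda>a. grid_cell K a \<in> X) [0..<K * K]"
proof (cases "K = 0")
  case False
  have "concat (map (\<lambda>i. map (\<lambda>j. grid_point K i j \<in> X) [0..<K]) [0..<M])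
      = map (\<lambda>a. grid_cell K a \<in> X) [0..<M * K]" for M
  proof (induction M)
    case (Suc M)
    have "[0..<Suc M * K] = [0..<M * K] @ map (\<lambda>j. M * K + j) [0..<K]"
      using upt_add_eq_append[of 0 "M * K" K] by (simp add: map_add_upt add.commute)
    moreover have "map (\<lambda>a. grid_cell K a \<in> X) (map (\<lambda>j. M * K + j) [0..<K])
        = map (\<lambda>j. grid_point K M j \<in> X) [0..<K]"
      using False by (auto simp: grid_cell_def)
    ultimately show ?case using Suc by simp
  qed simp
  then show ?thesis by (simp add: encode_arrangement_def)
qed (simp add: encode_arrangement_def)

lemma grid_point_nth: "grid_point K i j $ 1 = real i / (real K - 1)" "grid_point K i j $ 2 = real j / (real K - 1)"
  by (simp_all add: grid_point_def)

lemma inj_grid_cell: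
  assumes "2 \<le> K"
  shows "inj_on (grid_cell K) {..<K * K}"
proof (rule inj_onI)
  fix a b assume eq: "grid_cell K a = grid_cell K b"
  have "real (a div K) / (real K - 1) = real (b div K) / (real K - 1)"
    "real (a mod K) / (real K - 1) = real (b mod K) / (real K - 1)"
    using eq unfolding grid_cell_def by (metis grid_point_nth(1), metis grid_point_nth(2))
  then have "a div K = b div K" "a mod K = b mod K" using assms by auto
  then show "a = b" by (metis div_mult_mod_eq)
qed

lemma grid_eq: "grid K = grid_cell K ` {..<K * K}"
proof (intro equalityI subsetI)
  fix x assume "x \<in> grid K"
  then obtain i j where ij: "x = grid_point K i j" "i < K" "j < K" by (auto simp: grid_def)
  have "Suc i * K \<le> K * K" using ij by (intro mult_le_mono1) simp
  then have "i * K + j < K * K" using ij by simp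
  moreover have "x = grid_cell K (i * K + j)" using ij by (simp add: grid_cell_def)
  ultimately show "x \<in> grid_cell K ` {..<K * K}" by blast
next
  fix x assume "x \<in> grid_cell K ` {..<K * K}"
  then obtain a where a: "a < K * K" "x = grid_cell K a" by auto
  then have "a div K < K" "a mod K < K"
    by (auto simp: less_mult_imp_div_less) (metis mod_less_divisor mult_0_right neq0_conv not_less0)
  then show "x \<in> grid K" unfolding grid_def a(2) grid_cell_def by blast
qed

lemma triangle_area_grid_cell:
  assumes "2 \<le> K"
  shows "triangle_area (grid_cell K a) (grid_cell K b) (grid_cell K c)
    = real_of_int \<bar>det3 (cell K a) (cell K b) (cell K c)\<bar> / (2 * (real K - 1)\<^sup>2)"
proof -
  have "triangle_area (grid_cell K a) (grid_cell K b) (grid_cell K c) =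
    \<bar>(real (c div K) / (real K - 1) - real (a div K) / (real K - 1)) * (real (b mod K) / (real K - 1) - real (a mod K) / (real K - 1))
     - (real (b div K) / (real K - 1) - real (a div K) / (real K - 1)) * (real (c mod K) / (real K - 1) - real (a mod K) / (real K - 1))\<bar> / 2"
    unfolding triangle_area_def content_triangle grid_cell_def grid_point_nth ..
  \<comment> \<open>\<open>content_triangle\<close> uses the opposite orientation, hence the
    sign.\<close>
  also have "\<dots> = \<bar>- (real_of_int (det3 (cell K a) (cell K b) (cell K c)) / (real K - 1)\<^sup>2)\<bar> / 2"
    by (simp add: det3_def cell_def diff_divide_distrib[symmetric] power2_eq_square,
        simp add: diff_divide_distrib add_divide_distrib algebra_simps,
        rule disjI2, rule abs_minus_commute)
  also have "\<dots> = real_of_int \<bar>det3 (cell K a) (cell K b) (cell K c)\<bar> / (2 * (real K - 1)\<^sup>2)"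
    by (simp add: abs_divide)
  finally show ?thesis .
qed

text \<open>The coordinates of \<open>cell\<close> are those of the grid points times
  \<open>K - 1\<close>, which turns the area bound \<open>T / (2 n^3)\<close> into
  \<open>small\<close>.\<close>

lemma arrangement_spread_set:
  assumes X: "arrangement n K X" and K: "2 \<le> K" and n: "0 < n"
    and area: "\<And>a b c. a \<in> X \<Longrightarrow> b \<in> X \<Longrightarrow> c \<in> X \<Longrightarrow> a \<noteq> b \<Longrightarrow> a \<noteq> c \<Longrightarrow> b \<noteq> c \<Longrightarrow>
      real T / (2 * real n ^ 3) < triangle_area a b c"
  shows "{a. a < K * K \<and> grid_cell K a \<in> X} \<in> spread_sets n K T" (is "?S \<in> _")
proof -
  have inj: "inj_on (grid_cell K) ?S"
    using inj_grid_cell[OF K] by (rule inj_on_subset) auto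
  have "grid_cell K ` ?S = X"
    using X by (auto simp: arrangement_def grid_eq)
  then have "card ?S = n"
    using X card_image[OF inj] by (simp add: arrangement_def)
  moreover have "\<not> small n K T (cell K a) (cell K b) (cell K c)"
    if abc: "a \<in> ?S" "b \<in> ?S" "c \<in> ?S" "a < b" "b < c" for a b c
  proof
    let ?d = "real_of_int \<bar>det3 (cell K a) (cell K b) (cell K c)\<bar>"
    assume "small n K T (cell K a) (cell K b) (cell K c)"
    then have "?d \<le> real T * (real K - 1)\<^sup>2 / real n ^ 3"
      using small_iff_thin[of n K T] n K by (simp add: thin_def)
    then have "?d / (2 * (real K - 1)\<^sup>2) \<le> real T / (2 * real n ^ 3)"
      using K n by (simp add: field_simps)
    moreover have "grid_cell K a \<noteq> grid_cell K b" "grid_cell K a \<noteq> grid_cell K c" "grid_cell K b \<noteq> grid_cell K c"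
      using inj abc by (auto dest!: inj_onD)
    ultimately show False
      using area[of "grid_cell K a" "grid_cell K b" "grid_cell K c"] abc
      by (simp add: triangle_area_grid_cell[OF K])
  qed
  ultimately show ?thesis unfolding spread_sets_def by auto
qed

theorem theorem2:
  fixes U :: tm and \<epsilon> :: real
  assumes "universal_tm U" and "\<epsilon> > 0"
  shows "\<exists>C\<^sub>1>0. \<exists>C\<^sub>0::real.
    \<forall>\<^sub>F n in sequentially. \<forall>\<delta>::nat. 0 < \<delta> \<longrightarrow> real \<delta> < (2 - \<epsilon>) * log 2 (real n) \<longrightarrow>
      (\<forall>\<^sub>F K in sequentially. \<forall>X. arrangement n K X \<longrightarrow>
         real (kolmogorov U (encode_arrangement K X) (encode_pair n K))
           \<ge> log 2 (real (K\<^sup>2 choose n)) - real \<delta> \<longrightarrow>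
         (\<exists>a\<in>X. \<exists>b\<in>X. \<exists>c\<in>X. a \<noteq> b \<and> a \<noteq> c \<and> b \<noteq> c \<and>
            triangle_area a b c
              \<le> (14 * real \<delta> + C\<^sub>0) / (4 * C\<^sub>1 * real n ^ 3 * log 2 (exp 1))))"
proof -
  define D :: nat where "D = 20480000"
  obtain q where q: "\<And>n K v S. S \<in> spread_sets n K (D * v) \<Longrightarrow>
    \<exists>m. 2 ^ m \<le> 2 * card (spread_sets n K (D * v)) \<and>
       kolmogorov U (map (\<lambda>k. k \<in> S) [0..<K * K]) (encode_pair n K) \<le> q + v + m"
    using spread_sets_compression[OF assms(1), of D] by blast
  \<comment> \<open>Makes \<open>v = \<delta> + c\<close> outweigh the machine description
    \<open>q\<close> and the bit lost in rounding the index, and ensures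
    \<open>2 \<le> v\<close>.\<close>
  define c where "c = q + 2"
  \<comment> \<open>Chosen, together with \<open>14 * c\<close> for \<open>C\<^sub>0\<close>, so
    that the required bound becomes the threshold \<open>T / (2 n^3)\<close> with
    \<open>T = D * v\<close>.\<close>
  define C1 where "C1 = 7 / (real D * log 2 (exp 1))"
  have le: "0 < log 2 (exp 1 :: real)" by simp
  have C1: "C1 > 0" unfolding C1_def using le by (simp add: D_def)
  have bound: "(14 * real \<delta> + 14 * real c) / (4 * C1 * real n ^ 3 * log 2 (exp 1))
      = real (D * (\<delta> + c)) / (2 * real n ^ 3)" for \<delta> n
  proof -
    have eq: "4 * C1 * real n ^ 3 * log 2 (exp 1) = 28 * real n ^ 3 / real D"
      using le by (simp add: C1_def D_def field_simps)
    show ?thesis unfolding eq by (cases "n = 0") (simp_all add: field_simps D_def)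
  qed
  have "\<forall>\<^sub>F n in sequentially. \<forall>\<delta>::nat. 0 < \<delta> \<longrightarrow> real \<delta> < (2 - \<epsilon>) * log 2 (real n) \<longrightarrow>
      (\<forall>\<^sub>F K in sequentially. \<forall>X. arrangement n K X \<longrightarrow>
         real (kolmogorov U (encode_arrangement K X) (encode_pair n K))
           \<ge> log 2 (real (K\<^sup>2 choose n)) - real \<delta> \<longrightarrow>
         (\<exists>a\<in>X. \<exists>b\<in>X. \<exists>c'\<in>X. a \<noteq> b \<and> a \<noteq> c' \<and> b \<noteq> c' \<and>
            triangle_area a b c' \<le> real (D * (\<delta> + c)) / (2 * real n ^ 3)))"
    using few_spread_sets[of c, folded D_def] eventually_gt_at_top[of 0]
  proof eventually_elim
    case (elim n)
    note few = elim(1) and n = elim(2)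
    show ?case
    proof (intro allI impI)
      fix \<delta> :: nat assume \<delta>: "0 < \<delta>" "real \<delta> < (2 - \<epsilon>) * log 2 (real n)"
      define v where "v = \<delta> + c"
      have "0 \<le> log 2 (real n)" using n by simp
      then have "(2 - \<epsilon>) * log 2 (real n) \<le> 2 * log 2 (real n)"
        using assms(2) by (intro mult_right_mono) auto
      then have v: "2 \<le> v \<and> real v \<le> 2 * log 2 (real n) + real c"
        using \<delta> by (auto simp: v_def c_def)
      have "\<forall>\<^sub>F K in sequentially. real (card (spread_sets n K (D * v))) \<le> real (K\<^sup>2 choose n) / 2 ^ (3 * v)"
        using few v by blast
      then show "\<forall>\<^sub>F K in sequentially. \<forall>X. arrangement n K X \<longrightarrow>
         real (kolmogorov U (encode_arrangement K X) (encode_pair n K))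
           \<ge> log 2 (real (K\<^sup>2 choose n)) - real \<delta> \<longrightarrow>
         (\<exists>a\<in>X. \<exists>b\<in>X. \<exists>c'\<in>X. a \<noteq> b \<and> a \<noteq> c' \<and> b \<noteq> c' \<and>
            triangle_area a b c' \<le> real (D * (\<delta> + c)) / (2 * real n ^ 3))"
        using eventually_ge_at_top[of 2]
      proof eventually_elim
        case (elim K)
        note cnt = elim(1) and K = elim(2)
        show ?case
        proof (intro allI impI, rule ccontr)
          fix X assume X: "arrangement n K X"
            and compl: "real (kolmogorov U (encode_arrangement K X) (encode_pair n K))
                \<ge> log 2 (real (K\<^sup>2 choose n)) - real \<delta>"
            and no: "\<not> (\<exists>a\<in>X. \<exists>b\<in>X. \<exists>c'\<in>X. a \<noteq> b \<and> a \<noteq> c' \<and> b \<noteq> c' \<and>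
              triangle_area a b c' \<le> real (D * (\<delta> + c)) / (2 * real n ^ 3))"
          define S where "S = {a. a < K * K \<and> grid_cell K a \<in> X}"
          have S: "S \<in> spread_sets n K (D * v)"
            unfolding S_def by (rule arrangement_spread_set[OF X K n]) (use no in \<open>force simp: v_def not_le\<close>)
          have enc: "encode_arrangement K X = map (\<lambda>k. k \<in> S) [0..<K * K]"
            by (auto simp: encode_arrangement_eq S_def)
          obtain m where m: "2 ^ m \<le> 2 * card (spread_sets n K (D * v))"
            "kolmogorov U (encode_arrangement K X) (encode_pair n K) \<le> q + v + m"
            using q[OF S] unfolding enc by blast
          have "real (2 ^ m) \<le> real (2 * card (spread_sets n K (D * v)))"
            using m(1) by (simp only: of_nat_le_iff)
          also have "\<dots> \<le> 2 * (real (K\<^sup>2 choose n) / 2 ^ (3 * v))" using cnt by simp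
          finally have le: "2 ^ m * 2 ^ (3 * v) \<le> 2 * real (K\<^sup>2 choose n)" by (simp add: field_simps)
          have "0 < (2::real) ^ m * 2 ^ (3 * v)" by simp
          then have pos: "0 < real (K\<^sup>2 choose n)" using le by linarith
          have "log 2 (2 ^ m * 2 ^ (3 * v)) \<le> log 2 (2 * real (K\<^sup>2 choose n))"
            using le pos by (subst log_le_cancel_iff) auto
          then have "real m + 3 * real v \<le> 1 + log 2 (real (K\<^sup>2 choose n))"
            using pos by (simp add: log_mult log_nat_power)
          moreover have "real (kolmogorov U (encode_arrangement K X) (encode_pair n K)) \<le> real q + real v + real m"
            using m(2) by linarith
          \<comment> \<open>The program undercuts the logarithm of the binomial coefficient by at
            least \<open>2 * v - q - 1\<close>, which exceeds \<open>\<delta>\<close>.\<close>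
          ultimately have "log 2 (real (K\<^sup>2 choose n)) - real \<delta> \<le> real q + 1 - 2 * real v + log 2 (real (K\<^sup>2 choose n))"
            using compl by linarith
          then show False by (simp add: v_def c_def)
        qed
      qed
    qed
  qed
  then show ?thesis
    using C1 bound by (intro exI[of _ C1] conjI exI[of _ "14 * real c"]) (simp_all only: bound)
qed

end
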